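(* Let $\gamma,\delta\in[0,1]$ with $\gamma$ irrational, and let $\mathbf{u}$ be a word coding the two interval exchange transformation with parameters $\ell_0 = 1-\gamma$, $\ell_1 = \gamma$, $\rho = \delta$. If $\mathbf{u}$ is fixed by a primitive substitution $\varphi$, then $\varphi$ is closeable under derivation if and only if $\delta\in\{0,\gamma,1-\gamma,1\}$.
   Context: Two interval exchange coding: given $\ell_0,\ell_1>0$, take either $I=[0,\ell_0+\ell_1)$, $I_0=[0,\ell_0)$, $I_1=[\ell_0,\ell_0+\ell_1)$ (lower case) or $I=(0,\ell_0+\ell_1]$, $I_0=(0,\ell_0]$, $I_1=(\ell_0,\ell_0+\ell_1]$ (upper case); $T(x)=x+\ell_1$ on $I_0$ and $T(x)=x-\ell_0$ on $I_1$; for $\rho\in I$ the coding is $u_n=0$ if $T^n(\rho)\in I_0$, $u_n=1$ if $T^n(\rho)\in I_1$. A morphism is primitive if some power maps every letter to a word containing every letter; a substitution is a morphism $\psi$ with a letter $c$ such that $\psi(c)=cx$, $x$ nonempty, $|\psi^n(c)|\to\infty$. Derived word: for a uniformly recurrent word $\mathbf{u}$ and factor $v$, a return word of $v$ is a factor $r$ such that $rv$ is a factor in which $v$ occurs exactly twice (as prefix and suffix); with $r_0,\dots,r_k$ all return words and $\mathbf{u}=p\,r_{s_0}r_{s_1}\cdots$, $|p|$ the first occurrence of $v$, $\mathbf{d}_{\mathbf{u}}(v)=s_0s_1\cdots$, up to permutation of letters. A finite set $M$ of primitive substitutions is closed under derivation if for every $\varphi\in M$, every fixed point $\mathbf{u}$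 of $\varphi$ and every factor $v$ of $\mathbf{u}$, $\mathbf{d}_{\mathbf{u}}(v)$ is fixed by some primitive substitution $\psi\in M$; a primitive substitution is closeable under derivation if it belongs to some finite set closed under derivation. *)

theory Defs
  imports Complex_Main "HOL-Library.Infinite_Set"
begin

text \<open>Infinite words are functions nat => nat; finite words are lists of nat.
  A morphism is a pair (A, phi) of a finite alphabet A and a map phi on letters.\<close>

definition mimage :: "(nat \<Rightarrow> nat list) \<Rightarrow> nat list \<Rightarrow> nat list" where
  "mimage \<phi> w = concat (map \<phi> w)"

definition primitive_morphism :: "nat set \<Rightarrow> (nat \<Rightarrow> nat list) \<Rightarrow> bool" where
  "primitive_morphism A \<phi> \<longleftrightarrow> finite A \<and> A \<noteq> {} \<and> (\<forall>a\<in>A. set (\<phi> a) \<subseteq> A) \<and>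
     (\<exists>k\<ge>1. \<forall>a\<in>A. \<forall>b\<in>A. b \<in> set ((mimage \<phi> ^^ k) [a]))"

definition substitution :: "nat set \<Rightarrow> (nat \<Rightarrow> nat list) \<Rightarrow> bool" where
  "substitution A \<phi> \<longleftrightarrow> (\<forall>a\<in>A. set (\<phi> a) \<subseteq> A) \<and>
     (\<exists>c\<in>A. \<exists>x. x \<noteq> [] \<and> \<phi> c = c # x \<and>
        filterlim (\<lambda>n. length ((mimage \<phi> ^^ n) [c])) at_top sequentially)"

definition primitive_substitution :: "nat set \<Rightarrow> (nat \<Rightarrow> nat list) \<Rightarrow> bool" where
  "primitive_substitution A \<phi> \<longleftrightarrow> primitive_morphism A \<phi> \<and> substitution A \<phi>"

text \<open>u is fixed by phi: u is over A and phi(u) = u, i.e. phi(u_0 ... u_(n-1)) is a prefix of u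
  for every n (for non-erasing phi this is exactly phi(u) = u).\<close>
definition fixed_point :: "nat set \<Rightarrow> (nat \<Rightarrow> nat list) \<Rightarrow> (nat \<Rightarrow> nat) \<Rightarrow> bool" where
  "fixed_point A \<phi> u \<longleftrightarrow> (\<forall>n. u n \<in> A) \<and>
     (\<forall>n. \<forall>i < length (mimage \<phi> (map u [0..<n])). mimage \<phi> (map u [0..<n]) ! i = u i)"

definition occurs_at :: "(nat \<Rightarrow> nat) \<Rightarrow> nat list \<Rightarrow> nat \<Rightarrow> bool" where
  "occurs_at u v i \<longleftrightarrow> (\<forall>j < length v. u (i + j) = v ! j)"

definition factor :: "nat list \<Rightarrow> (nat \<Rightarrow> nat) \<Rightarrow> bool" where
  "factor v u \<longleftrightarrow> (\<exists>i. occurs_at u v i)"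

definition occ :: "(nat \<Rightarrow> nat) \<Rightarrow> nat list \<Rightarrow> nat \<Rightarrow> nat" where
  "occ u v = enumerate {i. occurs_at u v i}"

definition return_seq :: "(nat \<Rightarrow> nat) \<Rightarrow> nat list \<Rightarrow> nat \<Rightarrow> nat list" where
  "return_seq u v n = map u [occ u v n..<occ u v (Suc n)]"

text \<open>d is (a representative, up to permutation of letters, of) the derived word d_u(v):
  its letters are 0..k, where k+1 is the number of distinct return words, and letters
  code return words bijectively.\<close>
definition derived_word :: "(nat \<Rightarrow> nat) \<Rightarrow> nat list \<Rightarrow> (nat \<Rightarrow> nat) \<Rightarrow> bool" where
  "derived_word u v d \<longleftrightarrow> infinite {i. occurs_at u v i} \<and>
     range d = {..<card (range (return_seq u v))} \<and>
     (\<exists>\<theta>. inj_on \<theta> (range d) \<and> (\<forall>n. \<theta> (d n) = return_seq u v n))"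

definition closed_under_derivation :: "(nat set \<times> (nat \<Rightarrow> nat list)) set \<Rightarrow> bool" where
  "closed_under_derivation M \<longleftrightarrow> finite M \<and>
     (\<forall>(A, \<phi>)\<in>M. primitive_substitution A \<phi>) \<and>
     (\<forall>(A, \<phi>)\<in>M. \<forall>u. fixed_point A \<phi> u \<longrightarrow>
        (\<forall>v. v \<noteq> [] \<and> factor v u \<longrightarrow>
          (\<exists>d. derived_word u v d \<and> (\<exists>(B, \<psi>)\<in>M. fixed_point B \<psi> d))))"

definition closeable_under_derivation :: "nat set \<Rightarrow> (nat \<Rightarrow> nat list) \<Rightarrow> bool" where
  "closeable_under_derivation A \<phi> \<longleftrightarrow>
     primitive_substitution A \<phi> \<and> (\<exists>M. closed_under_derivation M \<and> (A, \<phi>) \<in> M)"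

text \<open>Two interval exchange: lower case I = [0, l0+l1), upper case I = (0, l0+l1].\<close>
definition T_lower :: "real \<Rightarrow> real \<Rightarrow> real \<Rightarrow> real" where
  "T_lower l0 l1 x = (if x < l0 then x + l1 else x - l0)"

definition T_upper :: "real \<Rightarrow> real \<Rightarrow> real \<Rightarrow> real" where
  "T_upper l0 l1 x = (if x \<le> l0 then x + l1 else x - l0)"

definition coding_2iet :: "real \<Rightarrow> real \<Rightarrow> real \<Rightarrow> (nat \<Rightarrow> nat) \<Rightarrow> bool" where
  "coding_2iet l0 l1 \<rho> u \<longleftrightarrow>
     (0 \<le> \<rho> \<and> \<rho> < l0 + l1 \<and>
       (\<forall>n. u n = (if (T_lower l0 l1 ^^ n) \<rho> < l0 then 0 else 1))) \<or>
     (0 < \<rho> \<and> \<rho> \<le> l0 + l1 \<and>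
       (\<forall>n. u n = (if (T_upper l0 l1 ^^ n) \<rho> \<le> l0 then 0 else 1)))"

end

theory Submission
  imports Defs "HOL-Analysis.Kronecker_Approximation_Theorem"
begin

text \<open>Let \<open>u\<close> code the orbit of \<open>\<delta>\<close> under the rotation by \<open>\<gamma>\<close>. A power \<open>\<Phi>\<close> of the substitution fixing
  \<open>u\<close> acts on displacements as multiplication by some \<open>lam\<close> in \<open>(0, 1)\<close>, so the blocks of
  \<open>u = \<Phi>(u)\<close> start exactly when the orbit visits \<open>J = F [0, 1)\<close>, where \<open>F x = (1 - lam) \<delta> + lam x\<close>.
  Since 0 must be an end of a floor of the towers over \<open>J\<close>, we get \<open>F 0 = - i \<gamma>\<close> modulo 1 with
  \<open>- |\<Phi> 1| < i < |\<Phi> 0|\<close>, and multiplication by \<open>lam\<close> is an automorphism of \<open>\<int> + \<int>\<gamma>\<close>.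

  If the substitution is closeable, the word read around all block boundaries, which starts
  \<open>|\<Phi> 0| - 1 - i\<close> letters before the boundary, has a shift of \<open>u\<close> as derived word. The shift is proper
  unless \<open>i = |\<Phi> 0| - 1\<close>, that is unless \<open>\<delta> = \<gamma>\<close>. As a finite set has finitely many fixed points,
  iterating reaches \<open>\<gamma>\<close>, so \<open>\<delta> = - k \<gamma>\<close> modulo 1 for some \<open>k \<ge> -1\<close>; the bound on \<open>i\<close> excludes
  \<open>k \<ge> 2\<close>.

  Conversely, let \<open>c\<close> be the characteristic word of slope \<open>\<gamma>\<close>. Special points are coded by
  \<open>c, 0c, 1c, 01c, 10c\<close>. The matrix of \<open>\<Phi>\<close> lies in \<open>SL\<^sub>2(\<nat>)\<close> and fixes the slope, so \<open>\<gamma>\<close> is purely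
  periodic under the Farey map. Desubstitution by \<open>0 \<mapsto> 0, 1 \<mapsto> 01\<close> (or its mirror image) shows that
  derived words of special words are \<open>c', 0c', 1c'\<close> for slopes in the finite Farey orbit, and these are
  fixed by compositions of elementary substitutions.\<close>

section \<open>Words and morphisms\<close>

text \<open>Return words are hardly ever listed. The derived word for the empty factor is the word
  itself, and an increasing map that carries occurrences to occurrences and return words injectively
  to return words preserves derived words; so each computation of a derived word comes down to
  matching occurrences. The word read around the block boundaries must occur nowhere else. Two of
  its letters ensure this: one says that the orbit point is not left of \<open>J\<close>, the other
  that it is not right of it. Its length \<open>p + q - 2\<close> counts the offsets at which no
  discontinuity of the coding falls inside the translate of \<open>J\<close>. This count needs every
  point of the module to be \<open>lam\<close> times a point of the module, which is why the module
  is treated before the words. A substitution may reverse the orientation of the line; an even power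
  does not, which makes \<open>lam\<close> positive. The reflection \<open>x \<mapsto> 1 - x\<close>
  exchanges the letters, the slopes \<gamma> and \<open>1 - \<gamma>\<close> and the two conventions
  on interval ends. It absorbs the permutation of letters in derived words and halves the Farey
  analysis.\<close>

abbreviation seg :: "(nat \<Rightarrow> nat) \<Rightarrow> nat \<Rightarrow> nat \<Rightarrow> nat list" where
  "seg u i j \<equiv> map u [i..<j]"

text \<open>Prefixes replace the infinite concatenation
  \<open>\<phi> (w 0) \<phi> (w 1) ...\<close>. The two words are kept apart because desubstitution
  relates words of different slopes.\<close>

definition maps_to :: "(nat \<Rightarrow> nat list) \<Rightarrow> (nat \<Rightarrow> nat) \<Rightarrow> (nat \<Rightarrow> nat) \<Rightarrow> bool" where
  "maps_to \<phi> w u \<longleftrightarrow> (\<forall>n. mimage \<phi> (seg w 0 n) = seg u 0 (length (mimage \<phi> (seg w 0 n))))"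

definition cut :: "(nat \<Rightarrow> nat list) \<Rightarrow> (nat \<Rightarrow> nat) \<Rightarrow> nat \<Rightarrow> nat" where
  "cut \<phi> w n = length (mimage \<phi> (seg w 0 n))"

lemma mimage_simps [simp]:
  "mimage \<phi> [] = []" "mimage \<phi> (a # x) = \<phi> a @ mimage \<phi> x"
  "mimage \<phi> (x @ y) = mimage \<phi> x @ mimage \<phi> y"
  by (simp_all add: mimage_def)

lemma seg_append: "i \<le> j \<Longrightarrow> j \<le> k \<Longrightarrow> seg u i j @ seg u j k = seg u i k"
  by (metis le_add_diff_inverse map_append upt_add_eq_append)

lemma eq_seg_iff: "x = seg u 0 (length x) \<longleftrightarrow> (\<forall>i<length x. x ! i = u i)"
  by (subst list_eq_iff_nth_eq) simp

lemma fixed_point_iff: "fixed_point A \<phi> u \<longleftrightarrow> range u \<subseteq> A \<and> maps_to \<phi> u u"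
  unfolding fixed_point_def maps_to_def eq_seg_iff by auto

lemma cut_0 [simp]: "cut \<phi> w 0 = 0"
  by (simp add: cut_def)

lemma cut_Suc: "cut \<phi> w (Suc n) = cut \<phi> w n + length (\<phi> (w n))"
  by (simp add: cut_def)

lemma cut_mono: "i \<le> j \<Longrightarrow> cut \<phi> w i \<le> cut \<phi> w j"
  by (rule lift_Suc_mono_le) (auto simp: cut_Suc)

lemma strict_mono_cut: "(\<And>n. \<phi> (w n) \<noteq> []) \<Longrightarrow> strict_mono (cut \<phi> w)"
  by (simp add: strict_mono_Suc_iff cut_Suc)

lemma maps_to_seg:
  assumes "maps_to \<phi> w u" "i \<le> j"
  shows "mimage \<phi> (seg w i j) = seg u (cut \<phi> w i) (cut \<phi> w j)"
proof -
  have *: "mimage \<phi> (seg w 0 n) = seg u 0 (cut \<phi> w n)" for n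
    using assms(1) unfolding maps_to_def cut_def by blast
  have "seg u 0 (cut \<phi> w i) @ mimage \<phi> (seg w i j) = seg u 0 (cut \<phi> w j)"
    using *[of i] *[of j] seg_append[of 0 i j w] assms(2)
    by (metis le0 mimage_simps(3))
  also have "\<dots> = seg u 0 (cut \<phi> w i) @ seg u (cut \<phi> w i) (cut \<phi> w j)"
    using seg_append[of 0 "cut \<phi> w i" "cut \<phi> w j" u] cut_mono[OF assms(2)] by simp
  finally show ?thesis by simp
qed

lemma maps_to_block: "maps_to \<phi> w u \<Longrightarrow> seg u (cut \<phi> w n) (cut \<phi> w (Suc n)) = \<phi> (w n)"
  using maps_to_seg[of \<phi> w u n "Suc n"] by simp

lemma maps_to_nth:
  assumes "maps_to \<phi> w u" "j < length (\<phi> (w n))"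
  shows "u (cut \<phi> w n + j) = \<phi> (w n) ! j"
proof -
  have "seg u (cut \<phi> w n) (cut \<phi> w (Suc n)) ! j = u (cut \<phi> w n + j)"
    using assms(2) by (simp add: cut_Suc)
  then show ?thesis using maps_to_block[OF assms(1)] by simp
qed

lemma maps_toI_blocks:
  assumes "\<And>n. \<phi> (w n) = seg u (cut \<phi> w n) (cut \<phi> w (Suc n))"
  shows "maps_to \<phi> w u"
  unfolding maps_to_def cut_def[symmetric]
proof
  fix n show "mimage \<phi> (seg w 0 n) = seg u 0 (cut \<phi> w n)"
  proof (induction n)
    case (Suc n)
    then show ?case
      using assms[of n] seg_append[of 0 "cut \<phi> w n" "cut \<phi> w (Suc n)" u]
        cut_mono[of n "Suc n" \<phi> w] by simp
  qed simp
qed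

lemma mimage_mimage: "mimage \<phi> (mimage \<psi> x) = mimage (\<lambda>a. mimage \<phi> (\<psi> a)) x"
  by (induction x) simp_all

lemma maps_to_comp:
  assumes "maps_to \<phi> w u" "maps_to \<psi> w' w"
  shows "maps_to (\<lambda>a. mimage \<phi> (\<psi> a)) w' u"
  unfolding maps_to_def
proof
  fix n
  have "mimage (\<lambda>a. mimage \<phi> (\<psi> a)) (seg w' 0 n) = mimage \<phi> (seg w 0 (cut \<psi> w' n))"
    using maps_to_seg[OF assms(2), of 0 n] by (simp flip: mimage_mimage)
  also have "\<dots> = seg u 0 (cut \<phi> w (cut \<psi> w' n))"
    using maps_to_seg[OF assms(1), of 0 "cut \<psi> w' n"] by simp
  finally show "mimage (\<lambda>a. mimage \<phi> (\<psi> a)) (seg w' 0 n) =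
      seg u 0 (length (mimage (\<lambda>a. mimage \<phi> (\<psi> a)) (seg w' 0 n)))" by simp
qed

lemma cut_cover:
  assumes "\<And>n. \<phi> (w n) \<noteq> []"
  obtains m j where "k = cut \<phi> w m + j" "j < length (\<phi> (w m))"
proof -
  have "\<exists>m j. k = cut \<phi> w m + j \<and> j < length (\<phi> (w m))"
  proof (induction k)
    case 0 then show ?case using assms[of 0] by (intro exI[of _ 0]) simp
  next
    case (Suc k)
    then obtain m j where *: "k = cut \<phi> w m + j" "j < length (\<phi> (w m))" by blast
    show ?case
    proof (cases "Suc j < length (\<phi> (w m))")
      case True then show ?thesis using * by (intro exI[of _ m] exI[of _ "Suc j"]) simp
    next
      case False
      then have "Suc k = cut \<phi> w (Suc m)" using * by (simp add: cut_Suc)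
      then show ?thesis using assms[of "Suc m"] by (intro exI[of _ "Suc m"] exI[of _ 0]) simp
    qed
  qed
  then show thesis using that by blast
qed

text \<open>Since the first image has at least two letters and no image is empty, the image of a
  nonempty prefix is strictly longer than the prefix, so each letter is determined by the earlier
  ones.\<close>

lemma maps_to_unique:
  assumes "maps_to \<phi> w w" "maps_to \<phi> w' w'" "w 0 = w' 0" "length (\<phi> (w 0)) \<ge> 2"
    and ne: "\<And>n. \<phi> (w n) \<noteq> []"
  shows "w = w'"
proof
  fix k
  have cut: "cut \<phi> w n > n" if "n > 0" for n
    using that
  proof (induction n)
    case (Suc n)
    have "length (\<phi> (w n)) > 0" using ne by simp
    then show ?case using Suc assms(4) unfolding cut_Suc
      by (cases "n = 0") (auto simp del: length_greater_0_conv)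
  qed simp
  show "w k = w' k"
  proof (induction k rule: less_induct)
    case (less k)
    show ?case
    proof (cases "k = 0")
      case False
      have eq: "seg w 0 k = seg w' 0 k" using less by simp
      then have c: "cut \<phi> w k = cut \<phi> w' k" unfolding cut_def by (rule arg_cong)
      have "seg w 0 (cut \<phi> w k) = seg w' 0 (cut \<phi> w k)"
        using maps_to_seg[OF assms(1), of 0 k] maps_to_seg[OF assms(2), of 0 k] eq c by simp
      then show ?thesis using cut[of k] False
        by (metis atLeastLessThan_iff gr0I le0 map_eq_conv set_upt)
    qed (use assms in simp)
  qed
qed

section \<open>Derived words\<close>

lemma strict_mono_range_unique:
  fixes f g :: "nat \<Rightarrow> nat"
  assumes "strict_mono f" "strict_mono g" "range f = range g"
  shows "f = g"
proof
  fix n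
  have aux: "f' k \<le> g' k"
    if f': "strict_mono f'" and g': "strict_mono g'" and sub: "range g' \<subseteq> range f'"
      and eq: "\<And>i. i < k \<Longrightarrow> f' i = g' i"
    for f' g' :: "nat \<Rightarrow> nat" and k
  proof -
    obtain m where m: "g' k = f' m" using sub by blast
    have "\<not> m < k" using eq[of m] m strict_monoD[OF g', of m k] by auto
    then show ?thesis using m strict_mono_mono[OF f'] by (simp add: monoD)
  qed
  show "f n = g n"
  proof (induction n rule: less_induct)
    case (less n)
    then show ?case using aux[of f g n] aux[of g f n] assms by (simp add: le_antisym)
  qed
qed

lemma occ_image:
  assumes "strict_mono N" "{i. occurs_at u v i} = N ` {i. occurs_at u1 v1 i}"
    "infinite {i. occurs_at u1 v1 i}"
  shows "occ u v n = N (occ u1 v1 n)"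
proof -
  have inf: "infinite {i. occurs_at u v i}"
    using assms by (simp add: finite_image_iff strict_mono_imp_inj_on)
  have "enumerate {i. occurs_at u v i} = N \<circ> enumerate {i. occurs_at u1 v1 i}"
  proof (rule strict_mono_range_unique)
    show "strict_mono (enumerate {i. occurs_at u v i})"
      using inf by (rule strict_mono_enumerate)
    show "strict_mono (N \<circ> enumerate {i. occurs_at u1 v1 i})"
      using assms(1) strict_mono_enumerate[OF assms(3)] by (rule strict_mono_o)
    show "range (enumerate {i. occurs_at u v i}) = range (N \<circ> enumerate {i. occurs_at u1 v1 i})"
      by (metis assms(2,3) image_comp inf range_enumerate)
  qed
  then show ?thesis by (simp add: occ_def)
qed

lemma occ_in: "infinite {i. occurs_at u v i} \<Longrightarrow> occurs_at u v (occ u v n)"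
  using enumerate_in_set[of "{i. occurs_at u v i}" n] by (simp add: occ_def)

lemma occ_less: "infinite {i. occurs_at u v i} \<Longrightarrow> occ u v n < occ u v (Suc n)"
  by (simp add: occ_def enumerate_step)

text \<open>A derived word records only which return words coincide. The coding
  \<open>\<theta>\<close> of one side becomes a coding of the other by composition with
  \<open>g\<close> or its inverse.\<close>

lemma derived_word_transfer:
  assumes N: "strict_mono N" and occ: "{i. occurs_at u v i} = N ` {i. occurs_at u1 v1 i}"
    and g: "\<And>n. return_seq u v n = g (return_seq u1 v1 n)"
    and inj: "inj_on g (range (return_seq u1 v1))"
  shows "derived_word u v d \<longleftrightarrow> derived_word u1 v1 d"
proof -
  let ?R = "range (return_seq u1 v1)"
  have inf: "infinite {i. occurs_at u v i} \<longleftrightarrow> infinite {i. occurs_at u1 v1 i}"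
    unfolding occ using N by (simp add: finite_image_iff strict_mono_imp_inj_on)
  have rng: "range (return_seq u v) = g ` ?R" using g by auto
  have card: "card (range (return_seq u v)) = card ?R"
    unfolding rng using inj by (rule card_image)
  have "(\<exists>\<theta>. inj_on \<theta> (range d) \<and> (\<forall>n. \<theta> (d n) = return_seq u v n)) \<longleftrightarrow>
        (\<exists>\<theta>. inj_on \<theta> (range d) \<and> (\<forall>n. \<theta> (d n) = return_seq u1 v1 n))" (is "?A \<longleftrightarrow> ?B")
  proof
    assume ?A
    then obtain \<theta> where \<theta>: "inj_on \<theta> (range d)" "\<And>n. \<theta> (d n) = return_seq u v n" by blast
    have "inv_into ?R g (\<theta> (d n)) = return_seq u1 v1 n" for n
      by (simp add: \<theta> g inv_into_f_f[OF inj])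
    moreover have "inj_on (inv_into ?R g \<circ> \<theta>) (range d)"
      by (rule comp_inj_on[OF \<theta>(1)]) (auto simp: \<theta> g intro!: inj_on_inv_into)
    ultimately show ?B by (metis comp_apply)
  next
    assume ?B
    then obtain \<theta> where \<theta>: "inj_on \<theta> (range d)" "\<And>n. \<theta> (d n) = return_seq u1 v1 n" by blast
    have "\<theta> ` range d = ?R" using \<theta>(2) by (auto simp: image_image)
    then have "inj_on (g \<circ> \<theta>) (range d)" using \<theta>(1) inj by (simp add: comp_inj_on)
    moreover have "(g \<circ> \<theta>) (d n) = return_seq u v n" for n by (simp add: \<theta> g)
    ultimately show ?A by blast
  qed
  then show ?thesis unfolding derived_word_def inf card by blast
qed

text \<open>The conditions on \<open>g\<close> concern arbitrary pairs of occurrences instead of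
  consecutive ones, so that \<open>occ\<close> need not be computed in applications.\<close>

lemma derived_word_transfer_seg:
  assumes N: "strict_mono N" and occ: "{i. occurs_at u v i} = N ` {i. occurs_at u1 v1 i}"
    and g: "\<And>i j. i < j \<Longrightarrow> occurs_at u1 v1 i \<Longrightarrow> occurs_at u1 v1 j \<Longrightarrow>
              seg u (N i) (N j) = g (seg u1 i j)"
    and inj: "\<And>i j i' j'. i < j \<Longrightarrow> occurs_at u1 v1 i \<Longrightarrow> occurs_at u1 v1 j \<Longrightarrow>
              i' < j' \<Longrightarrow> occurs_at u1 v1 i' \<Longrightarrow> occurs_at u1 v1 j' \<Longrightarrow>
              g (seg u1 i j) = g (seg u1 i' j') \<Longrightarrow> seg u1 i j = seg u1 i' j'"
    and d: "derived_word u1 v1 d"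
  shows "derived_word u v d"
proof -
  have inf: "infinite {i. occurs_at u1 v1 i}" using d by (simp add: derived_word_def)
  note o = occ_less[OF inf] occ_in[OF inf]
  show ?thesis
  proof (rule iffD2[OF derived_word_transfer[OF N occ] d])
    show "return_seq u v n = g (return_seq u1 v1 n)" for n
      using g[OF o(1,2,2), of n] by (simp add: return_seq_def occ_image[OF N occ inf])
    show "inj_on g (range (return_seq u1 v1))"
      by (rule inj_onI) (auto simp: return_seq_def intro: inj o)
  qed
qed

lemma occurs_at_Nil [simp]: "occurs_at u [] i"
  by (simp add: occurs_at_def)

lemma occ_Nil: "occ u [] = id"
proof (rule strict_mono_range_unique)
  have U: "{i. occurs_at u [] i} = UNIV" by simp
  show "strict_mono (occ u [])" "range (occ u []) = range id"
    unfolding occ_def U by (simp_all add: strict_mono_enumerate range_enumerate)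
qed (simp add: strict_mono_def)

lemma return_seq_Nil [simp]: "return_seq u [] n = [u n]"
  by (simp add: return_seq_def occ_Nil)

lemma card_letters: "range w = {0, 1::nat} \<Longrightarrow> card (range (\<lambda>n. [w n])) = 2"
proof -
  assume w: "range w = {0, 1::nat}"
  have "range (\<lambda>n. [w n]) = (\<lambda>a. [a]) ` range w" by auto
  then show ?thesis using w by (simp add: card_image inj_on_def)
qed

text \<open>The return words of the empty factor are the single letters. This is where the repeated
  desubstitution of a factor ends.\<close>

lemma derived_word_Nil:
  assumes "range w = {0, 1::nat}"
  shows "derived_word w [] w"
proof -
  have r: "return_seq w [] = (\<lambda>n. [w n])" by (rule ext) simp
  have "range w = {..<card (range (return_seq w []))}"
    unfolding r card_letters[OF assms] assms by auto
  moreover have "\<exists>\<theta>. inj_on \<theta> (range w) \<and> (\<forall>n. \<theta> (w n) = return_seq w [] n)"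
    by (rule exI[of _ "\<lambda>a. [a]"]) (simp add: inj_on_def)
  moreover have "{i. occurs_at w [] i} = UNIV" by simp
  ultimately show ?thesis unfolding derived_word_def by (metis infinite_UNIV_nat)
qed

definition swap01 :: "nat \<Rightarrow> nat" where
  "swap01 a = (if a = 0 then 1 else if a = 1 then 0 else a)"

lemma swap01_simps [simp]: "swap01 0 = 1" "swap01 (Suc 0) = 0" "swap01 (swap01 a) = a"
  by (auto simp: swap01_def)

lemma inj_swap01: "inj_on swap01 X"
  by (metis inj_on_def swap01_simps(3))

lemma swap01_eq_iff [simp]: "swap01 a = swap01 b \<longleftrightarrow> a = b"
  by (metis swap01_simps(3))

lemma derived_word_Nil_cases:
  assumes "derived_word w [] d" "range w = {0, 1::nat}"
  shows "d = w \<or> d = swap01 \<circ> w"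
proof -
  obtain \<theta> where \<theta>: "inj_on \<theta> (range d)" "\<And>n. \<theta> (d n) = [w n]"
    using assms(1) by (auto simp: derived_word_def)
  have rd: "range d = {0, 1}"
    using assms card_letters[OF assms(2)] by (auto simp: derived_word_def return_seq_Nil[abs_def])
  have eq: "d m = d n \<longleftrightarrow> w m = w n" for m n
    using \<theta> by (metis inj_on_eq_iff list.inject rangeI)
  have d01: "d n = 0 \<or> d n = 1" and w01: "w n = 0 \<or> w n = 1" for n
    using rangeI[of d n] rangeI[of w n] unfolding rd assms(2) by auto
  show ?thesis
  proof (cases "d 0 = w 0")
    case True
    then have "d n = w n" for n using eq[of n 0] d01[of n] w01[of n] d01[of 0] w01[of 0] by auto
    then show ?thesis by auto
  next
    case False
    then have "d n = swap01 (w n)" for n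
      using eq[of n 0] d01[of n] w01[of n] d01[of 0] w01[of 0] by auto
    then show ?thesis by auto
  qed
qed

lemma occurs_at_swap: "occurs_at (swap01 \<circ> u) (map swap01 v) i \<longleftrightarrow> occurs_at u v i"
  by (auto simp: occurs_at_def)

lemma derived_word_swap: "derived_word (swap01 \<circ> u) (map swap01 v) d \<longleftrightarrow> derived_word u v d"
proof (rule derived_word_transfer[where N = id and g = "map swap01"])
  show "return_seq (swap01 \<circ> u) (map swap01 v) n = map swap01 (return_seq u v n)" for n
    by (simp add: return_seq_def occ_def occurs_at_swap)
  show "inj_on (map swap01) (range (return_seq u v))"
    by (rule inj_on_mapI) (rule inj_swap01)
qed (auto simp: occurs_at_swap strict_mono_def)

section \<open>Codings of irrational rotations\<close>

text \<open>The flag \<open>f\<close> selects the convention on interval ends: \<open>pos f (x - a) \<and> \<not> pos f (x - b)\<close>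
  says \<open>x \<in> [a, b)\<close> for the lower exchange (\<open>f\<close> true) and \<open>x \<in> (a, b]\<close> for the upper one.\<close>
definition pos :: "bool \<Rightarrow> real \<Rightarrow> bool" where
  "pos f t \<longleftrightarrow> (if f then 0 \<le> t else 0 < t)"

definition rot :: "bool \<Rightarrow> real \<Rightarrow> real \<Rightarrow> real" where
  "rot f \<gamma> x = (if pos f (x - (1 - \<gamma>)) then x - (1 - \<gamma>) else x + \<gamma>)"

definition code :: "bool \<Rightarrow> real \<Rightarrow> real \<Rightarrow> nat \<Rightarrow> nat" where
  "code f \<gamma> \<rho> n = (if pos f ((rot f \<gamma> ^^ n) \<rho> - (1 - \<gamma>)) then 1 else 0)"

text \<open>The displacement of a point along an orbit segment coded by \<open>w\<close>.\<close>
definition ht :: "real \<Rightarrow> nat list \<Rightarrow> real" where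
  "ht \<gamma> w = real (length w) * \<gamma> - real (length (filter (\<lambda>a. a \<noteq> 0) w))"

lemma pos_mono: "pos f s \<Longrightarrow> s \<le> t \<Longrightarrow> pos f t"
  by (auto simp: pos_def split: if_splits)

lemma pos_ge: "pos f t \<Longrightarrow> 0 \<le> t"
  by (auto simp: pos_def split: if_splits)

lemma not_pos_le: "\<not> pos f t \<Longrightarrow> t \<le> 0"
  by (auto simp: pos_def split: if_splits)

lemma pos_gt: "0 < t \<Longrightarrow> pos f t"
  by (auto simp: pos_def)

lemma not_pos_lt: "t < 0 \<Longrightarrow> \<not> pos f t"
  by (auto simp: pos_def)

lemma pos_scale: "0 < c \<Longrightarrow> pos f (c * t) \<longleftrightarrow> pos f t"
  by (auto simp: pos_def zero_le_mult_iff zero_less_mult_iff)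

lemma pos_uminus: "pos (\<not> f) (- t) \<longleftrightarrow> \<not> pos f t"
  by (auto simp: pos_def)

text \<open>A half-open unit interval has one representative of each class modulo 1, whichever end
  is missing. Congruences between orbit points become equations this way.\<close>

lemma pos_unit_unique:
  assumes "pos f x" "\<not> pos f (x - 1)" "pos f x'" "\<not> pos f (x' - 1)" "x' = x + of_int k"
  shows "x' = x"
proof -
  have "\<not> 1 \<le> k" using assms pos_mono[of f x "x' - 1"] by auto
  moreover have "\<not> k \<le> -1" using assms pos_mono[of f x' "x - 1"]
    by (metis add.commute add_le_cancel_left add_uminus_conv_diff of_int_1 of_int_le_iff of_int_minus uminus_add_conv_diff le_diff_eq)
  ultimately have "k = 0" by linarith
  then show ?thesis using assms by simp
qed

lemma ht_simps [simp]:
  "ht \<gamma> [] = 0" "ht \<gamma> (a # w) = (if a = 0 then \<gamma> else \<gamma> - 1) + ht \<gamma> w"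
  by (auto simp: ht_def algebra_simps)

lemma ht_append [simp]: "ht \<gamma> (v @ w) = ht \<gamma> v + ht \<gamma> w"
  by (auto simp: ht_def algebra_simps)

lemma ht_int: "\<exists>k::int. ht \<gamma> w = of_int (int (length w)) * \<gamma> - of_int k"
  unfolding ht_def by (rule exI[of _ "int (length (filter (\<lambda>a. a \<noteq> 0) w))"]) simp

lemma irrational_lin:
  assumes "\<gamma> \<notin> \<rat>" "of_int a * \<gamma> = of_int b"
  shows "a = 0"
proof (rule ccontr)
  assume "a \<noteq> 0"
  then have "\<gamma> = of_int b / of_int a" using assms(2) by (simp add: field_simps)
  then show False using assms(1) by (metis Rats_divide Rats_of_int)
qed

lemma coding_2iet_iff:
  "coding_2iet (1 - \<gamma>) \<gamma> \<rho> u \<longleftrightarrow> (\<exists>f. pos f \<rho> \<and> \<not> pos f (\<rho> - 1) \<and> u = code f \<gamma> \<rho>)"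
proof -
  have l: "T_lower (1 - \<gamma>) \<gamma> = rot True \<gamma>"
    by (auto simp: T_lower_def rot_def pos_def fun_eq_iff)
  have r: "T_upper (1 - \<gamma>) \<gamma> = rot False \<gamma>"
    by (auto simp: T_upper_def rot_def pos_def fun_eq_iff)
  have cl: "code True \<gamma> \<rho> n = (if (rot True \<gamma> ^^ n) \<rho> < 1 - \<gamma> then 0 else 1)" for n
    by (auto simp: code_def pos_def)
  have cr: "code False \<gamma> \<rho> n = (if (rot False \<gamma> ^^ n) \<rho> \<le> 1 - \<gamma> then 0 else 1)" for n
    by (auto simp: code_def pos_def)
  show ?thesis
    unfolding coding_2iet_def l r cl[symmetric] cr[symmetric] ex_bool_eq
    by (auto simp: pos_def fun_eq_iff)
qed

lemma rot_swap: "rot (\<not> f) (1 - \<gamma>) (1 - x) = 1 - rot f \<gamma> x"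
  using pos_uminus[of f "x - (1 - \<gamma>)"] by (auto simp: rot_def algebra_simps)

text \<open>The reflection of the unit interval conjugates the two rotations; it reverses the order,
  so a closed left end becomes a closed right end and the flag is negated.\<close>

lemma code_swap: "code (\<not> f) (1 - \<gamma>) (1 - \<rho>) = swap01 \<circ> code f \<gamma> \<rho>"
proof
  fix n
  have "(rot (\<not> f) (1 - \<gamma>) ^^ n) (1 - \<rho>) = 1 - (rot f \<gamma> ^^ n) \<rho>"
    by (induction n) (simp_all add: rot_swap)
  then have "(rot (\<not> f) (1 - \<gamma>) ^^ n) (1 - \<rho>) - (1 - (1 - \<gamma>)) = - ((rot f \<gamma> ^^ n) \<rho> - (1 - \<gamma>))"
    by simp
  then show "code (\<not> f) (1 - \<gamma>) (1 - \<rho>) n = (swap01 \<circ> code f \<gamma> \<rho>) n"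
    unfolding code_def by (simp only: pos_uminus) simp
qed

lemma code_shift: "code f \<gamma> ((rot f \<gamma> ^^ n) \<rho>) k = code f \<gamma> \<rho> (n + k)"
  by (simp add: code_def add.commute[of n k] funpow_add)

locale coding =
  fixes f :: bool and \<gamma> \<rho> :: real
  assumes irr: "\<gamma> \<notin> \<rat>" and \<gamma>0: "0 < \<gamma>" and \<gamma>1: "\<gamma> < 1"
    and \<rho>0: "pos f \<rho>" and \<rho>1: "\<not> pos f (\<rho> - 1)"
begin

abbreviation "u \<equiv> code f \<gamma> \<rho>"

definition "y n = (rot f \<gamma> ^^ n) \<rho>"

lemma y_0: "y 0 = \<rho>" by (simp add: y_def)

lemma u_pos: "u n = 1 \<longleftrightarrow> pos f (y n - (1 - \<gamma>))"
  by (simp add: code_def y_def)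

lemma u_01: "u n = 0 \<or> u n = 1"
  by (simp add: code_def)

lemma u_0: "u n = 0 \<longleftrightarrow> \<not> pos f (y n - (1 - \<gamma>))"
  by (simp add: code_def y_def)

lemma set_seg: "set (seg u i j) \<subseteq> {0, 1}"
  by (auto simp: code_def)

lemma y_Suc: "y (Suc n) = y n + (if u n = 0 then \<gamma> else \<gamma> - 1)"
  by (simp add: y_def rot_def code_def)

lemma y_unit: "pos f (y n)" "\<not> pos f (y n - 1)"
proof (induction n)
  case 0
  { case 1 show ?case using \<rho>0 by (simp add: y_0) }
  { case 2 show ?case using \<rho>1 by (simp add: y_0) }
next
  case (Suc n)
  { case 1 show ?case
      using Suc u_pos[of n] u_01[of n] pos_mono[of f "y n" "y n + \<gamma>"] \<gamma>0
      by (auto simp: y_Suc algebra_simps) }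
  { case 2 show ?case
      using Suc u_0[of n] u_01[of n] pos_mono[of f "y n + \<gamma> - 2" "y n - 1"] \<gamma>1
      by (auto simp: y_Suc algebra_simps) }
qed

lemma y_bounds: "0 \<le> y n" "y n \<le> 1"
  using pos_ge[OF y_unit(1)] not_pos_le[OF y_unit(2), of n] by auto

lemma y_seg: "y (n + m) = y n + ht \<gamma> (seg u n (n + m))"
  by (induction m) (auto simp: y_Suc)

lemma y_ht: "y n = \<rho> + ht \<gamma> (seg u 0 n)"
  using y_seg[of 0 n] by (simp add: y_0)

lemma y_add: "\<exists>k::int. y (n + m) = y n + of_int (int m) * \<gamma> - of_int k"
  using ht_int[of \<gamma> "seg u n (n + m)"] by (auto simp: y_seg)

lemma y_eqI:
  assumes "pos f x" "\<not> pos f (x - 1)" "y n = x + of_int k"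
  shows "y n = x"
  using pos_unit_unique[OF assms(1,2) y_unit[of n] assms(3)] .

lemma density:
  assumes "0 \<le> a" "a < b" "b \<le> 1"
  obtains n where "n \<ge> n0" "a < y n" "y n < b"
proof -
  \<comment> \<open>The target is taken relative to \<open>y n0\<close>, so that the positive
    multiplier \<open>k\<close> yields an index beyond \<open>n0\<close>.\<close>
  obtain h k where k: "k > 0" "\<bar>of_int k * \<gamma> - of_int h - ((a + b) / 2 - y n0)\<bar> < (b - a) / 2"
    by (rule sequence_of_fractional_parts_is_dense[OF irr, of "(b - a) / 2" "(a + b) / 2 - y n0"])
      (use assms in auto)
  define z where "z = y n0 + of_int k * \<gamma> - of_int h"
  have z: "a < z" "z < b" using k(2) unfolding z_def by (auto simp: abs_less_iff field_simps)
  obtain m :: int where "y (n0 + nat k) = y n0 + of_int k * \<gamma> - of_int m"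
    using y_add[of n0 "nat k"] k(1) by auto
  then have eq: "y (n0 + nat k) = z + of_int (h - m)" by (simp add: z_def)
  have "y (n0 + nat k) = z"
    by (rule y_eqI[OF _ _ eq]) (use z assms in \<open>auto intro: pos_gt dest: pos_ge\<close>)
  then show thesis using that[of "n0 + nat k"] z by auto
qed

lemma range_shift: "range (\<lambda>k. u (n + k)) = {0, 1}"
proof -
  obtain m where m: "m \<ge> n" "y m < 1 - \<gamma>" using density[of 0 "1 - \<gamma>" n] \<gamma>0 \<gamma>1 by auto
  obtain m' where m': "m' \<ge> n" "y m' > 1 - \<gamma>" using density[of "1 - \<gamma>" 1 n] \<gamma>0 \<gamma>1 by auto
  have "u (n + (m - n)) = 0" using m u_0[of m] not_pos_lt by auto
  moreover have "u (n + (m' - n)) = 1" using m' u_pos[of m'] pos_gt by auto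
  ultimately have "0 \<in> range (\<lambda>k. u (n + k))" "1 \<in> range (\<lambda>k. u (n + k))"
    by (metis rangeI)+
  moreover have "range (\<lambda>k. u (n + k)) \<subseteq> {0, 1}" by (auto simp: code_def)
  ultimately show ?thesis by blast
qed

lemma range_u: "range u = {0, 1}"
  using range_shift[of 0] by simp

text \<open>If the shifts by \<open>m < n\<close> agree, every stretch of \<open>n - m\<close> steps
  from \<open>m\<close> on has the same displacement \<open>e\<close>. The orbit is bounded, so
  \<open>e = 0\<close>, and a positive multiple of \<gamma> would be an integer.\<close>

lemma shift_inj:
  assumes "(\<lambda>k. u (m + k)) = (\<lambda>k. u (n + k))"
  shows "m = n"
proof -
  have aux: False if "m < n" and eq: "\<And>k. u (m + k) = u (n + k)" for m n
  proof -
    define r where "r = n - m"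
    have n: "n = m + r" "r > 0" using that by (auto simp: r_def)
    have per: "y (m + r + j) - y (m + r) = y (m + j) - y m" for j
    proof (induction j)
      case (Suc j) then show ?case using eq[of j] n by (simp add: y_Suc)
    qed simp
    define e where "e = y (m + r) - y m"
    have mult: "y (m + j * r) = y m + real j * e" for j
    proof (induction j)
      case (Suc j)
      have "y (m + Suc j * r) = y (m + r + j * r)" by (simp add: algebra_simps)
      also have "\<dots> = y (m + j * r) + e" using per[of "j * r"] by (simp add: e_def)
      finally show ?case using Suc by (simp add: algebra_simps)
    qed simp
    have "e = 0"
    proof (rule ccontr)
      assume "e \<noteq> 0"
      then obtain j :: nat where "real j * \<bar>e\<bar> > 1"
        using reals_Archimedean3[of "\<bar>e\<bar>"] by auto
      then have "\<bar>real j * e\<bar> > 1" by (simp add: abs_mult)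
      then show False using mult[of j] y_bounds[of m] y_bounds[of "m + j * r"] by linarith
    qed
    moreover obtain k :: int where "y (m + r) = y m + of_int (int r) * \<gamma> - of_int k"
      using y_add[of m r] by blast
    ultimately have "of_int (int r) * \<gamma> = of_int k" by (simp add: e_def)
    then show False using irrational_lin[OF irr, of "int r" k] n by auto
  qed
  show ?thesis
    using aux[of m n] aux[of n m] assms by (metis linorder_neqE_nat)
qed

lemma coding_shift: "coding f \<gamma> (y n)"
  using irr \<gamma>0 \<gamma>1 y_unit by unfold_locales auto

lemma coding_swap: "coding (\<not> f) (1 - \<gamma>) (1 - \<rho>)"
proof
  show "1 - \<gamma> \<notin> \<rat>"
    using irr Rats_diff[OF Rats_1, of "1 - \<gamma>"] by auto
  show "pos (\<not> f) (1 - \<rho>)" using \<rho>1 pos_uminus[of f "\<rho> - 1"] by simp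
  show "\<not> pos (\<not> f) (1 - \<rho> - 1)" using \<rho>0 pos_uminus[of f \<rho>] by simp
qed (use \<gamma>0 \<gamma>1 in auto)

end

section \<open>Fixed points as self-similar codings\<close>

declare One_nat_def [simp del]

locale coding_maps = coding +
  fixes \<phi> :: "nat \<Rightarrow> nat list"
  assumes mt: "maps_to \<phi> u u"
begin

abbreviation "N \<equiv> cut \<phi> u"
abbreviation "p \<equiv> length (\<phi> 0)"
abbreviation "q \<equiv> length (\<phi> 1)"

text \<open>The displacement of the image of the vector of letter counts \<open>(1, -1)\<close>,
  which itself has displacement 1. The point \<open>x0\<close> below is the left end
  \<open>F 0\<close> of \<open>J\<close>.\<close>

definition "lam = ht \<gamma> (\<phi> 0) - ht \<gamma> (\<phi> 1)"
definition "x0 = (1 - lam) * \<rho>"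

text \<open>The vector of letter counts of \<open>w\<close> is its length times the frequency vector
  \<open>(1 - \<gamma>, \<gamma>)\<close> plus its displacement times \<open>(1, -1)\<close>, and
  the displacement of the image is linear in the letter counts.\<close>

lemma ht_phi_aux:
  "set w \<subseteq> {0, 1} \<Longrightarrow> ht \<gamma> (mimage \<phi> w) =
     real (length w) * ((1 - \<gamma>) * ht \<gamma> (\<phi> 0) + \<gamma> * ht \<gamma> (\<phi> 1)) + ht \<gamma> w * lam"
  by (induction w) (auto simp: lam_def algebra_simps)

lemma y_N_ht: "y (N n) = \<rho> + ht \<gamma> (mimage \<phi> (seg u 0 n))"
  using maps_to_seg[OF mt, of 0 n] by (simp add: y_ht)

text \<open>If the image of the frequency vector had nonzero displacement, \<open>y (N n)\<close>
  would drift linearly in \<open>n\<close>, but orbits stay in the unit interval.\<close>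

lemma ht_bracket: "(1 - \<gamma>) * ht \<gamma> (\<phi> 0) + \<gamma> * ht \<gamma> (\<phi> 1) = 0" (is "?B = 0")
proof (rule ccontr)
  assume "?B \<noteq> 0"
  then obtain n :: nat where "real n * \<bar>?B\<bar> > 1 + \<bar>lam\<bar>"
    using reals_Archimedean3[of "\<bar>?B\<bar>"] by auto
  then have n: "\<bar>real n * ?B\<bar> > 1 + \<bar>lam\<bar>" by (simp add: abs_mult)
  have "y (N n) = \<rho> + (real n * ?B + (y n - \<rho>) * lam)"
    using ht_phi_aux[OF set_seg, of 0 n] by (simp add: y_N_ht y_ht[of n])
  moreover have "\<bar>(y n - \<rho>) * lam\<bar> \<le> 1 * \<bar>lam\<bar>"
    unfolding abs_mult using y_bounds[of n] y_bounds[of 0]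
    by (intro mult_right_mono) (auto simp: y_0 abs_le_iff)
  ultimately show False using n y_bounds[of "N n"] y_bounds[of 0] unfolding y_0 by linarith
qed

lemma ht_phi: "set w \<subseteq> {0, 1} \<Longrightarrow> ht \<gamma> (mimage \<phi> w) = lam * ht \<gamma> w"
  using ht_phi_aux[of w] ht_bracket by simp

lemma ht_phi0: "ht \<gamma> (\<phi> 0) = lam * \<gamma>" and ht_phi1: "ht \<gamma> (\<phi> 1) = lam * (\<gamma> - 1)"
  using ht_phi[of "[0]"] ht_phi[of "[1]"] by auto

lemma y_N: "y (N n) = x0 + lam * y n"
  using ht_phi[OF set_seg, of 0 n] by (simp add: y_N_ht y_ht[of n] x0_def algebra_simps)

end

section \<open>The contraction and the Rokhlin towers over its image\<close>

locale coding_fixed = coding_maps +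
  assumes set0: "set (\<phi> 0) = {0, 1}" and set1: "set (\<phi> 1) = {0, 1}"
    and ht0: "ht \<gamma> (\<phi> 0) > 0"
begin

lemma p2: "p \<ge> 2" and q2: "q \<ge> 2"
  using card_length[of "\<phi> 0"] card_length[of "\<phi> 1"] set0 set1 by auto

lemma phi_ne: "\<phi> (u n) \<noteq> []"
  using u_01[of n] set0 set1 by auto

lemma strict_mono_N: "strict_mono N"
  using phi_ne by (rule strict_mono_cut)

lemma lam0: "lam > 0"
  using ht0 \<gamma>0 unfolding ht_phi0 by (simp add: zero_less_mult_iff)

text \<open>The affine map with slope \<open>lam\<close> sends orbit points to orbit points, so a
  slope above 1 would stretch points near 0 and near 1 further apart than the unit interval allows.
  Slope 1 contradicts irrationality.\<close>

lemma lam1: "lam < 1"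
proof (rule ccontr)
  assume "\<not> lam < 1"
  moreover have "lam \<noteq> 1"
  proof
    assume "lam = 1"
    then have "ht \<gamma> (\<phi> 0) = \<gamma>" using ht_phi0 by simp
    moreover obtain k :: int where "ht \<gamma> (\<phi> 0) = of_int (int p) * \<gamma> - of_int k"
      using ht_int by blast
    ultimately have "of_int (int p - 1) * \<gamma> = of_int k" by (simp add: algebra_simps)
    then show False using irrational_lin[OF irr, of "int p - 1" k] p2 by auto
  qed
  ultimately have l: "lam > 1" by simp
  \<comment> \<open>With this choice \<open>lam * (1 - 2 * e) = (lam + 1) / 2\<close>, which still
    exceeds 1.\<close>
  define e where "e = (lam - 1) / (4 * lam)"
  have e: "0 < e" "e < 1/2" "lam * (1 - 2 * e) > 1"
    using l by (auto simp: e_def field_simps)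
  obtain n where n: "y n < e" using density[of 0 e 0] e by auto
  obtain m where m: "y m > 1 - e" using density[of "1 - e" 1 0] e by auto
  have "lam * (y m - y n) > lam * (1 - 2 * e)" using m n l by (intro mult_strict_left_mono) auto
  then have "y (N m) - y (N n) > 1" using e by (simp add: y_N algebra_simps)
  then show False using y_bounds[of "N m"] y_bounds[of "N n"] by linarith
qed

lemma x0_bounds: "0 \<le> x0" "x0 + lam \<le> 1"
proof -
  have r: "0 \<le> \<rho>" "\<rho> \<le> 1" using y_bounds[of 0] by (auto simp: y_0)
  show "0 \<le> x0" using r lam1 by (simp add: x0_def)
  have "(1 - lam) * \<rho> \<le> (1 - lam) * 1" using r lam1 by (intro mult_left_mono) auto
  then show "x0 + lam \<le> 1" by (simp add: x0_def)
qed

definition "lend a = (if a = (0::nat) then 0 else 1 - \<gamma>)"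
definition "rend a = (if a = (0::nat) then 1 - \<gamma> else 1)"

lemma lend_le: "lend (u n) \<le> y n" and rend_ge: "y n \<le> rend (u n)"
  using u_01[of n] u_pos[of n] u_0[of n] pos_ge[of f "y n - (1 - \<gamma>)"]
    not_pos_le[of f "y n - (1 - \<gamma>)"] y_bounds[of n]
  by (auto simp: lend_def rend_def)

lemma inside_letter:
  assumes "a \<in> {0, 1}" "lend a < y n" "y n < rend a"
  shows "u n = a"
  using assms u_0[of n] u_pos[of n] pos_gt[of "y n - (1 - \<gamma>)" f] not_pos_lt[of "y n - (1 - \<gamma>)" f]
  by (auto simp: lend_def rend_def)

lemma ends: "a \<in> {0, 1} \<Longrightarrow> 0 \<le> lend a \<and> lend a < rend a \<and> rend a \<le> 1"
  using \<gamma>0 \<gamma>1 by (auto simp: lend_def rend_def)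

lemma y_N_add:
  assumes "j \<le> length (\<phi> (u m))"
  shows "y (N m + j) = x0 + lam * y m + ht \<gamma> (take j (\<phi> (u m)))"
proof -
  have "take j (seg u (N m) (N (Suc m))) = seg u (N m) (N m + j)"
    using assms by (simp add: take_map cut_Suc)
  then have "take j (\<phi> (u m)) = seg u (N m) (N m + j)"
    using maps_to_block[OF mt, of m] by simp
  then show ?thesis using y_seg[of "N m" j] by (simp add: y_N)
qed

text \<open>For orbit points inside the interval of \<open>a\<close> both bounds are clear; these
  points are dense there, and the limit reaches the ends. The limit is why the inequalities are
  weak.\<close>

lemma level_ends:
  assumes a: "a \<in> {0, 1}" and j: "j < length (\<phi> a)"
  shows "lend (\<phi> a ! j) \<le> x0 + lam * lend a + ht \<gamma> (take j (\<phi> a))"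
    and "x0 + lam * rend a + ht \<gamma> (take j (\<phi> a)) \<le> rend (\<phi> a ! j)"
proof -
  have step: "lend (\<phi> a ! j) \<le> x0 + lam * y m + ht \<gamma> (take j (\<phi> a))"
    "x0 + lam * y m + ht \<gamma> (take j (\<phi> a)) \<le> rend (\<phi> a ! j)" if "u m = a" for m
    using lend_le[of "N m + j"] rend_ge[of "N m + j"] y_N_add[of j m] maps_to_nth[OF mt, of j m] j that
    by auto
  show "lend (\<phi> a ! j) \<le> x0 + lam * lend a + ht \<gamma> (take j (\<phi> a))"
  proof (rule field_le_epsilon)
    fix e :: real assume e: "e > 0"
    have "lend a < min (rend a) (lend a + e)" using ends[OF a] e by auto
    moreover have "min (rend a) (lend a + e) \<le> 1" using ends[OF a] by auto
    ultimately obtain m where m: "lend a < y m" "y m < min (rend a) (lend a + e)"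
      using density[of "lend a" "min (rend a) (lend a + e)" 0] ends[OF a] by blast
    have "lam * y m \<le> lam * (lend a + e)" using m lam0 by (intro mult_left_mono) auto
    also have "\<dots> \<le> lam * lend a + e" using lam1 lam0 e by (simp add: algebra_simps)
    finally show "lend (\<phi> a ! j) \<le> x0 + lam * lend a + ht \<gamma> (take j (\<phi> a)) + e"
      using step(1)[OF inside_letter[OF a, of m]] m by auto
  qed
  show "x0 + lam * rend a + ht \<gamma> (take j (\<phi> a)) \<le> rend (\<phi> a ! j)"
  proof (rule field_le_epsilon)
    fix e :: real assume e: "e > 0"
    have "max (lend a) (rend a - e) < rend a" using ends[OF a] e by auto
    moreover have "0 \<le> max (lend a) (rend a - e)" using ends[OF a] by auto
    ultimately obtain m where m: "max (lend a) (rend a - e) < y m" "y m < rend a"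
      using density[of "max (lend a) (rend a - e)" "rend a" 0] ends[OF a] by blast
    have "lam * rend a \<le> lam * (y m + e)" using m lam0 by (intro mult_left_mono) auto
    also have "\<dots> \<le> lam * y m + e" using lam1 lam0 e by (simp add: algebra_simps)
    finally show "x0 + lam * rend a + ht \<gamma> (take j (\<phi> a)) \<le> rend (\<phi> a ! j) + e"
      using step(2)[OF inside_letter[OF a, of m]] m by auto
  qed
qed

definition "lev a j = x0 + lam * lend a + ht \<gamma> (take j (\<phi> a))"
definition "idx a j = (if a = (0::nat) then int j else int j - int q)"

text \<open>The floors of the Rokhlin towers over the image of the affine contraction have the left ends
  \<open>lev a j\<close>; all of them lie on one orbit of the rotation, at time \<open>idx a j\<close>.\<close>
lemma lev_idx:
  assumes "a \<in> {0, 1}" "j \<le> length (\<phi> a)"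
  shows "\<exists>k::int. lev a j = x0 + of_int (idx a j) * \<gamma> - of_int k"
proof -
  obtain k :: int where k: "ht \<gamma> (take j (\<phi> a)) = of_int (int j) * \<gamma> - of_int k"
    using ht_int[of \<gamma> "take j (\<phi> a)"] assms by auto
  obtain l :: int where l: "ht \<gamma> (\<phi> 1) = of_int (int q) * \<gamma> - of_int l"
    using ht_int[of \<gamma> "\<phi> 1"] by auto
  show ?thesis
  proof (cases "a = 0")
    case True then show ?thesis using k by (auto simp: lev_def idx_def lend_def)
  next
    case False
    then have "lev a j = x0 - ht \<gamma> (\<phi> 1) + ht \<gamma> (take j (\<phi> a))"
      by (simp add: lev_def lend_def ht_phi1 algebra_simps)
    then have "lev a j = x0 + of_int (idx a j) * \<gamma> - of_int (k - l)"
      using False k l by (simp add: idx_def algebra_simps)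
    then show ?thesis by blast
  qed
qed

lemma lev_zero_unique:
  assumes "a \<in> {0, 1}" "j < length (\<phi> a)" "lev a j = 0"
    and "a' \<in> {0, 1}" "j' < length (\<phi> a')" "lev a' j' = 0"
  shows "a = a' \<and> j = j'"
proof -
  obtain k k' :: int where "lev a j = x0 + of_int (idx a j) * \<gamma> - of_int k"
    "lev a' j' = x0 + of_int (idx a' j') * \<gamma> - of_int k'"
    using lev_idx assms by (metis less_imp_le)
  then have "of_int (idx a j - idx a' j') * \<gamma> = of_int (k - k')"
    using assms by (simp add: algebra_simps)
  from irrational_lin[OF irr this] have "idx a j = idx a' j'" by simp
  then show ?thesis using assms by (auto simp: idx_def split: if_splits)
qed

text \<open>Every orbit point lies on a floor, and no floor starts below 0. A point below the
  smallest positive left end thus lies on a floor starting at 0, and irrationality allows only one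
  such floor.\<close>

lemma near_zero:
  "\<exists>a j \<epsilon>. a \<in> {0, 1} \<and> j < length (\<phi> a) \<and> lev a j = 0 \<and> \<epsilon> > 0 \<and> \<epsilon> \<le> 1 \<and>
     (\<forall>n. y n < \<epsilon> \<longrightarrow> (\<exists>m. n = N m + j \<and> u m = a))"
proof -
  define V where "V = (\<lambda>(a, j). lev a j) ` (\<Union>a\<in>{0, 1}. {a} \<times> {..<length (\<phi> a)})"
  \<comment> \<open>The extra element 1 keeps the minimum defined and bounds it by 1.\<close>
  define \<epsilon> where "\<epsilon> = Min (insert 1 {t \<in> V. t > 0})"
  have fin: "finite V" unfolding V_def by auto
  have \<epsilon>: "\<epsilon> > 0" "\<epsilon> \<le> 1" "\<And>t. t \<in> V \<Longrightarrow> t > 0 \<Longrightarrow> \<epsilon> \<le> t"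
    using fin by (auto simp: \<epsilon>_def)
  have key: "\<exists>m j. n = N m + j \<and> j < length (\<phi> (u m)) \<and> lev (u m) j = 0" if "y n < \<epsilon>" for n
  proof -
    obtain m j where mj: "n = N m + j" "j < length (\<phi> (u m))"
      using cut_cover[of \<phi> u n] phi_ne by blast
    have a: "u m \<in> {0, 1}" using u_01[of m] by auto
    have "lev (u m) j \<le> y n"
      using y_N_add[of j m] mj lend_le[of m] lam0 by (simp add: lev_def)
    moreover have "lev (u m) j \<ge> 0"
      using level_ends(1)[OF a mj(2)] \<gamma>1 by (auto simp: lev_def lend_def split: if_splits)
    moreover have "lev (u m) j \<in> V" unfolding V_def using mj a by (intro image_eqI[of _ _ "(u m, j)"]) auto
    ultimately have "lev (u m) j = 0" using \<epsilon>(3)[of "lev (u m) j"] that by fastforce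
    then show ?thesis using mj by blast
  qed
  obtain n where "y n < \<epsilon>" using density[of 0 \<epsilon> 0] \<epsilon> by auto
  from key[OF this] obtain m0 j where mj: "j < length (\<phi> (u m0))" "lev (u m0) j = 0" by blast
  have a: "u m \<in> {0, 1}" for m using u_01[of m] by auto
  have "\<exists>m. n = N m + j \<and> u m = u m0" if "y n < \<epsilon>" for n
  proof -
    from key[OF that] obtain m j' where m: "n = N m + j'" "j' < length (\<phi> (u m))" "lev (u m) j' = 0"
      by blast
    have "u m = u m0 \<and> j' = j" using lev_zero_unique[OF a m(2,3) a mj] by simp
    then show ?thesis using m by blast
  qed
  then show ?thesis using mj a[of m0] \<epsilon>(1,2) by blast
qed

lemma idx_exists: "\<exists>i k::int. - int q < i \<and> i < int p \<and> x0 + of_int i * \<gamma> = of_int k"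
proof -
  obtain a j where aj: "a \<in> {0, 1}" "j < length (\<phi> a)" "lev a j = 0"
    using near_zero by blast
  obtain k :: int where k: "x0 + of_int (idx a j) * \<gamma> = of_int k"
    using lev_idx[of a j] aj by auto
  \<comment> \<open>The ground floor for letter 1 starts at \<open>F (1 - \<gamma>)\<close>,
    strictly to the right of \<open>x0\<close>. Excluding it makes the lower bound on the index
    strict.\<close>
  have "\<not> (a = 1 \<and> j = 0)"
  proof
    assume "a = 1 \<and> j = 0"
    then have "x0 + lam * (1 - \<gamma>) = 0" using aj(3) by (simp add: lev_def lend_def)
    moreover have "lam * (1 - \<gamma>) > 0" using lam0 \<gamma>1 by simp
    ultimately show False using x0_bounds by simp
  qed
  then have "- int q < idx a j" "idx a j < int p" using aj q2 p2 by (auto simp: idx_def)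
  then show ?thesis using k by blast
qed

text \<open>Membership in the module \<open>L = \<int> + \<int>\<gamma>\<close>. Points close to 0 all lie on the unique floor starting
  at 0, hence their differences are in \<open>lam L\<close>; small differences generate \<open>L\<close>, so \<open>lam L = L\<close>.\<close>
definition "inL x \<longleftrightarrow> (\<exists>a b::int. x = of_int a * \<gamma> + of_int b)"

lemma inL_I: "inL (of_int a * \<gamma> + of_int b)"
  unfolding inL_def by blast

lemma inL_diff: "inL x \<Longrightarrow> inL x' \<Longrightarrow> inL (x - x')"
proof -
  assume "inL x" "inL x'"
  then obtain a b a' b' :: int where "x = of_int a * \<gamma> + of_int b" "x' = of_int a' * \<gamma> + of_int b'"
    unfolding inL_def by blast
  then have "x - x' = of_int (a - a') * \<gamma> + of_int (b - b')" by (simp add: algebra_simps)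
  then show ?thesis unfolding inL_def by blast
qed

lemma inL_mult: "inL x \<Longrightarrow> inL (of_int k * x)"
proof -
  assume "inL x"
  then obtain a b :: int where "x = of_int a * \<gamma> + of_int b"
    unfolding inL_def by blast
  then have "of_int k * x = of_int (k * a) * \<gamma> + of_int (k * b)" by (simp add: algebra_simps)
  then show ?thesis unfolding inL_def by blast
qed

lemma inL_y: "inL (y n - y m)"
proof -
  have "inL (y n - \<rho>)" for n
  proof -
    obtain k :: int where "y (0 + n) = y 0 + of_int (int n) * \<gamma> - of_int k" using y_add by blast
    then have "y n - \<rho> = of_int (int n) * \<gamma> + of_int (- k)" by (simp add: y_0)
    then show ?thesis using inL_I by metis
  qed
  from inL_diff[OF this[of n] this[of m]] show ?thesis by simp
qed

lemma small_inL:
  obtains \<epsilon> where "\<epsilon> > 0" "\<And>x. inL x \<Longrightarrow> \<bar>x\<bar> < \<epsilon> \<Longrightarrow> inL (x / lam)"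
proof -
  obtain a j \<epsilon> where aj: "a \<in> {0, 1}" "j < length (\<phi> a)" "lev a j = 0" "\<epsilon> > 0" "\<epsilon> \<le> 1"
    and near: "\<And>n. y n < \<epsilon> \<Longrightarrow> \<exists>m. n = N m + j \<and> u m = a"
    using near_zero by blast
  have diff: "inL ((y n - y n') / lam)" if n: "y n < \<epsilon>" "y n' < \<epsilon>" for n n'
  proof -
    obtain m m' where "n = N m + j" "n' = N m' + j" "u m = a" "u m' = a"
      using near[OF n(1)] near[OF n(2)] by blast
    then have "(y n - y n') / lam = y m - y m'"
      using y_N_add[of j m] y_N_add[of j m'] aj lam0 by (simp add: field_simps)
    then show ?thesis using inL_y by simp
  qed
  have forward: "inL (x / lam)" if x: "x = of_int r * \<gamma> + of_int s" "\<bar>x\<bar> < \<epsilon> / 2" "r > 0" for x r s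
  proof -
    \<comment> \<open>The window has room for both \<open>y n\<close> and \<open>y n + x\<close>
      below \<open>\<epsilon>\<close> and above 0, so the point \<open>r\<close> steps later is
      \<open>y n + x\<close> itself and not just congruent to it.\<close>
    have "0 \<le> max 0 (- x)" "max 0 (- x) < min \<epsilon> (\<epsilon> - x)" "min \<epsilon> (\<epsilon> - x) \<le> 1"
      using x(2) aj by (auto simp: abs_less_iff)
    then obtain n where n: "max 0 (- x) < y n" "y n < min \<epsilon> (\<epsilon> - x)"
      using density[of "max 0 (- x)" "min \<epsilon> (\<epsilon> - x)" 0] by blast
    obtain k :: int where "y (n + nat r) = y n + of_int (int (nat r)) * \<gamma> - of_int k"
      using y_add by blast
    then have eq: "y (n + nat r) = (y n + x) + of_int (- s - k)" using x by simp
    have "y (n + nat r) = y n + x"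
      by (rule y_eqI[OF _ _ eq]) (use n aj in \<open>auto intro: pos_gt dest: pos_ge\<close>)
    then show ?thesis using diff[of "n + nat r" n] n by auto
  qed
  have "inL (x / lam)" if xL: "inL x" and small: "\<bar>x\<bar> < \<epsilon> / 2" for x
  proof -
    obtain r s :: int where x: "x = of_int r * \<gamma> + of_int s" using xL unfolding inL_def by blast
    consider "r > 0" | "r < 0" | "r = 0" by linarith
    then show ?thesis
    proof cases
      case 1 then show ?thesis using forward x small by blast
    next
      case 2
      have "- x = of_int (- r) * \<gamma> + of_int (- s)" using x by simp
      then have "inL (- x / lam)" by (rule forward) (use small 2 in auto)
      then show ?thesis using inL_mult[of "- x / lam" "-1"] by simp
    next
      case 3
      then have "\<bar>of_int s :: real\<bar> < 1" using x small aj by simp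
      then have "s = 0" by linarith
      then have "x = 0" using x 3 by simp
      then show ?thesis using inL_I[of 0 0] by simp
    qed
  qed
  then show thesis using that[of "\<epsilon> / 2"] aj by auto
qed

lemma inL_div_lam:
  assumes "inL x" shows "inL (x / lam)"
proof -
  obtain \<epsilon> where \<epsilon>: "\<epsilon> > 0" "\<And>x. inL x \<Longrightarrow> \<bar>x\<bar> < \<epsilon> \<Longrightarrow> inL (x / lam)" using small_inL by blast
  define e where "e = min \<epsilon> 1"
  obtain h k where hk: "k > 0" "\<bar>of_int k * \<gamma> - of_int h - e / 2\<bar> < e / 2"
    by (rule sequence_of_fractional_parts_is_dense[OF irr, of "e / 2" "e / 2"])
      (use \<epsilon> in \<open>auto simp: e_def\<close>)
  define d where "d = of_int k * \<gamma> + of_int (- h)"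
  have "inL d" unfolding d_def by (rule inL_I)
  moreover have "0 < d" "d < e" using hk(2) unfolding d_def by linarith+
  moreover have "e \<le> \<epsilon>" by (simp add: e_def)
  ultimately have d: "inL d" "0 < d" "d < \<epsilon>" by auto
  \<comment> \<open>Division with remainder by the small element \<open>d\<close>: both
    \<open>d\<close> and the remainder lie below \<open>\<epsilon>\<close>, so both may be divided
    by \<open>lam\<close>, and hence so may \<open>x\<close>.\<close>
  define r where "r = x - of_int \<lfloor>x / d\<rfloor> * d"
  have "0 \<le> r \<and> r < d"
    using floor_divide_lower[OF d(2), of x] floor_divide_upper[OF d(2), of x]
    by (simp add: r_def algebra_simps)
  moreover have "inL r" unfolding r_def using assms d by (intro inL_diff inL_mult)
  ultimately have "inL (r / lam)" using \<epsilon>(2) d by auto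
  moreover have "inL (of_int (- \<lfloor>x / d\<rfloor>) * (d / lam))" using \<epsilon>(2) d by (intro inL_mult) auto
  ultimately have "inL (r / lam - of_int (- \<lfloor>x / d\<rfloor>) * (d / lam))" by (rule inL_diff)
  moreover have "r / lam - of_int (- \<lfloor>x / d\<rfloor>) * (d / lam) = x / lam"
    by (simp add: r_def diff_divide_distrib)
  ultimately show ?thesis by simp
qed

end

section \<open>Letters at fixed offsets from the block boundaries\<close>

context coding_fixed
begin

text \<open>By irrationality only one integer qualifies: the number of rotation steps, possibly
  negative, that take the left end of \<open>J\<close> to 0 on the circle.\<close>

definition "i = (SOME i. - int q < i \<and> i < int p \<and> (\<exists>k::int. x0 + of_int i * \<gamma> = of_int k))"

lemma i_props: "- int q < i \<and> i < int p \<and> (\<exists>k::int. x0 + of_int i * \<gamma> = of_int k)"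
  unfolding i_def by (rule someI_ex) (use idx_exists in blast)

lemma i_lower: "- int q < i" and i_upper: "i < int p"
  using i_props by auto

definition "p1 = int (length (filter (\<lambda>a. a \<noteq> 0) (\<phi> 0)))"
definition "q1 = int (length (filter (\<lambda>a. a \<noteq> 0) (\<phi> 1)))"

lemma lam_gamma: "lam * \<gamma> = of_int (int p) * \<gamma> - of_int p1"
  using ht_phi0 by (simp add: ht_def p1_def)

lemma lam_gamma': "lam * (\<gamma> - 1) = of_int (int q) * \<gamma> - of_int q1"
  using ht_phi1 by (simp add: ht_def q1_def)

lemma lam_eq: "lam = of_int (int p - int q) * \<gamma> - of_int (p1 - q1)"
  using lam_gamma lam_gamma' by (simp add: algebra_simps)

text \<open>Equal lengths would make \<open>lam\<close> an integer. Later the lengths alone tell the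
  two return words of \<open>v\<close> apart.\<close>

lemma p_neq_q: "p \<noteq> q"
proof
  assume "p = q"
  then have "lam = of_int (q1 - p1)" using lam_eq by simp
  then show False using lam0 lam1 by simp
qed

lemma lam_mult:
  "lam * (of_int m - of_int k * \<gamma>) =
     of_int (- ((k - m) * int p + m * int q)) * \<gamma> + of_int (k * p1 - m * (p1 - q1))"
proof -
  have "lam * (of_int m - of_int k * \<gamma>) = of_int m * lam - of_int k * (lam * \<gamma>)"
    by (simp add: algebra_simps)
  also have "\<dots> = of_int m * (of_int (int p - int q) * \<gamma> - of_int (p1 - q1)) -
      of_int k * (of_int (int p) * \<gamma> - of_int p1)"
    unfolding lam_gamma by (subst lam_eq) (rule refl)
  also have "\<dots> = of_int (- ((k - m) * int p + m * int q)) * \<gamma> + of_int (k * p1 - m * (p1 - q1))"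
    by (simp add: algebra_simps)
  finally show ?thesis .
qed

lemma lin_unique:
  assumes "of_int a * \<gamma> + of_int b = of_int a' * \<gamma> + of_int b'"
  shows "a = a'" "b = b'"
proof -
  have "of_int (a - a') * \<gamma> = of_int (b' - b)" using assms by (simp add: algebra_simps)
  from irrational_lin[OF irr this] show "a = a'" by simp
  then show "b = b'" using assms by simp
qed

text \<open>For \<open>k - m\<close> zeros and \<open>m\<close> ones,
  \<open>m - k * \<gamma>\<close> is the negated displacement. In the unit interval it cannot arise
  from counts of opposite signs, so the two terms of the length of the image do not cancel.\<close>

lemma lattice_signs:
  fixes k m :: int
  assumes "0 < of_int m - of_int k * \<gamma>" "of_int m - of_int k * \<gamma> < 1"
  shows "k \<ge> 1 \<and> m \<ge> 1 \<and> m \<le> k \<or> k \<le> -1 \<and> m \<le> 0 \<and> k < m"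
proof -
  consider "k \<ge> 1" | "k = 0" | "k \<le> -1" by linarith
  then show ?thesis
  proof cases
    case 1
    then have "of_int k * \<gamma> > 0" "of_int k * \<gamma> < of_int k" using \<gamma>0 \<gamma>1 by auto
    then have "(of_int m :: real) > 0" "(of_int m :: real) < of_int (k + 1)" using assms by auto
    then show ?thesis using 1 by linarith
  next
    case 2 then show ?thesis using assms by auto
  next
    case 3
    then have "of_int k * \<gamma> < 0" "of_int k < of_int k * \<gamma>"
      using \<gamma>0 \<gamma>1 by (auto simp: mult_less_0_iff)
    then have "(of_int m :: real) < 1" "(of_int k :: real) < of_int m" using assms by auto
    then show ?thesis using 3 by linarith
  qed
qed

text \<open>A point inside \<open>J\<close> on the orbit of its left end \<open>x0\<close> is at least \<open>q\<close> steps before or \<open>p\<close> steps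
  after \<open>x0\<close> on that orbit.\<close>
lemma cut_point:
  assumes t: "0 < t" "t < 1" and eq: "lam * t = of_int r * \<gamma> + of_int c"
  shows "r \<le> - int q \<or> r \<ge> int p"
proof -
  have "inL (lam * t / lam)" unfolding eq by (intro inL_div_lam inL_I)
  then obtain a b :: int where ab: "t = of_int a * \<gamma> + of_int b" using lam0 by (auto simp: inL_def)
  define k where "k = - a"
  have tk: "t = of_int b - of_int k * \<gamma>" using ab by (simp add: k_def)
  have "of_int r * \<gamma> + of_int c = of_int (- ((k - b) * int p + b * int q)) * \<gamma> + of_int (k * p1 - b * (p1 - q1))"
    using eq lam_mult[of b k] unfolding tk by simp
  from lin_unique(1)[OF this] have r: "r = - ((k - b) * int p + b * int q)" .
  from lattice_signs[of b k] t tk consider "k - b \<ge> 0" "b \<ge> 1" | "k - b \<le> -1" "b \<le> 0" by auto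
  then show ?thesis
  proof cases
    case 1
    then have "(k - b) * int p \<ge> 0" "b * int q \<ge> 1 * int q"
      by (simp, intro mult_right_mono) auto
    then show ?thesis using r by linarith
  next
    case 2
    then have "(k - b) * int p \<le> (-1) * int p" "b * int q \<le> 0"
      by (intro mult_right_mono, auto simp: mult_le_0_iff)
    then show ?thesis using r by linarith
  qed
qed

lemma y_cong: "\<exists>c::int. y k = y l + of_int (int k - int l) * \<gamma> + of_int c"
proof -
  obtain a b :: int where "y (0 + k) = y 0 + of_int (int k) * \<gamma> - of_int a"
    "y (0 + l) = y 0 + of_int (int l) * \<gamma> - of_int b" using y_add by blast
  then have "y k = y l + of_int (int k - int l) * \<gamma> + of_int (b - a)" by (simp add: algebra_simps)
  then show ?thesis by blast
qed

lemma y_inj: "y k = y l \<Longrightarrow> k = l"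
proof -
  assume eq: "y k = y l"
  obtain c :: int where "y k = y l + of_int (int k - int l) * \<gamma> + of_int c" using y_cong by blast
  then have "of_int (int k - int l) * \<gamma> = of_int (- c)" using eq by simp
  from irrational_lin[OF irr this] show "k = l" by simp
qed

lemma y_N_cong:
  assumes "int k = int (N m) + j"
  shows "\<exists>c::int. y k = lam * y m + of_int (j - i) * \<gamma> + of_int c"
proof -
  obtain k0 :: int where k0: "x0 + of_int i * \<gamma> = of_int k0" using i_props by blast
  obtain c :: int where "y k = y (N m) + of_int (int k - int (N m)) * \<gamma> + of_int c"
    using y_cong by blast
  then have "y k = lam * y m + of_int (j - i) * \<gamma> + of_int (k0 + c)"
    using k0 assms by (simp add: y_N algebra_simps)
  then show ?thesis by blast
qed

text \<open>The letters at offset \<open>j\<close> from the boundaries code a translate of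
  \<open>J\<close>. They differ only if \<open>1 - \<gamma>\<close> or the point 0 of the circle
  lies inside it. Pulled back, this is a point of \<open>J\<close> on the orbit of \<open>x0\<close>
  at time \<open>i - j - 1\<close> or \<open>i - j\<close>, and the bounds on \<open>j\<close> put
  both times strictly between \<open>- q\<close> and \<open>p\<close>, against
  \<open>cut_point\<close>.\<close>

lemma window_aux:
  assumes k: "int k = int (N m) + j" "int k' = int (N m') + j"
    and j: "i - int p < j" "j + 1 < i + int q"
    and uk: "u k = 0" "u k' = 1"
  shows False
proof -
  obtain c where c: "y k = lam * y m + of_int (j - i) * \<gamma> + of_int (c::int)"
    using y_N_cong[OF k(1)] by blast
  obtain c' where c': "y k' = lam * y m' + of_int (j - i) * \<gamma> + of_int (c'::int)"
    using y_N_cong[OF k(2)] by blast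
  have A: "\<not> pos f (y k - (1 - \<gamma>))" "pos f (y k' - (1 - \<gamma>))" using uk u_0 u_pos by auto
  have b: "\<bar>lam * (y m' - y m)\<bar> < 1"
  proof -
    have "\<bar>y m' - y m\<bar> \<le> 1" using y_bounds[of m] y_bounds[of m'] by linarith
    then have "lam * \<bar>y m' - y m\<bar> \<le> lam * 1" using lam0 by (intro mult_left_mono) auto
    moreover have "\<bar>lam * (y m' - y m)\<bar> = lam * \<bar>y m' - y m\<bar>" using lam0 by (simp add: abs_mult)
    ultimately show ?thesis using lam1 by linarith
  qed
  have unit: "0 < t \<and> t < 1" if "\<not> pos f (y a - t)" "pos f (y b - t)" for t a b
  proof -
    have "\<not> t \<le> 0" using that(1) y_unit(1)[of a] pos_mono[of f "y a" "y a - t"] by auto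
    moreover have "\<not> t \<ge> 1" using that(2) y_unit(2)[of b] pos_mono[of f "y b - t" "y b - 1"] by auto
    ultimately show ?thesis by simp
  qed
  have d: "y k' - y k = lam * (y m' - y m) + of_int (c' - c)" using c c' by (simp add: algebra_simps)
  have "0 \<le> y k' - y k" "y k' - y k \<le> 1"
    using A not_pos_le[OF A(1)] pos_ge[OF A(2)] y_bounds[of k] y_bounds[of k'] by auto
  then have "(of_int (c' - c) :: real) > -1" "(of_int (c' - c) :: real) < 2" using d b by linarith+
  then consider "c' = c" | "c' = c + 1" by linarith
  then show False
  proof cases
    case 1
    \<comment> \<open>Here the translate of \<open>J\<close> does not wrap around, and
      \<open>t\<close> is the parameter of the discontinuity \<open>1 - \<gamma>\<close>.\<close>
    define t where "t = y m - (y k - (1 - \<gamma>)) / lam"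
    have e: "y k - (1 - \<gamma>) = lam * (y m - t)" using lam0 by (simp add: t_def)
    have e': "y k' - (1 - \<gamma>) = lam * (y m' - t)" using d 1 e by (simp add: algebra_simps)
    have t: "0 < t \<and> t < 1" using unit[of m t m'] A unfolding e e' pos_scale[OF lam0] by blast
    have "lam * t = of_int (i - j - 1) * \<gamma> + of_int (1 - c)"
      using e c by (simp add: algebra_simps)
    from cut_point[OF _ _ this] t show False using j by linarith
  next
    case 2
    \<comment> \<open>Here the two points lie on different sides of 0 on the circle, and
      \<open>t\<close> is the parameter of that point.\<close>
    define t where "t = y m - y k / lam"
    have e: "y k = lam * (y m - t)" using lam0 by (simp add: t_def right_diff_distrib)
    have e': "y k' - 1 = lam * (y m' - t)" using d 2 e by (simp add: algebra_simps)
    have t: "0 < t \<and> t < 1"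
      using unit[of m' t m] y_unit(1)[of k] y_unit(2)[of k'] unfolding e e' pos_scale[OF lam0] by blast
    have "lam * t = of_int (i - j) * \<gamma> + of_int (- c)"
      using e c by (simp add: algebra_simps)
    from cut_point[OF _ _ this] t show False using j by linarith
  qed
qed

lemma window_const:
  assumes "int k = int (N m) + j" "int k' = int (N m') + j" "i - int p < j" "j + 1 < i + int q"
  shows "u k = u k'"
  using window_aux[OF assms] window_aux[OF assms(2,1,3,4)] u_01[of k] u_01[of k'] by metis

lemma N_ge: "n \<le> N n"
  using strict_mono_imp_increasing[OF strict_mono_N] .

text \<open>Rotating \<open>x0\<close> by \<open>i - 1\<close> steps gives
  \<open>1 - \<gamma>\<close>, so \<open>J\<close> is carried to the right of the discontinuity. As
  the letter is constant, one boundary close to the left end of \<open>J\<close> decides it.\<close>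

lemma letter_left:
  assumes "int k = int (N m) + i - 1"
  shows "u k = 1"
proof -
  \<comment> \<open>The bound \<open>m' \<ge> q\<close> keeps \<open>k'\<close> a natural number,
    since \<open>i - 1\<close> can be as low as \<open>- q\<close>.\<close>
  obtain m' where m': "m' \<ge> q" "0 < y m'" "y m' < \<gamma>" using density[of 0 \<gamma> q] \<gamma>0 \<gamma>1 by auto
  define k' where "k' = nat (int (N m') + (i - 1))"
  have k': "int k' = int (N m') + (i - 1)" using m' N_ge[of m'] i_lower by (simp add: k'_def)
  obtain c :: int where c: "y k' = lam * y m' + of_int (i - 1 - i) * \<gamma> + of_int c"
    using y_N_cong[OF k'] by blast
  then have e: "y k' = (1 - \<gamma> + lam * y m') + of_int (c - 1)" by simp
  have "lam * y m' < 1 * y m'" using m' lam1 by (intro mult_strict_right_mono) auto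
  also have "\<dots> < \<gamma>" using m' by simp
  finally have "lam * y m' < \<gamma>" .
  moreover have "0 < lam * y m'" using m' lam0 by simp
  ultimately have "y k' = 1 - \<gamma> + lam * y m'"
    by (intro y_eqI[OF _ _ e]) (use \<gamma>1 in \<open>auto intro: pos_gt dest: pos_ge\<close>)
  then have "u k' = 1" using \<open>0 < lam * y m'\<close> by (simp add: u_pos pos_gt)
  moreover have "u k = u k'"
    by (rule window_const[OF _ k']) (use assms p2 q2 in auto)
  ultimately show ?thesis by simp
qed

text \<open>Since \<open>lam\<close> is congruent to \<open>(p - q) * \<gamma>\<close>, this offset
  carries the right end of \<open>J\<close> to \<open>1 - \<gamma>\<close>, with \<open>J\<close> to
  the left of the discontinuity.\<close>

lemma letter_right:
  assumes "int k = int (N m) + (i - int p + int q) - 1"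
  shows "u k = 0"
proof -
  obtain m' where m': "m' \<ge> p" "\<gamma> < y m'" "y m' < 1" using density[of \<gamma> 1 p] \<gamma>0 \<gamma>1 by auto
  define k' where "k' = nat (int (N m') + (i - int p + int q - 1))"
  have k': "int k' = int (N m') + (i - int p + int q - 1)"
    using m' N_ge[of m'] i_lower by (simp add: k'_def)
  obtain c :: int where c: "y k' = lam * y m' + of_int (i - int p + int q - 1 - i) * \<gamma> + of_int c"
    using y_N_cong[OF k'] by blast
  have "of_int (i - int p + int q - 1 - i) * \<gamma> = - (lam + of_int (p1 - q1)) - \<gamma>"
    by (subst lam_eq) (simp add: algebra_simps)
  with c have e: "y k' = (1 - \<gamma> - lam * (1 - y m')) + of_int (c - 1 - p1 + q1)"
    by (simp add: algebra_simps)
  have "lam * (1 - y m') < 1 * (1 - y m')" using m' lam1 by (intro mult_strict_right_mono) auto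
  also have "\<dots> < 1 - \<gamma>" using m' by simp
  finally have "lam * (1 - y m') < 1 - \<gamma>" .
  moreover have "0 < lam * (1 - y m')" using m' lam0 by simp
  ultimately have "y k' = 1 - \<gamma> - lam * (1 - y m')"
    by (intro y_eqI[OF _ _ e]) (use \<gamma>0 in \<open>auto intro: pos_gt dest: pos_ge\<close>)
  then have "u k' = 0" using \<open>0 < lam * (1 - y m')\<close> by (simp add: u_0 not_pos_lt)
  moreover have "u k = u k'"
    by (rule window_const[OF _ k']) (use assms p2 q2 in auto)
  ultimately show ?thesis by simp
qed

text \<open>Invertibility of \<open>lam\<close> on the module puts the preimage of
  \<open>y K\<close> under the contraction on the two-sided orbit of \<rho>. It remains to see that
  it lies on the forward orbit.\<close>

lemma in_J:
  assumes "pos f (y K - x0)" "\<not> pos f (y K - x0 - lam)"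
  shows "\<exists>m. K = N m"
proof -
  define z where "z = (y K - x0) / lam"
  have z: "y K = x0 + lam * z" using lam0 by (simp add: z_def)
  have "y K - x0 = lam * z" "y K - x0 - lam = lam * (z - 1)" using z by (auto simp: algebra_simps)
  then have zu: "pos f z" "\<not> pos f (z - 1)" using assms pos_scale[OF lam0] by auto
  obtain c :: int where c: "y K = \<rho> + of_int (int K) * \<gamma> + of_int c"
    using y_cong[of K 0] by (auto simp: y_0)
  have "z - \<rho> = (of_int (int K) * \<gamma> + of_int c) / lam"
    using z c lam0 by (simp add: x0_def field_simps)
  also have "inL \<dots>" by (intro inL_div_lam inL_I)
  finally obtain k b :: int where kb: "z - \<rho> = of_int k * \<gamma> + of_int b" by (auto simp: inL_def)
  have "lam * (z - \<rho>) = of_int (int K) * \<gamma> + of_int c"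
    using z c by (simp add: x0_def algebra_simps)
  moreover have "z - \<rho> = of_int b - of_int (- k) * \<gamma>" using kb by simp
  ultimately have "of_int (int K) * \<gamma> + of_int c =
      of_int (- ((- k - b) * int p + b * int q)) * \<gamma> + of_int ((- k) * p1 - b * (p1 - q1))"
    using lam_mult[of b "- k"] by simp
  from lin_unique(1)[OF this] have K: "int K = (k + b) * int p - b * int q"
    by (simp add: algebra_simps)
  \<comment> \<open>For negative \<open>k\<close> the signs of \<open>b\<close> and
    \<open>k + b\<close> give \<open>K \<le> 0\<close>. Then \<open>K = 0\<close>, both products
    vanish, and \<open>k = 0\<close>.\<close>
  have "k \<ge> 0"
  proof (rule ccontr)
    assume "\<not> k \<ge> 0"
    then have k: "k \<le> -1" by simp
    have zb: "\<bar>z - \<rho>\<bar> \<le> 1" using pos_ge[OF zu(1)] not_pos_le[OF zu(2)] y_bounds[of 0] by (simp add: y_0 abs_le_iff)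
    have "of_int k * \<gamma> < 0" "of_int k * (1 - \<gamma>) < 0" using k \<gamma>0 \<gamma>1 by (auto simp: mult_less_0_iff)
    then have "(of_int b :: real) > -1" "of_int (k + b) < (1 :: real)"
      using zb kb by (auto simp: algebra_simps abs_le_iff)
    then have s: "b \<ge> 0" "k + b \<le> 0" by linarith+
    then have "(k + b) * int p \<le> 0" "b * int q \<ge> 0" by (auto simp: mult_le_0_iff)
    then have "(k + b) * int p = 0" "b * int q = 0" using K by linarith+
    then have "k = 0" using p2 q2 by auto
    then show False using k by simp
  qed
  obtain c' :: int where "y (nat k) = \<rho> + of_int k * \<gamma> + of_int c'"
    using y_cong[of "nat k" 0] \<open>k \<ge> 0\<close> by (auto simp: y_0)
  then have e: "y (nat k) = z + of_int (c' - b)" using kb by simp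
  have "y (nat k) = z" by (rule y_eqI[OF zu e])
  then have "y (N (nat k)) = y K" using z by (simp add: y_N)
  then show ?thesis using y_inj by metis
qed

text \<open>The letter 1 places \<open>y K\<close> on the right of the left end of \<open>J\<close>,
  the letter 0 on the left of its right end, with the end conventions of the coding.\<close>

lemma determine:
  assumes k1: "int k1 = int K + i - 1" and k2: "int k2 = int K + (i - int p + int q) - 1"
    and "u k1 = 1" "u k2 = 0"
  shows "\<exists>m. K = N m"
proof -
  obtain k0 :: int where k0: "x0 + of_int i * \<gamma> = of_int k0" using i_props by blast
  define w where "w = y k1 - (1 - \<gamma>)"
  define w' where "w' = y k2 - (1 - \<gamma>)"
  have w: "pos f w" "\<not> pos f w'" using assms u_pos u_0 by (auto simp: w_def w'_def)
  have wb: "0 \<le> w" "w \<le> \<gamma>" "- (1 - \<gamma>) \<le> w'" "w' \<le> 0"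
    using pos_ge[OF w(1)] not_pos_le[OF w(2)] y_bounds[of k1] y_bounds[of k2]
    by (auto simp: w_def w'_def)
  obtain c :: int where c: "y K = y k1 + of_int (int K - int k1) * \<gamma> + of_int c" using y_cong by blast
  have yw: "y K = (x0 + w) + of_int (c + 1 - k0)"
    using c k0 k1 by (simp add: w_def algebra_simps)
  obtain d :: int where d: "y K = y k2 + of_int (int K - int k2) * \<gamma> + of_int d" using y_cong by blast
  have yw': "y K = x0 + lam + w' + of_int (d + 1 - k0 + (p1 - q1))"
    using d k0 k2 lam_eq by (simp add: w'_def algebra_simps)
  \<comment> \<open>The number of full turns by which the two computations of \<open>y K\<close>
    differ; the bounds on \<open>w\<close> and \<open>w'\<close> leave only 0.\<close>
  define e where "e = (d + 1 - k0 + (p1 - q1)) - (c + 1 - k0)"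
  have we: "w = lam + w' + of_int e" using yw yw' by (simp add: e_def)
  then have "(of_int e :: real) < 1" "(of_int e :: real) > -1" using wb lam0 lam1 by linarith+
  then have "e = 0" by linarith
  then have ww: "w' = w - lam" using we by simp
  have "y K = x0 + w"
  proof (rule y_eqI[OF _ _ yw])
    show "pos f (x0 + w)" using pos_mono[OF w(1)] x0_bounds by simp
    show "\<not> pos f (x0 + w - 1)"
      using w(2) pos_mono[of f "x0 + w - 1" w'] x0_bounds unfolding ww by auto
  qed
  then show ?thesis using w unfolding ww by (intro in_J) (auto simp: algebra_simps)
qed

end

section \<open>Base point, recognizable factor and incidence matrix\<close>

context coding_fixed
begin

lemma rho_bounds: "0 \<le> \<rho>" "\<rho> \<le> 1"
  using y_bounds[of 0] by (auto simp: y_0)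

text \<open>As \<open>x0 = (1 - lam) * \<rho>\<close>, a congruence for \<open>x0\<close> fixes
  \<open>(1 - lam) * \<rho>\<close> modulo 1 only. This bound turns it into an equation for
  \<rho>.\<close>

lemma small_int_zero:
  assumes "\<bar>x\<bar> < 1" "x * (1 - lam) = of_int k"
  shows "x = 0"
proof -
  have "\<bar>x * (1 - lam)\<bar> = \<bar>x\<bar> * (1 - lam)" using lam1 by (simp add: abs_mult)
  also have "\<dots> \<le> \<bar>x\<bar> * 1" using lam0 by (intro mult_left_mono) auto
  finally have "\<bar>of_int k :: real\<bar> < 1" using assms by simp
  then have "k = 0" by linarith
  then show ?thesis using assms lam1 by simp
qed

lemma rho_eq_gamma:
  assumes "i = int p - 1" shows "\<rho> = \<gamma>"
proof -
  obtain k0 :: int where k0: "x0 + of_int i * \<gamma> = of_int k0" using i_props by blast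
  have "(\<rho> - \<gamma>) * (1 - lam) = x0 - \<gamma> + lam * \<gamma>" by (simp add: x0_def algebra_simps)
  also have "\<dots> = of_int (k0 - p1)" unfolding lam_gamma using k0 assms by (simp add: algebra_simps)
  finally have "\<rho> - \<gamma> = 0"
    by (rule small_int_zero[rotated]) (use rho_bounds \<gamma>0 \<gamma>1 in \<open>auto simp: abs_less_iff\<close>)
  then show ?thesis by simp
qed

lemma rho_eq_one_minus_gamma:
  assumes "i = 1 - int q" shows "\<rho> = 1 - \<gamma>"
proof -
  obtain k0 :: int where k0: "x0 + of_int i * \<gamma> = of_int k0" using i_props by blast
  have "(\<rho> - (1 - \<gamma>)) * (1 - lam) = x0 - (1 - \<gamma>) - lam * (\<gamma> - 1)" by (simp add: x0_def algebra_simps)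
  also have "\<dots> = of_int (k0 - 1 + q1)" unfolding lam_gamma' using k0 assms by (simp add: algebra_simps)
  finally have "\<rho> - (1 - \<gamma>) = 0"
    by (rule small_int_zero[rotated]) (use rho_bounds \<gamma>0 \<gamma>1 in \<open>auto simp: abs_less_iff\<close>)
  then show ?thesis by simp
qed

text \<open>Offset 0 belongs to the window of constant letters unless \<open>i = 1 - int q\<close>,
  and inside the window both images begin alike.\<close>

lemma distinct_first_letters:
  assumes "\<phi> 0 ! 0 \<noteq> \<phi> 1 ! 0" shows "\<rho> = 1 - \<gamma>"
proof (rule rho_eq_one_minus_gamma, rule ccontr)
  assume "i \<noteq> 1 - int q"
  then have "1 < i + int q" using i_lower by linarith
  then have eq: "u (N m) = u (N m')" for m m'
    using window_const[of "N m" m 0 "N m'" m'] i_upper by simp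
  have N0: "u (N m) = \<phi> (u m) ! 0" for m
    using maps_to_nth[OF mt, of 0 m] phi_ne[of m] by simp
  obtain m m' where "u m = 0" "u m' = 1" using range_u by (metis insertCI rangeE)
  then show False using eq[of m m'] N0[of m] N0[of m'] assms by simp
qed

text \<open>Comparing coefficients of \<gamma> in \<open>x0 = \<rho> - lam * \<rho>\<close>
  expresses \<open>i\<close> by \<open>k\<close>, \<open>m\<close>, \<open>p\<close> and
  \<open>q\<close>. Then \<open>i > - q\<close> and \<open>p, q \<ge> 2\<close> give
  \<open>2 * k - 2 < k\<close>.\<close>

lemma not_backward:
  fixes k m :: int
  assumes "\<rho> = of_int m - of_int k * \<gamma>"
  shows "k \<le> 1"
proof (rule ccontr)
  assume "\<not> k \<le> 1"
  then have k: "k \<ge> 2" by simp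
  obtain k0 :: int where k0: "x0 + of_int i * \<gamma> = of_int k0" using i_props by blast
  have ne: "of_int m - of_int k * \<gamma> \<noteq> of_int b" for b :: int
    using lin_unique(1)[of "- k" m 0 b] k by auto
  have "\<rho> \<noteq> 0" "\<rho> \<noteq> 1" using ne[of 0] ne[of 1] assms by auto
  then have "0 < \<rho>" "\<rho> < 1" using rho_bounds by auto
  then have s: "m \<ge> 1" "m \<le> k" using lattice_signs[of m k] k assms by auto
  have "x0 = \<rho> - lam * \<rho>" by (simp add: x0_def algebra_simps)
  then have "of_int (- i) * \<gamma> + of_int k0 =
     (of_int m - of_int k * \<gamma>) - lam * (of_int m - of_int k * \<gamma>)" using k0 assms by simp
  also have "\<dots> = of_int (- k + ((k - m) * int p + m * int q)) * \<gamma> + of_int (m - (k * p1 - m * (p1 - q1)))"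
    unfolding lam_mult by (simp add: algebra_simps)
  finally have "- i = - k + ((k - m) * int p + m * int q)" by (rule lin_unique(1))
  then have "(k - m) * int p + (m - 1) * int q < k"
    using i_lower by (simp add: algebra_simps)
  moreover have "(k - m) * 2 \<le> (k - m) * int p" "(m - 1) * 2 \<le> (m - 1) * int q"
    using s p2 q2 by (intro mult_left_mono; simp)+
  then have "2 * k - 2 \<le> (k - m) * int p + (m - 1) * int q"
    by (simp only: algebra_simps)
  ultimately show False using k by linarith
qed

text \<open>The longest word shared by all neighbourhoods of the block boundaries \<open>N m\<close>.\<close>
definition "s = nat (int p - 1 - i)"
definition "v = seg u (N s - s) (N s - s + (p + q - 2))"

lemma s_int: "int s = int p - 1 - i"
  using i_upper by (simp add: s_def)

lemma occurs_v_N: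
  assumes "N m \<ge> s" "k < p + q - 2"
  shows "u (N m - s + k) = v ! k"
proof -
  have "u (N m - s + k) = u (N s - s + k)"
    by (rule window_const[of _ m "int k - int s" _ s])
      (use assms N_ge[of s] s_int i_lower in \<open>auto simp: of_nat_diff\<close>)
  then show ?thesis using assms by (simp add: v_def)
qed

lemma occurs_v: "occurs_at u v k \<longleftrightarrow> (\<exists>m. k + s = N m)"
proof
  assume "\<exists>m. k + s = N m"
  then obtain m where m: "k + s = N m" by blast
  have "k = N m - s" "s \<le> N m" using m by auto
  then show "occurs_at u v k" using occurs_v_N[of m] by (simp add: occurs_at_def v_def)
next
  assume occ: "occurs_at u v k"
  have len: "length v = p + q - 2" by (simp add: v_def)
  have sN: "s \<le> N s" by (rule N_ge)
  \<comment> \<open>As \<open>v\<close> starts \<open>s = p - 1 - i\<close> letters before a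
    boundary, its positions \<open>p - 2\<close> and \<open>q - 2\<close> are the offsets
    \<open>i - 1\<close> and \<open>i - p + q - 1\<close> of the two decisive letters.\<close>
  have "p - 2 < p + q - 2" "q - 2 < p + q - 2" using p2 q2 by auto
  then have "u (k + (p - 2)) = v ! (p - 2)" "u (k + (q - 2)) = v ! (q - 2)"
    using occ unfolding occurs_at_def len by blast+
  moreover have "v ! (p - 2) = u (N s - s + (p - 2))" "v ! (q - 2) = u (N s - s + (q - 2))"
    using p2 q2 by (auto simp: v_def)
  moreover have "u (N s - s + (p - 2)) = 1"
    by (rule letter_left[of _ s]) (use sN p2 s_int in auto)
  moreover have "u (N s - s + (q - 2)) = 0"
    by (rule letter_right[of _ s]) (use sN q2 s_int in auto)
  ultimately have "u (k + (p - 2)) = 1" "u (k + (q - 2)) = 0" by simp_all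
  then show "\<exists>m. k + s = N m"
    by (intro determine[of "k + (p - 2)" _ "k + (q - 2)"]) (use p2 q2 s_int in auto)
qed

text \<open>The return words of \<open>v\<close> are the images of the letters, cut \<open>s\<close>
  letters early. The first boundary with \<open>s\<close> letters in front of it has index
  \<open>n\<close>, where the shifted word starts.\<close>

lemma derived_v:
  "\<exists>n. (n \<ge> 1 \<or> \<rho> = \<gamma>) \<and> (\<forall>d. derived_word u v d \<longleftrightarrow> derived_word (\<lambda>k. u (n + k)) [] d)"
proof -
  define n where "n = (LEAST n. s \<le> N n)"
  have n: "s \<le> N n" unfolding n_def by (rule LeastI[of _ s]) (rule N_ge)
  have least: "n \<le> m" if "s \<le> N m" for m unfolding n_def using that by (rule Least_le)
  have sm: "s \<le> N (n + k)" for k using n cut_mono[of n "n + k" \<phi> u] by simp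
  let ?N = "\<lambda>k. N (n + k) - s"
  let ?u = "\<lambda>k. u (n + k)"
  have mono: "strict_mono ?N"
    using strict_mono_N sm by (auto simp: strict_mono_def intro!: diff_less_mono)
  have occ: "{k. occurs_at u v k} = ?N ` {k. occurs_at ?u [] k}"
  proof (intro equalityI subsetI)
    fix k assume "k \<in> {k. occurs_at u v k}"
    then obtain m where m: "k + s = N m" using occurs_v by auto
    then have "n \<le> m" using least[of m] by simp
    then have "k = ?N (m - n)" using m by simp
    then show "k \<in> ?N ` {k. occurs_at ?u [] k}" by simp
  next
    fix k assume "k \<in> ?N ` {k. occurs_at ?u [] k}"
    then obtain m where "k = ?N m" by auto
    then have "k + s = N (n + m)" using sm[of m] by simp
    then show "k \<in> {k. occurs_at u v k}" using occurs_v by blast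
  qed
  \<comment> \<open>The \<open>s\<close> letters before a boundary are always the same prefix of
    \<open>v\<close>, so the displaced block is a function of the letter alone.\<close>
  define g where "g w = take (length (\<phi> (hd w))) (take s v @ \<phi> (hd w))" for w
  have g: "return_seq u v k = g (return_seq ?u [] k)" for k
  proof -
    let ?m = "n + k"
    have ret: "return_seq u v k = seg u (N ?m - s) (N (Suc ?m) - s)"
    proof -
      have oc: "occ u v j = ?N j" for j
        using occ_image[OF mono occ, of j] by (simp add: occ_Nil)
      show ?thesis by (simp add: return_seq_def oc)
    qed
    have sl: "s \<le> p + q - 2" using s_int i_lower by linarith
    have pre: "seg u (N ?m - s) (N ?m) = take s v"
    proof (rule nth_equalityI)
      show "length (seg u (N ?m - s) (N ?m)) = length (take s v)"
        using sm[of k] sl by (simp add: v_def)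
    next
      fix j assume "j < length (seg u (N ?m - s) (N ?m))"
      then have "j < s" using sm[of k] by simp
      then show "seg u (N ?m - s) (N ?m) ! j = take s v ! j"
        using occurs_v_N[OF sm[of k], of j] sl sm[of k] by simp
    qed
    have "take s v @ \<phi> (u ?m) = seg u (N ?m - s) (N (Suc ?m))"
      using seg_append[of "N ?m - s" "N ?m" "N (Suc ?m)" u] cut_mono[of ?m "Suc ?m" \<phi> u]
        maps_to_block[OF mt, of ?m] pre by simp
    moreover have "take (length (\<phi> (u ?m))) (seg u (N ?m - s) (N (Suc ?m))) =
        seg u (N ?m - s) (N (Suc ?m) - s)"
      using sm[of k] by (simp add: take_map cut_Suc)
    ultimately show ?thesis using ret by (simp add: g_def)
  qed
  have lg: "length (g [a]) = length (\<phi> a)" for a by (simp add: g_def)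
  have inj: "inj_on g (range (return_seq ?u []))"
  proof (rule inj_onI)
    fix w w' assume "w \<in> range (return_seq ?u [])" "w' \<in> range (return_seq ?u [])" and eq: "g w = g w'"
    then obtain a b where w: "w = [u a]" "w' = [u b]" by auto
    have "length (\<phi> (u a)) = length (\<phi> (u b))" using eq lg w by metis
    then show "w = w'" using w p_neq_q u_01[of a] u_01[of b] by auto
  qed
  have "n \<ge> 1 \<or> \<rho> = \<gamma>"
  proof (cases "n \<ge> 1")
    case False
    then have "n = 0" by linarith
    then have "s = 0" using n by simp
    then show ?thesis using rho_eq_gamma s_int by simp
  qed simp
  then show ?thesis using derived_word_transfer[OF mono occ g inj] by blast
qed

lemma v_factor: "v \<noteq> []" "factor v u"
proof -
  show "v \<noteq> []" using p2 q2 by (simp add: v_def)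
  have "occurs_at u v (N s - s)" using occurs_v N_ge[of s] by force
  then show "factor v u" by (auto simp: factor_def)
qed

text \<open>The affine map \<open>x \<mapsto> x0 + lam * x\<close> conjugates the rotation to the first return map,
  so it transports the coding of every point, for both conventions on the interval ends.\<close>
lemma maps_to_code:
  assumes z: "pos f' z" "\<not> pos f' (z - 1)"
  shows "maps_to \<phi> (code f' \<gamma> z) (code f' \<gamma> (x0 + lam * z))"
proof -
  interpret Z: coding f' \<gamma> z using irr \<gamma>0 \<gamma>1 z by unfold_locales auto
  let ?Y = "\<lambda>n. (rot f' \<gamma> ^^ n) (x0 + lam * z)"
  let ?U = "code f' \<gamma> (x0 + lam * z)"
  let ?N = "cut \<phi> (code f' \<gamma> z)"
  have ext: "pos f' (Z.y n - lend (Z.u n))" "\<not> pos f' (Z.y n - rend (Z.u n))" for n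
    using Z.u_pos[of n] Z.u_0[of n] Z.u_01[of n] Z.y_unit[of n] by (auto simp: lend_def rend_def)
  have letter: "code f' \<gamma> (x0 + lam * z) n = b"
    if Y: "?Y n = x0 + lam * Z.y m + ht \<gamma> (take j (\<phi> (Z.u m)))"
      and j: "j < length (\<phi> (Z.u m))" and b: "b = \<phi> (Z.u m) ! j" for n m j b
  proof -
    have a: "Z.u m \<in> {0, 1}" using Z.u_01[of m] by auto
    note le = level_ends[OF a j]
    have "b \<in> set (\<phi> (Z.u m))" using b j by simp
    moreover have "set (\<phi> (Z.u m)) = {0, 1}" using Z.u_01[of m] set0 set1 by metis
    ultimately have b01: "b = 0 \<or> b = 1" by simp
    have 1: "lam * (Z.y m - lend (Z.u m)) \<le> ?Y n - lend b" using Y le(1) b by (simp add: algebra_simps)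
    have 2: "?Y n - rend b \<le> lam * (Z.y m - rend (Z.u m))" using Y le(2) b by (simp add: algebra_simps)
    have "pos f' (?Y n - lend b)" using 1 ext(1)[of m] pos_scale[OF lam0] pos_mono by blast
    moreover have "\<not> pos f' (?Y n - rend b)" using 2 ext(2)[of m] pos_scale[OF lam0] pos_mono by blast
    ultimately show ?thesis using b01 by (auto simp: code_def lend_def rend_def)
  qed
  have step: "?Y (Suc n) = ?Y n + (if ?U n = 0 then \<gamma> else \<gamma> - 1)" for n
    by (simp add: code_def rot_def)
  have lev: "?Y (?N m + j) = x0 + lam * Z.y m + ht \<gamma> (take j (\<phi> (Z.u m)))"
    if "?Y (?N m) = x0 + lam * Z.y m" "j \<le> length (\<phi> (Z.u m))" for m j
    using that(2)
  proof (induction j)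
    case 0 then show ?case using that(1) by simp
  next
    case (Suc j)
    then have IH: "?Y (?N m + j) = x0 + lam * Z.y m + ht \<gamma> (take j (\<phi> (Z.u m)))" by simp
    have "?U (?N m + j) = \<phi> (Z.u m) ! j" using letter[OF IH] Suc.prems by simp
    then show ?case using IH step[of "?N m + j"] Suc.prems by (simp add: take_Suc_conv_app_nth)
  qed
  have YN: "?Y (?N m) = x0 + lam * Z.y m" for m
  proof (induction m)
    case 0 show ?case by (simp add: Z.y_0)
  next
    case (Suc m)
    have "ht \<gamma> (\<phi> (Z.u m)) = lam * (if Z.u m = 0 then \<gamma> else \<gamma> - 1)"
      using Z.u_01[of m] ht_phi0 ht_phi1 by auto
    then show ?case using lev[OF Suc order_refl] by (simp add: cut_Suc Z.y_Suc algebra_simps)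
  qed
  show ?thesis
  proof (rule maps_toI_blocks)
    fix m
    show "\<phi> (Z.u m) = seg ?U (?N m) (?N (Suc m))"
    proof (rule nth_equalityI)
      fix j assume "j < length (\<phi> (Z.u m))"
      then show "\<phi> (Z.u m) ! j = seg ?U (?N m) (?N (Suc m)) ! j"
        using letter[OF lev[OF YN], of j m] by (simp add: cut_Suc)
    qed (simp add: cut_Suc)
  qed
qed

text \<open>The point \<open>1 - \<gamma>\<close> is interior, so both conventions code it and the
  contraction fixes it in both. This produces the second fixed point when the images begin with
  different letters.\<close>

lemma other_flag:
  assumes "\<rho> = 1 - \<gamma>"
  shows "maps_to \<phi> (code (\<not> f) \<gamma> \<rho>) (code (\<not> f) \<gamma> \<rho>)"
proof -
  have "x0 + lam * \<rho> = \<rho>" by (simp add: x0_def algebra_simps)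
  then show ?thesis using maps_to_code[of "\<not> f" \<rho>] \<gamma>0 \<gamma>1 assms
    by (simp add: pos_gt not_pos_lt)
qed

definition "pz = int (length (filter (\<lambda>a. a = 0) (\<phi> 0)))"
definition "qz = int (length (filter (\<lambda>a. a = 0) (\<phi> 1)))"

lemma p_split: "int p = pz + p1" and q_split: "int q = qz + q1"
  using sum_length_filter_compl[of "\<lambda>a. a = 0" "\<phi> 0"] sum_length_filter_compl[of "\<lambda>a. a = 0" "\<phi> 1"]
  by (simp_all add: pz_def qz_def p1_def q1_def)

text \<open>Invertibility on the module makes the determinant of the incidence matrix a unit; its
  eigenvalues decide the sign.\<close>

lemma det_one: "pz * q1 - p1 * qz = 1"
proof -
  obtain a b :: int where ab: "\<gamma> / lam = of_int a * \<gamma> + of_int b"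
    using inL_div_lam[OF inL_I[of 1 0]] by (auto simp: inL_def)
  obtain a' b' :: int where ab': "1 / lam = of_int a' * \<gamma> + of_int b'"
    using inL_div_lam[OF inL_I[of 0 1]] by (auto simp: inL_def)
  have expand: "lam * (of_int x * \<gamma> + of_int z) =
      of_int (x * int p + z * int p - z * int q) * \<gamma> + of_int (- (x + z) * p1 + z * q1)" for x z :: int
  proof -
    have "lam * (of_int x * \<gamma> + of_int z) = of_int (x + z) * (lam * \<gamma>) - of_int z * (lam * (\<gamma> - 1))"
      by (simp add: algebra_simps)
    then show ?thesis unfolding lam_gamma lam_gamma' by (simp add: algebra_simps)
  qed
  have "of_int 1 * \<gamma> + of_int 0 = lam * (of_int a * \<gamma> + of_int b)" using ab lam0 by (simp add: field_simps)
  note e1 = lin_unique[OF this[unfolded expand], symmetric]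
  have "of_int 0 * \<gamma> + of_int 1 = lam * (of_int a' * \<gamma> + of_int b')" using ab' lam0 by (simp add: field_simps)
  note e2 = lin_unique[OF this[unfolded expand], symmetric]
  define D where "D = pz * q1 - p1 * qz"
  \<comment> \<open>Multiplicativity of determinants: the coordinates of
    \<open>\<gamma> / lam\<close> and \<open>1 / lam\<close> form the inverse matrix.\<close>
  have "(a * b' - b * a') * D =
     (a * int p + b * int p - b * int q) * (- (a' + b') * p1 + b' * q1)
     - (- (a + b) * p1 + b * q1) * (a' * int p + b' * int p - b' * int q)"
    unfolding D_def p_split q_split by (simp add: algebra_simps)
  then have "(a * b' - b * a') * D = 1" using e1 e2 by simp
  then have "D dvd 1" by (metis dvd_triv_right)
  \<comment> \<open>One eigenvalue is \<open>lam\<close>, so the other is the trace minus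
    \<open>lam\<close>. It is positive because both diagonal entries are at least
    \<open>lam\<close>.\<close>
  moreover have "D > 0"
  proof -
    have 1: "of_int p1 * (1 - \<gamma>) = \<gamma> * (of_int pz - lam)"
      using lam_gamma unfolding p_split by (simp add: algebra_simps)
    have 2: "of_int qz * \<gamma> = (1 - \<gamma>) * (of_int q1 - lam)"
      using lam_gamma' unfolding q_split by (simp add: algebra_simps)
    have "(1 - \<gamma>) * \<gamma> * (of_int p1 * of_int qz) = (of_int p1 * (1 - \<gamma>)) * (of_int qz * \<gamma>)"
      by (simp add: algebra_simps)
    also have "\<dots> = (1 - \<gamma>) * \<gamma> * ((of_int pz - lam) * (of_int q1 - lam))"
      unfolding 1 2 by (simp add: algebra_simps)
    finally have "of_int p1 * of_int qz = (of_int pz - lam) * (of_int q1 - lam)"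
      using \<gamma>0 \<gamma>1 by simp
    then have D: "of_int D = lam * (of_int pz + of_int q1 - lam)"
      by (simp add: D_def algebra_simps)
    have "of_int p1 * (1 - \<gamma>) \<ge> 0" "of_int qz * \<gamma> \<ge> 0" using \<gamma>0 \<gamma>1 by (auto simp: p1_def qz_def)
    then have "of_int pz - lam \<ge> 0" "of_int q1 - lam \<ge> 0"
      unfolding 1 2 using \<gamma>0 \<gamma>1 by (auto simp: zero_le_mult_iff)
    then have "lam * (of_int pz + of_int q1 - lam) > 0" using lam0 by (intro mult_pos_pos) auto
    then show ?thesis using D by (metis of_int_0_less_iff)
  qed
  ultimately show ?thesis unfolding D_def by simp
qed

text \<open>The frequency vector \<open>(1 - \<gamma>, \<gamma>)\<close> is an eigenvector of the
  incidence matrix, so the proportion of ones in its image is again \<gamma>.\<close>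

lemma slope_eq:
  "(1 - \<gamma>) * of_int p1 + \<gamma> * of_int q1 = \<gamma> * ((1 - \<gamma>) * of_int pz + \<gamma> * of_int qz + ((1 - \<gamma>) * of_int p1 + \<gamma> * of_int q1))"
proof -
  have "(1 - \<gamma>) * (lam * \<gamma>) + \<gamma> * (lam * (\<gamma> - 1)) = 0" by (simp add: algebra_simps)
  then have "(1 - \<gamma>) * (of_int (int p) * \<gamma> - of_int p1) + \<gamma> * (of_int (int q) * \<gamma> - of_int q1) = 0"
    unfolding lam_gamma lam_gamma' .
  then show ?thesis unfolding p_split q_split by (simp add: algebra_simps)
qed

end

section \<open>Closeable substitutions fix special words\<close>

definition pw :: "(nat \<Rightarrow> nat list) \<Rightarrow> nat \<Rightarrow> nat \<Rightarrow> nat list" where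
  "pw \<phi> k a = (mimage \<phi> ^^ k) [a]"

lemma maps_to_pw: "maps_to \<phi> w w \<Longrightarrow> maps_to (pw \<phi> k) w w"
proof (induction k)
  case 0
  have "mimage (pw \<phi> 0) x = x" for x by (induction x) (simp_all add: pw_def)
  then show ?case unfolding maps_to_def by simp
next
  case (Suc k)
  have "pw \<phi> (Suc k) = (\<lambda>a. mimage \<phi> (pw \<phi> k a))" by (simp add: pw_def fun_eq_iff)
  then show ?case using maps_to_comp[OF Suc.prems Suc.IH[OF Suc.prems]] by simp
qed

lemma maps_to_hd_prefix:
  assumes "maps_to \<phi> w u" shows "set (\<phi> (w 0)) \<subseteq> range u"
  using maps_to_block[OF assms, of 0, symmetric] by auto

lemma set_mimage: "set (mimage \<phi> w) = (\<Union>a\<in>set w. set (\<phi> a))"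
  by (induction w) auto

lemma set_pw: "(\<And>a. a \<in> A \<Longrightarrow> set (\<phi> a) \<subseteq> A) \<Longrightarrow> a \<in> A \<Longrightarrow> set (pw \<phi> k a) \<subseteq> A"
proof (induction k)
  case (Suc k)
  have "set (pw \<phi> (Suc k) a) = (\<Union>b\<in>set (pw \<phi> k a). set (\<phi> b))"
    by (simp add: pw_def set_mimage)
  then show ?case using Suc by blast
qed (simp add: pw_def)

lemma (in coding) alphabet:
  assumes "primitive_morphism A \<phi>" "fixed_point A \<phi> u"
  shows "A = {0, 1}"
proof
  show "{0, 1} \<subseteq> A" using assms(2) range_u by (simp add: fixed_point_iff)
  then have "u 0 \<in> A" using u_01[of 0] by auto
  moreover obtain k where "\<forall>a\<in>A. \<forall>b\<in>A. b \<in> set (pw \<phi> k a)"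
    using assms(1) by (auto simp: primitive_morphism_def pw_def)
  ultimately have "A \<subseteq> set (pw \<phi> k (u 0))" by blast
  then show "A \<subseteq> {0, 1}"
    using maps_to_hd_prefix[OF maps_to_pw, of \<phi> u k] assms(2) range_u by (auto simp: fixed_point_iff)
qed

text \<open>A power puts both letters into both images. Its square multiplies displacements by a
  square, which excludes reversal of orientation. All fixed points of \<open>\<phi>\<close> are
  kept, so uniqueness statements carry back to \<open>\<phi>\<close>.\<close>

lemma (in coding) power_coding_fixed:
  assumes "primitive_morphism A \<phi>" "fixed_point A \<phi> u"
  shows "\<exists>\<Phi>. coding_fixed f \<gamma> \<rho> \<Phi> \<and> (\<forall>w. maps_to \<phi> w w \<longrightarrow> maps_to \<Phi> w w)"
proof -
  note A = alphabet[OF assms]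
  obtain k where k: "\<forall>a\<in>A. \<forall>b\<in>A. b \<in> set (pw \<phi> k a)"
    using assms(1) by (auto simp: primitive_morphism_def pw_def)
  have cl: "\<And>a. a \<in> A \<Longrightarrow> set (\<phi> a) \<subseteq> A" using assms(1) by (simp add: primitive_morphism_def)
  have sub: "set (pw \<phi> k a) = {0, 1}" if "a \<in> {0, 1}" for a
  proof -
    have a: "a \<in> A" using that A by simp
    then have "set (pw \<phi> k a) \<subseteq> A" using cl by (intro set_pw)
    moreover have "A \<subseteq> set (pw \<phi> k a)" using a k by blast
    ultimately have "set (pw \<phi> k a) = A" by blast
    then show ?thesis using A by simp
  qed
  define \<Phi> where "\<Phi> a = mimage (pw \<phi> k) (pw \<phi> k a)" for a
  have fix_all: "maps_to \<Phi> w w" if "maps_to \<phi> w w" for w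
    using maps_to_comp[OF maps_to_pw maps_to_pw, OF that that, of k k] by (simp add: \<Phi>_def[abs_def])
  have mu: "maps_to \<phi> u u" using assms(2) by (simp add: fixed_point_iff)
  interpret P: coding_maps f \<gamma> \<rho> "pw \<phi> k"
    by unfold_locales (rule maps_to_pw[OF mu])
  have s: "set (\<Phi> a) = {0, 1}" if "a \<in> {0, 1}" for a
    using sub that by (simp add: \<Phi>_def set_mimage)
  have "ht \<gamma> (\<Phi> 0) = P.lam * (P.lam * \<gamma>)"
    using P.ht_phi[of "pw \<phi> k 0"] sub[of 0] by (simp add: \<Phi>_def P.ht_phi0)
  then have "ht \<gamma> (\<Phi> 0) = (P.lam)\<^sup>2 * \<gamma>" by (simp add: power2_eq_square)
  then have "ht \<gamma> (\<Phi> 0) \<ge> 0" using \<gamma>0 by simp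
  moreover have "ht \<gamma> (\<Phi> 0) \<noteq> 0"
  proof
    assume "ht \<gamma> (\<Phi> 0) = 0"
    moreover obtain l :: int where "ht \<gamma> (\<Phi> 0) = of_int (int (length (\<Phi> 0))) * \<gamma> - of_int l"
      using ht_int by blast
    ultimately have "of_int (int (length (\<Phi> 0))) * \<gamma> = of_int l" by simp
    from irrational_lin[OF irr this] show False using s[of 0] by auto
  qed
  ultimately have "coding_fixed f \<gamma> \<rho> \<Phi>"
    using s[of 0] s[of 1] fix_all[OF mu] by unfold_locales auto
  then show ?thesis using fix_all by blast
qed

lemma (in coding_fixed) fixed_unique:
  assumes "maps_to \<phi> w w" "w 0 = u 0"
  shows "w = u"
proof -
  have "length (\<phi> (u 0)) \<ge> 2" using u_01[of 0] p2 q2 by auto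
  then show ?thesis using maps_to_unique[OF mt assms(1)] assms(2) phi_ne by auto
qed

lemma (in coding) fixed_point_unique:
  assumes "primitive_morphism A \<phi>" "fixed_point A \<phi> u" "fixed_point A \<phi> w" "w 0 = u 0"
  shows "w = u"
proof -
  obtain \<Phi> where \<Phi>: "coding_fixed f \<gamma> \<rho> \<Phi>" "\<And>w. maps_to \<phi> w w \<Longrightarrow> maps_to \<Phi> w w"
    using power_coding_fixed[OF assms(1,2)] by blast
  interpret F: coding_fixed f \<gamma> \<rho> \<Phi> by (rule \<Phi>(1))
  show ?thesis using F.fixed_unique \<Phi>(2) assms by (simp add: fixed_point_iff)
qed

text \<open>Derived words are given up to a permutation of letters, hence the swapped
  alternative.\<close>

definition fixed_in :: "(nat set \<times> (nat \<Rightarrow> nat list)) set \<Rightarrow> (nat \<Rightarrow> nat) \<Rightarrow> bool" where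
  "fixed_in M w \<longleftrightarrow> (\<exists>(B, \<psi>)\<in>M. fixed_point B \<psi> w \<or> fixed_point B \<psi> (swap01 \<circ> w))"

lemma swap_swap: "swap01 \<circ> (swap01 \<circ> w) = w"
  by (simp add: fun_eq_iff)

lemma fixed_in_swap: "fixed_in M (swap01 \<circ> w) \<longleftrightarrow> fixed_in M w"
  unfolding fixed_in_def swap_swap by auto

lemma (in coding) derivation_step:
  assumes M: "closed_under_derivation M" and B: "(B, \<psi>) \<in> M" "fixed_point B \<psi> u"
  shows "\<rho> = \<gamma> \<or> (\<exists>n\<ge>1. fixed_in M (\<lambda>k. u (n + k)))"
proof -
  have "primitive_morphism B \<psi>"
    using M B by (auto simp: closed_under_derivation_def primitive_substitution_def)
  from power_coding_fixed[OF this B(2)] obtain \<Phi> where \<Phi>: "coding_fixed f \<gamma> \<rho> \<Phi>" by blast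
  interpret F: coding_fixed f \<gamma> \<rho> \<Phi> by (rule \<Phi>)
  obtain n where n: "n \<ge> 1 \<or> \<rho> = \<gamma>"
    "\<And>d. derived_word u F.v d \<longleftrightarrow> derived_word (\<lambda>k. u (n + k)) [] d"
    using F.derived_v by blast
  have "\<exists>d. derived_word u F.v d \<and> (\<exists>(B, \<psi>)\<in>M. fixed_point B \<psi> d)"
    using M B F.v_factor unfolding closed_under_derivation_def by fast
  then obtain d B' \<psi>' where d: "derived_word u F.v d" "(B', \<psi>') \<in> M" "fixed_point B' \<psi>' d" by blast
  have "d = (\<lambda>k. u (n + k)) \<or> d = swap01 \<circ> (\<lambda>k. u (n + k))"
    by (rule derived_word_Nil_cases[OF iffD1[OF n(2) d(1)] range_shift])
  then have "fixed_in M (\<lambda>k. u (n + k))" using d(2,3) unfolding fixed_in_def by blast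
  then show ?thesis using n(1) by blast
qed

lemma (in coding) closeable_imp_special:
  assumes cl: "closeable_under_derivation A \<phi>" and fp: "fixed_point A \<phi> u"
  shows "\<rho> \<in> {0, \<gamma>, 1 - \<gamma>, 1}"
proof -
  obtain M where M: "closed_under_derivation M" "(A, \<phi>) \<in> M"
    using cl by (auto simp: closeable_under_derivation_def)
  have prim: "primitive_morphism B \<psi>" if "(B, \<psi>) \<in> M" for B \<psi>
    using M that by (auto simp: closed_under_derivation_def primitive_substitution_def)
  define S where "S n = (\<lambda>k. u (n + k))" for n
  have S_code: "S n = code f \<gamma> (y n)" for n
    by (simp add: S_def y_def code_shift fun_eq_iff)
  have S_swap: "swap01 \<circ> S n = code (\<not> f) (1 - \<gamma>) (1 - y n)" for n
    by (simp add: S_code code_swap)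
  have cs: "coding f \<gamma> (y n)" and cs': "coding (\<not> f) (1 - \<gamma>) (1 - y n)" for n
    using coding_shift coding.coding_swap[OF coding_shift] by blast+
  define R where "R = {n. fixed_in M (S n)}"
  have step: "y n = \<gamma> \<or> (\<exists>m\<in>R. n < m)" if nR: "n \<in> R" for n
  proof -
    obtain B \<psi> where B: "(B, \<psi>) \<in> M" "fixed_point B \<psi> (S n) \<or> fixed_point B \<psi> (swap01 \<circ> S n)"
      using nR by (auto simp: R_def fixed_in_def)
    have shift: "(\<lambda>k. S n (m + k)) = S (n + m)" for m by (simp add: S_def add.assoc)
    have shift': "(\<lambda>k. (swap01 \<circ> S n) (m + k)) = swap01 \<circ> S (n + m)" for m
      by (simp add: S_def add.assoc fun_eq_iff)
    have "y n = \<gamma> \<or> (\<exists>m\<ge>1. fixed_in M (S (n + m)))"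
      using B(2)
    proof
      assume "fixed_point B \<psi> (S n)"
      from coding.derivation_step[OF cs M(1) B(1) this[unfolded S_code]]
      show ?thesis unfolding S_code[symmetric] shift .
    next
      assume "fixed_point B \<psi> (swap01 \<circ> S n)"
      from coding.derivation_step[OF cs' M(1) B(1) this[unfolded S_swap]]
      show ?thesis unfolding S_swap[symmetric] shift' fixed_in_swap by simp
    qed
    then show ?thesis
    proof
      assume "\<exists>m\<ge>1. fixed_in M (S (n + m))"
      then obtain m where "m \<ge> 1" "n + m \<in> R" by (auto simp: R_def)
      then show ?thesis by (intro disjI2 bexI[of _ "n + m"]) auto
    qed simp
  qed
  have "finite R"
  proof -
    \<comment> \<open>A label consists of a member of \<open>M\<close>, a bit for the swap and a
      first letter. It fits at most one shift, because it determines the fixed word and distinct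
      shifts of \<open>u\<close> are distinct words.\<close>
    define D where "D t = {n. case t of (Bp, b, a) \<Rightarrow>
        fixed_point (fst Bp) (snd Bp) (if b then swap01 \<circ> S n else S n) \<and> S n 0 = a}"
      for t :: "(nat set \<times> (nat \<Rightarrow> nat list)) \<times> bool \<times> nat"
    have "R \<subseteq> (\<Union>t\<in>M \<times> UNIV \<times> {0, 1}. D t)"
    proof
      fix n assume "n \<in> R"
      then obtain Bp where B: "Bp \<in> M"
        "fixed_point (fst Bp) (snd Bp) (S n) \<or> fixed_point (fst Bp) (snd Bp) (swap01 \<circ> S n)"
        by (auto simp: R_def fixed_in_def)
      then obtain b where "fixed_point (fst Bp) (snd Bp) (if b then swap01 \<circ> S n else S n)" by metis
      then have "n \<in> D (Bp, b, S n 0)" by (simp add: D_def)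
      moreover have "S n 0 \<in> {0, 1}" using u_01[of n] by (auto simp: S_def)
      ultimately show "n \<in> (\<Union>t\<in>M \<times> UNIV \<times> {0, 1}. D t)" using B(1) by blast
    qed
    moreover have "finite (D t)" if "t \<in> M \<times> UNIV \<times> {0, 1}" for t
    proof -
      obtain B \<psi> b a where t: "t = ((B, \<psi>), b, a)" by (metis prod.exhaust)
      have BM: "(B, \<psi>) \<in> M" using that t by auto
      have "n = m" if "n \<in> D t" "m \<in> D t" for n m
      proof -
        have eq0: "S n 0 = S m 0" using that t by (auto simp: D_def)
        have "S n = S m"
        proof (cases b)
          case True
          then have "fixed_point B \<psi> (swap01 \<circ> S n)" "fixed_point B \<psi> (swap01 \<circ> S m)"
            using that t by (auto simp: D_def)
          then have "swap01 \<circ> S m = swap01 \<circ> S n"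
            using coding.fixed_point_unique[OF cs'[of n] prim[OF BM], folded S_swap, of "swap01 \<circ> S m"] eq0
            by auto
          then show ?thesis by (metis swap_swap)
        next
          case False
          then have "fixed_point B \<psi> (S n)" "fixed_point B \<psi> (S m)"
            using that t by (auto simp: D_def)
          then show ?thesis
            using coding.fixed_point_unique[OF cs[of n] prim[OF BM], folded S_code, of "S m"] eq0
            by auto
        qed
        then show ?thesis unfolding S_def by (rule shift_inj)
      qed
      then have "D t = {} \<or> (\<exists>n. D t = {n})" by blast
      then show ?thesis by auto
    qed
    moreover have "finite M" using M by (simp add: closed_under_derivation_def)
    then have "finite (M \<times> (UNIV :: bool set) \<times> {0, 1::nat})" by simp
    ultimately show ?thesis by (meson finite_UN_I finite_subset)
  qed
  have "S 0 = u" by (simp add: S_def)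
  then have "0 \<in> R" using M(2) fp by (auto simp: R_def fixed_in_def)
  \<comment> \<open>From the largest index in \<open>R\<close> no proper shift is possible, so
    derivation has reached the base point \<gamma>.\<close>
  define n where "n = Max R"
  have "n \<in> R" "\<And>m. m \<in> R \<Longrightarrow> m \<le> n"
    using \<open>finite R\<close> \<open>0 \<in> R\<close> by (auto simp: n_def intro: Max_in)
  then have yn: "y n = \<gamma>" using step[of n] by fastforce
  obtain \<Phi> where "coding_fixed f \<gamma> \<rho> \<Phi>" using power_coding_fixed[OF prim[OF M(2)] fp] by blast
  then interpret F: coding_fixed f \<gamma> \<rho> \<Phi> .
  obtain c :: int where c: "\<gamma> = \<rho> + of_int (int n) * \<gamma> + of_int c"
    using F.y_cong[of n 0] yn by (auto simp: y_0)
  \<comment> \<open>Read backwards, \<rho> is congruent to \<open>(1 - n) * \<gamma>\<close>. The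
    values 0, 1, 2 of \<open>n\<close> give \<gamma>, an end of the unit interval, and
    \<open>1 - \<gamma>\<close>.\<close>
  then have rho: "\<rho> = of_int (- c) - of_int (int n - 1) * \<gamma>" by (simp add: algebra_simps)
  then have "int n - 1 \<le> 1" by (rule F.not_backward)
  then consider "n = 0" | "n = 1" | "n = 2" by linarith
  then show ?thesis
  proof cases
    case 1
    then have "\<rho> = \<gamma>" using yn by (simp add: y_0)
    then show ?thesis by simp
  next
    case 2
    then have "\<rho> = of_int (- c)" using rho by simp
    then have "- c = 0 \<or> - c = 1" using F.rho_bounds by auto
    then show ?thesis using \<open>\<rho> = of_int (- c)\<close> by auto
  next
    case 3
    then have r: "\<rho> = of_int (- c) - \<gamma>" using rho by simp
    then have "of_int (- c) < (2::real)" "of_int (- c) > (0::real)" using F.rho_bounds \<gamma>0 \<gamma>1 by auto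
    then have "- c = 1" by linarith
    then show ?thesis using r by simp
  qed
qed

declare One_nat_def [simp]

section \<open>Desubstitution of special words\<close>

abbreviation prep :: "nat list \<Rightarrow> (nat \<Rightarrow> nat) \<Rightarrow> nat \<Rightarrow> nat" where
  "prep t w \<equiv> foldr case_nat t w"

text \<open>\<open>L0\<close> and \<open>R0\<close> are conjugate by the letter 0. The second serves
  words beginning with 1, since every image under \<open>L0\<close> begins with 0.\<close>

definition L0 :: "nat \<Rightarrow> nat list" where "L0 a = (if a = 0 then [0] else [0, 1])"
definition R0 :: "nat \<Rightarrow> nat list" where "R0 a = (if a = 0 then [0] else [1, 0])"

lemma seg_case_nat: "seg (case_nat a u) 0 (Suc n) = a # seg u 0 n"
  by (simp add: map_upt_Suc del: upt_Suc)

lemma prefix_prep: "x = seg u 0 (length x) \<Longrightarrow> t @ x = seg (prep t u) 0 (length (t @ x))"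
proof (induction t)
  case (Cons a t)
  from Cons.IH[OF Cons.prems] show ?case
    using seg_case_nat[of a "prep t u" "length (t @ x)"] by simp
qed simp

lemma maps_to_prep:
  assumes "maps_to \<phi> w u"
  shows "maps_to \<phi> (case_nat a w) (prep (\<phi> a) u)"
  unfolding maps_to_def
proof
  fix n
  show "mimage \<phi> (seg (case_nat a w) 0 n) =
      seg (prep (\<phi> a) u) 0 (length (mimage \<phi> (seg (case_nat a w) 0 n)))"
  proof (cases n)
    case (Suc m)
    have "mimage \<phi> (seg w 0 m) = seg u 0 (length (mimage \<phi> (seg w 0 m)))"
      using assms unfolding maps_to_def by blast
    from prefix_prep[OF this, of "\<phi> a"] show ?thesis
      unfolding Suc seg_case_nat by simp
  qed simp
qed

lemma L0_simps: "L0 0 = [0]" "L0 (Suc 0) = [0, 1]"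
  by (simp_all add: L0_def)

lemma L0_ne: "L0 a \<noteq> []" by (simp add: L0_def)

lemma L0_R0: "mimage L0 x @ [0] = 0 # mimage R0 x"
  by (induction x) (auto simp: L0_def R0_def)

lemma maps_to_L0_nth0: "maps_to L0 w u \<Longrightarrow> u (cut L0 w m) = 0"
  using maps_to_nth[of L0 w u 0 m] by (simp add: L0_def split: if_splits)

lemma maps_to_L0_nth1: "maps_to L0 w u \<Longrightarrow> w m \<noteq> 0 \<Longrightarrow> u (Suc (cut L0 w m)) = 1"
  using maps_to_nth[of L0 w u 1 m] by (simp add: L0_def)

lemma cut_L0_Suc: "cut L0 w (Suc m) = (if w m = 0 then Suc (cut L0 w m) else Suc (Suc (cut L0 w m)))"
  by (simp add: cut_Suc L0_def)

lemma maps_to_L0_zero_iff: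
  assumes "maps_to L0 w u"
  shows "u k = 0 \<longleftrightarrow> (\<exists>m. k = cut L0 w m)"
proof
  assume k: "u k = 0"
  obtain m j where mj: "k = cut L0 w m + j" "j < length (L0 (w m))"
    using cut_cover[of L0 w k] L0_ne by blast
  have "j = 0"
  proof (rule ccontr)
    assume "j \<noteq> 0"
    then have "j = 1" "w m \<noteq> 0" using mj(2) by (auto simp: L0_def split: if_splits)
    then have "u k = 1" using maps_to_L0_nth1[OF assms, of m] mj(1) by simp
    then show False using k by simp
  qed
  then show "\<exists>m. k = cut L0 w m" using mj by auto
qed (use maps_to_L0_nth0[OF assms] in auto)

lemma maps_to_L0_cases:
  assumes "maps_to L0 w u"
  obtains m where "k = cut L0 w m" "u k = 0"
  | m where "k = Suc (cut L0 w m)" "w m \<noteq> 0" "u k = 1"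
proof -
  obtain m j where mj: "k = cut L0 w m + j" "j < length (L0 (w m))"
    using cut_cover[of L0 w k] L0_ne by blast
  then consider "j = 0" | "j = 1" "w m \<noteq> 0" by (auto simp: L0_def less_Suc_eq split: if_splits)
  then show thesis
  proof cases
    case 1 then show ?thesis using that(1)[of m] mj maps_to_L0_nth0[OF assms] by simp
  next
    case 2 then show ?thesis using that(2)[of m] mj maps_to_L0_nth1[OF assms] by simp
  qed
qed

lemma maps_to_L0_one_next: "maps_to L0 w u \<Longrightarrow> u k \<noteq> 0 \<Longrightarrow> u (Suc k) = 0"
proof -
  assume mt: "maps_to L0 w u" and k: "u k \<noteq> 0"
  show ?thesis
  proof (rule maps_to_L0_cases[OF mt, of k])
    fix m assume "k = Suc (cut L0 w m)" "w m \<noteq> 0"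
    then show ?thesis using maps_to_L0_nth0[OF mt, of "Suc m"] by (simp add: cut_L0_Suc)
  qed (use k in simp)
qed

lemma maps_to_L0_one_prev:
  assumes "maps_to L0 w u" "u k = 1" shows "\<exists>j. k = Suc j \<and> u j = 0"
  by (rule maps_to_L0_cases[OF assms(1), of k])
    (use assms(2) in \<open>auto simp: maps_to_L0_nth0[OF assms(1)]\<close>)

text \<open>By conjugacy, \<open>R0\<close> of \<open>1 x\<close> is \<open>1\<close>, then
  \<open>L0\<close> of \<open>x\<close>, then \<open>0\<close>; this last 0 is the first letter of
  the next \<open>L0\<close> block.\<close>

lemma maps_to_R0:
  assumes "maps_to L0 w u"
  shows "maps_to R0 (case_nat 1 w) (case_nat 1 u)"
  unfolding maps_to_def
proof
  fix n
  show "mimage R0 (seg (case_nat 1 w) 0 n) =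
      seg (case_nat 1 u) 0 (length (mimage R0 (seg (case_nat 1 w) 0 n)))"
  proof (cases n)
    case (Suc m)
    have "mimage L0 (seg w 0 m) = seg u 0 (cut L0 w m)"
      using maps_to_seg[OF assms, of 0 m] by simp
    then have "mimage L0 (seg w 0 m) @ [0] = seg u 0 (Suc (cut L0 w m))"
      using maps_to_L0_nth0[OF assms, of m] by simp
    moreover have "mimage R0 (seg (case_nat 1 w) 0 n) = 1 # (mimage L0 (seg w 0 m) @ [0])"
      unfolding Suc seg_case_nat by (simp add: L0_R0) (simp add: R0_def)
    ultimately have eq: "mimage R0 (seg (case_nat 1 w) 0 n) = seg (case_nat 1 u) 0 (Suc (Suc (cut L0 w m)))"
      using seg_case_nat[of 1 u "Suc (cut L0 w m)"] by simp
    show ?thesis unfolding eq by simp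
  qed simp
qed

section \<open>Occurrences and derived words in images under \<open>L0\<close>\<close>

lemma occurs_at_Cons: "occurs_at u (a # x) k \<longleftrightarrow> u k = a \<and> occurs_at u x (Suc k)"
  by (auto simp: occurs_at_def nth_Cons' less_Suc_eq_0_disj)

lemma occurs_at_append: "occurs_at u (x @ z) k \<longleftrightarrow> occurs_at u x k \<and> occurs_at u z (k + length x)"
  by (induction x arbitrary: k) (auto simp: occurs_at_Cons)

lemma occurs_at_seg: "occurs_at u x k \<longleftrightarrow> x = seg u k (k + length x)"
  by (subst list_eq_iff_nth_eq) (auto simp: occurs_at_def)

text \<open>The closing 0 certifies that a block ends before it. Without it a last letter 0 of the
  image of \<open>x\<close> could be the start of a block \<open>01\<close>.\<close>

lemma occurs_at_L0:
  assumes mt: "maps_to L0 w u" and w: "range w \<subseteq> {0, 1}" and "set x \<subseteq> {0, 1}"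
  shows "occurs_at u (mimage L0 x @ [0]) k \<longleftrightarrow> (\<exists>m. k = cut L0 w m \<and> occurs_at w x m)"
  using assms(3)
proof (induction x arbitrary: k)
  case Nil
  then show ?case using maps_to_L0_zero_iff[OF mt] by (simp add: occurs_at_Cons)
next
  case (Cons a x)
  have inj: "cut L0 w m = cut L0 w m' \<Longrightarrow> m = m'" for m m'
    using strict_mono_cut[of L0 w] L0_ne by (metis strict_mono_eq)
  have IH: "occurs_at u (mimage L0 x @ [0]) k \<longleftrightarrow> (\<exists>m. k = cut L0 w m \<and> occurs_at w x m)" for k
    using Cons by simp
  have w01: "w m = 0 \<or> w m = 1" for m using w by (auto simp: image_subset_iff)
  note nth = maps_to_L0_nth0[OF mt] maps_to_L0_nth1[OF mt]
  show ?case
  proof (cases "a = 0")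
    case True
    have "(\<exists>m. k = cut L0 w m) \<and> (\<exists>m'. Suc k = cut L0 w m' \<and> occurs_at w x m') \<longleftrightarrow>
        (\<exists>m. k = cut L0 w m \<and> w m = 0 \<and> occurs_at w x (Suc m))" (is "?A \<longleftrightarrow> ?B")
    proof
      assume ?A
      then obtain m m' where m: "k = cut L0 w m" "Suc k = cut L0 w m'" "occurs_at w x m'" by blast
      have "w m = 0" using nth(1)[of m'] nth(2)[of m] m by force
      then have "m' = Suc m" using m inj[of m' "Suc m"] by (simp add: cut_L0_Suc)
      then show ?B using m \<open>w m = 0\<close> by blast
    next
      assume ?B
      then show ?A by (metis cut_L0_Suc)
    qed
    then show ?thesis using True by (simp add: L0_simps occurs_at_Cons IH maps_to_L0_zero_iff[OF mt])
  next
    case False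
    then have a: "a = 1" using Cons.prems by simp
    have "(\<exists>m. k = cut L0 w m) \<and> u (Suc k) = 1 \<and> (\<exists>m'. Suc (Suc k) = cut L0 w m' \<and> occurs_at w x m') \<longleftrightarrow>
        (\<exists>m. k = cut L0 w m \<and> w m = 1 \<and> occurs_at w x (Suc m))" (is "?A \<longleftrightarrow> ?B")
    proof
      assume ?A
      then obtain m m' where m: "k = cut L0 w m" "u (Suc k) = 1" "Suc (Suc k) = cut L0 w m'" "occurs_at w x m'"
        by blast
      have "w m \<noteq> 0" using nth(1)[of "Suc m"] m by (auto simp: cut_L0_Suc split: if_splits)
      then have "m' = Suc m" "w m = 1" using m inj[of m' "Suc m"] w01[of m] by (auto simp: cut_L0_Suc)
      then show ?B using m by blast
    next
      assume ?B
      then obtain m where m: "k = cut L0 w m" "w m = 1" "occurs_at w x (Suc m)" by blast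
      then have "Suc (Suc k) = cut L0 w (Suc m)" by (simp add: cut_L0_Suc)
      then show ?A using m nth(2)[of m] by auto
    qed
    then show ?thesis using a by (simp add: L0_simps occurs_at_Cons IH maps_to_L0_zero_iff[OF mt])
  qed
qed

lemma mimage_L0_hd: "mimage L0 x \<noteq> Suc 0 # z" "Suc 0 # z \<noteq> mimage L0 x"
  by (cases x; auto simp: L0_def)+

lemma mimage_L0_inj:
  "set x \<subseteq> {0, 1} \<Longrightarrow> set x' \<subseteq> {0, 1} \<Longrightarrow> mimage L0 x = mimage L0 x' \<Longrightarrow> x = x'"
proof (induction x arbitrary: x')
  case Nil then show ?case by (cases x') (auto simp: L0_def split: if_splits)
next
  case (Cons a x)
  obtain b z where x': "x' = b # z" using Cons.prems(3) by (cases x') (auto simp: L0_def split: if_splits)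
  have "a = b \<and> mimage L0 x = mimage L0 z"
    using Cons.prems x' by (auto simp: L0_simps mimage_L0_hd)
  then show ?case using Cons x' by simp
qed

lemma derived_word_L0:
  assumes mt: "maps_to L0 w u" and w: "range w \<subseteq> {0, 1}" and x: "set x \<subseteq> {0, 1}"
    and d: "derived_word w x d"
  shows "derived_word u (mimage L0 x @ [0]) d"
proof (rule derived_word_transfer_seg[where N = "cut L0 w" and g = "mimage L0", OF _ _ _ _ d])
  show "strict_mono (cut L0 w)" using L0_ne by (rule strict_mono_cut)
  show "{i. occurs_at u (mimage L0 x @ [0]) i} = cut L0 w ` {i. occurs_at w x i}"
    using occurs_at_L0[OF mt w x] by auto
  show "seg u (cut L0 w i) (cut L0 w j) = mimage L0 (seg w i j)" if "i < j" for i j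
    using maps_to_seg[OF mt, of i j] that by simp
  show "seg w i j = seg w i' j'" if "mimage L0 (seg w i j) = mimage L0 (seg w i' j')" for i j i' j'
    by (rule mimage_L0_inj[OF _ _ that]) (use w in \<open>auto simp: image_subset_iff\<close>)
qed

lemma derived_word_cong:
  assumes "\<And>k. occurs_at u x k \<longleftrightarrow> occurs_at u x' k"
  shows "derived_word u x d \<longleftrightarrow> derived_word u x' d"
proof -
  have o: "{i. occurs_at u x i} = {i. occurs_at u x' i}" using assms by simp
  have "occ u x = occ u x'" unfolding occ_def o ..
  then have "return_seq u x = return_seq u x'" by (simp add: return_seq_def fun_eq_iff)
  then show ?thesis unfolding derived_word_def o by simp
qed

lemma seg_case_nat_Suc: "seg (case_nat a u) (Suc i) (Suc j) = seg u i j"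
  by (simp add: map_Suc_upt[symmetric] del: upt_Suc map_Suc_upt)

lemma derived_word_shift:
  assumes "\<not> occurs_at (case_nat a u) x 0"
  shows "derived_word (case_nat a u) x d \<longleftrightarrow> derived_word u x d"
proof -
  have S: "occurs_at (case_nat a u) x (Suc k) \<longleftrightarrow> occurs_at u x k" for k
    by (simp add: occurs_at_def)
  have occ: "{i. occurs_at (case_nat a u) x i} = Suc ` {i. occurs_at u x i}"
  proof (intro equalityI subsetI)
    fix k assume "k \<in> {i. occurs_at (case_nat a u) x i}"
    then show "k \<in> Suc ` {i. occurs_at u x i}" using assms S by (cases k) auto
  qed (use S in auto)
  have m: "strict_mono Suc" by (simp add: strict_mono_def)
  show ?thesis
  proof (cases "infinite {i. occurs_at u x i}")
    case True
    show ?thesis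
    proof (rule derived_word_transfer[where N = Suc and g = id, OF m occ])
      show "return_seq (case_nat a u) x n = id (return_seq u x n)" for n
        unfolding return_seq_def occ_image[OF m occ True] seg_case_nat_Suc by simp
    qed simp
  next
    case False
    then have "finite {i. occurs_at (case_nat a u) x i}" unfolding occ by simp
    then show ?thesis using False by (simp add: derived_word_def)
  qed
qed

text \<open>Each 1 is preceded by 0, so the occurrences correspond by a step to the right, and in
  each return word the leading 0 moves to the end.\<close>

lemma derived_word_prepend_zero:
  assumes mt: "maps_to L0 w u" and d: "derived_word u (0 # 1 # x) d"
  shows "derived_word u (1 # x) d"
proof (rule derived_word_transfer_seg[where N = Suc and g = "\<lambda>r. tl r @ [0]", OF _ _ _ _ d])
  show "strict_mono Suc" by (simp add: strict_mono_def)
  show "{i. occurs_at u (1 # x) i} = Suc ` {i. occurs_at u (0 # 1 # x) i}"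
    using maps_to_L0_one_prev[OF mt] by (fastforce simp: occurs_at_Cons image_iff)
  show "seg u (Suc i) (Suc j) = tl (seg u i j) @ [0]"
    if "i < j" "occurs_at u (0 # 1 # x) i" "occurs_at u (0 # 1 # x) j" for i j
    using that by (simp add: occurs_at_Cons map_tl[symmetric])
  show "seg u i j = seg u i' j'"
    if "i < j" "occurs_at u (0 # 1 # x) i" "occurs_at u (0 # 1 # x) j"
      "i' < j'" "occurs_at u (0 # 1 # x) i'" "occurs_at u (0 # 1 # x) j'"
      "tl (seg u i j) @ [0] = tl (seg u i' j') @ [0]" for i j i' j'
  proof -
    have "hd (seg u i j) = 0" "hd (seg u i' j') = 0"
      using that by (simp_all add: hd_map occurs_at_Cons)
    then show ?thesis using that(1,4,7)
      by (metis append_same_eq hd_Cons_tl length_0_conv length_map length_upt zero_less_diff less_irrefl)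
  qed
qed

text \<open>A final 1 is always followed by 0, so adding this 0 loses no occurrence. A factor that
  begins and ends with 0 then runs from one block start to another.\<close>

lemma parse_L0:
  assumes mt: "maps_to L0 w u" and w: "range w \<subseteq> {0, 1}" and occ: "occurs_at u v k"
    and v: "v \<noteq> []" "hd v = 0"
  obtains x where "set x \<subseteq> {0, 1}" "factor x w"
    "mimage L0 x @ [0] = (if last v = 0 then v else v @ [0])"
    "\<And>j. occurs_at u v j \<longleftrightarrow> occurs_at u (mimage L0 x @ [0]) j"
proof -
  define z where "z = (if last v = 0 then v else v @ [0])"
  have z_ends: "z \<noteq> []" "last z = 0" "hd z = 0" using v by (auto simp: z_def)
  have eqv: "occurs_at u v j \<longleftrightarrow> occurs_at u z j" for j
  proof (cases "last v = 0")
    case False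
    have "u (j + length v) = 0" if "occurs_at u v j"
    proof -
      have "u (j + (length v - 1)) = v ! (length v - 1)" using that v by (simp add: occurs_at_def)
      then have "u (j + (length v - 1)) \<noteq> 0" using False v by (simp add: last_conv_nth)
      moreover have "Suc (j + (length v - 1)) = j + length v" using v by (cases v) auto
      ultimately show ?thesis using maps_to_L0_one_next[OF mt] by metis
    qed
    then show ?thesis using False by (auto simp: z_def occurs_at_append occurs_at_Cons)
  qed (simp add: z_def)
  have oz: "occurs_at u z k" using occ eqv by simp
  have "u (k + 0) = z ! 0" "u (k + (length z - 1)) = z ! (length z - 1)"
    using oz z_ends unfolding occurs_at_def by auto
  then have "u k = 0" "u (k + (length z - 1)) = 0"
    using z_ends by (auto simp: hd_conv_nth last_conv_nth)
  then obtain m m' where m: "k = cut L0 w m" "k + (length z - 1) = cut L0 w m'"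
    using maps_to_L0_zero_iff[OF mt] by blast
  have "m \<le> m'"
    using m strict_mono_less_eq[OF strict_mono_cut[of L0 w], of m m'] L0_ne by simp
  define x where "x = seg w m m'"
  have "z = seg u k (k + length z)" using oz occurs_at_seg by blast
  also have "k + length z = Suc (k + (length z - 1))" using z_ends by (cases z) auto
  also have "seg u k (Suc (k + (length z - 1))) = seg u k (k + (length z - 1)) @ [0]"
    using \<open>u (k + (length z - 1)) = 0\<close> by simp
  also have "seg u k (k + (length z - 1)) = mimage L0 x"
    unfolding m(2) unfolding m(1) x_def using maps_to_seg[OF mt \<open>m \<le> m'\<close>] by simp
  finally have zx: "z = mimage L0 x @ [0]" .
  have "set x \<subseteq> {0, 1}" unfolding x_def using w by (auto simp: image_subset_iff)
  moreover have "factor x w"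
    unfolding factor_def x_def by (rule exI[of _ m]) (simp add: occurs_at_def)
  ultimately show thesis using that[of x] zx eqv unfolding z_def[symmetric] by simp
qed

lemma length_mimage_L0:
  "length (mimage L0 x) = length x + length (filter (\<lambda>a. a \<noteq> 0) x)"
  by (induction x) (auto simp: L0_def)

lemma mimage_L0_ones:
  "length (filter (\<lambda>a. a \<noteq> 0) (mimage L0 x)) = length (filter (\<lambda>a. a \<noteq> 0) x)"
  by (induction x) (auto simp: L0_def)

text \<open>The factor is longer than \<open>x\<close> by one for each 1 and by one more for a final
  0, and it has a 1 or a final 0.\<close>

lemma desubstitute_zero:
  assumes mt: "maps_to L0 w u" and w: "range w \<subseteq> {0, 1}" and fv: "factor v u"
    and v: "v \<noteq> []" "hd v = 0"
  shows "\<exists>x. factor x w \<and> (\<forall>d. derived_word w x d \<longrightarrow> derived_word u v d) \<and> length x < length v"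
proof -
  obtain k where k: "occurs_at u v k" using fv by (auto simp: factor_def)
  obtain x where x: "set x \<subseteq> {0, 1}" "factor x w"
    "mimage L0 x @ [0] = (if last v = 0 then v else v @ [0])"
    "\<And>j. occurs_at u v j \<longleftrightarrow> occurs_at u (mimage L0 x @ [0]) j"
    using parse_L0[OF mt w k v] by blast
  have "length x < length v"
  proof (cases "last v = 0")
    case True
    then have "Suc (length (mimage L0 x)) = length v" using x(3) by (metis length_append_singleton)
    then show ?thesis by (simp add: length_mimage_L0)
  next
    case False
    then have v: "v = mimage L0 x" using x(3) by simp
    have "last v \<in> set (filter (\<lambda>a. a \<noteq> 0) v)" using False assms(4) by simp
    then have "length (filter (\<lambda>a. a \<noteq> 0) v) > 0" by (metis length_pos_if_in_set)
    from this[unfolded v mimage_L0_ones] length_mimage_L0[of x] show ?thesis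
      unfolding v by linarith
  qed
  then show ?thesis
    using x(2) derived_word_L0[OF mt w x(1)] derived_word_cong[OF x(4)] by blast
qed

text \<open>The 0 forced in front of \<open>v\<close> must be added before parsing. This costs one
  letter, and the length fails to drop only for the single letter 1. As \<open>x\<close> contains a
  1, it is not empty.\<close>

lemma desubstitute_one:
  assumes mt: "maps_to L0 w u" and w: "range w \<subseteq> {0, 1}" and fv: "factor v u"
    and v: "v \<noteq> []" "hd v = 1"
  shows "\<exists>x. x \<noteq> [] \<and> factor x w \<and> (\<forall>d. derived_word w x d \<longrightarrow> derived_word u v d) \<and>
     (length x < length v \<or> v = [1] \<and> x = [1])"
proof -
  obtain k where k: "occurs_at u v k" using fv by (auto simp: factor_def)
  obtain v' where v': "v = 1 # v'" using v by (cases v) auto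
  have "u k = 1" using k v' by (simp add: occurs_at_Cons)
  then obtain j where j: "k = Suc j" "u j = 0" using maps_to_L0_one_prev[OF mt] by blast
  have k0: "occurs_at u (0 # v) j" using k j by (simp add: occurs_at_Cons)
  obtain x where x: "set x \<subseteq> {0, 1}" "factor x w"
    "mimage L0 x @ [0] = (if last (0 # v) = 0 then 0 # v else (0 # v) @ [0])"
    "\<And>j. occurs_at u (0 # v) j \<longleftrightarrow> occurs_at u (mimage L0 x @ [0]) j"
    using parse_L0[OF mt w k0] by auto
  have ones: "length (filter (\<lambda>a. a \<noteq> 0) v) = length (filter (\<lambda>a. a \<noteq> 0) x)"
  proof -
    have "length (filter (\<lambda>a. a \<noteq> 0) (mimage L0 x @ [0])) = length (filter (\<lambda>a. a \<noteq> 0) v)"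
      unfolding x(3) by simp
    then show ?thesis using mimage_L0_ones[of x] by simp
  qed
  have pos1: "length (filter (\<lambda>a. a \<noteq> 0) x) \<ge> 1" using ones v' by simp
  then have ne: "x \<noteq> []" by auto
  have len: "length x < length v \<or> v = [1] \<and> x = [1]"
  proof (cases "last v = 0")
    case True
    then have "length (mimage L0 x) = length v" using x(3) v(1)
      by (metis (no_types, lifting) add_right_cancel last_ConsR length_Cons length_append_singleton nat.inject)
    then show ?thesis using pos1 length_mimage_L0[of x] by simp
  next
    case False
    then have eq: "mimage L0 x = 0 # v" using x(3) v(1) by simp
    then have l: "Suc (length v) = length x + length (filter (\<lambda>a. a \<noteq> 0) x)"
      using length_mimage_L0[of x] by simp
    show ?thesis
    proof (cases "length (filter (\<lambda>a. a \<noteq> 0) x) = 1")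
      case True
      then have "length (filter (\<lambda>a. a \<noteq> 0) v') = 0" using ones v' by simp
      then have z: "\<And>a. a \<in> set v' \<Longrightarrow> a = 0" by (auto simp: filter_empty_conv)
      have "v' = []"
      proof (rule ccontr)
        assume "v' \<noteq> []"
        then have "last v \<in> set v'" using v' by simp
        then show False using z[of "last v"] \<open>last v \<noteq> 0\<close> by simp
      qed
      then have v1: "v = [1]" using v' by simp
      then have "length x = 1" using l True by simp
      then obtain a where "x = [a]" by (metis One_nat_def length_0_conv length_Suc_conv)
      then show ?thesis using eq v1 x(1) by (auto simp: L0_def split: if_splits)
    next
      case False
      then show ?thesis using l pos1 by linarith
    qed
  qed
  have "derived_word u v d" if "derived_word w x d" for d
    using derived_word_L0[OF mt w x(1) that] derived_word_cong[OF x(4)]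
      derived_word_prepend_zero[OF mt] v' by blast
  then show ?thesis using ne x(2) len by blast
qed

section \<open>The Farey map and characteristic words\<close>

definition slope :: "real \<Rightarrow> bool" where
  "slope \<gamma> \<longleftrightarrow> \<gamma> \<notin> \<rat> \<and> 0 < \<gamma> \<and> \<gamma> < 1"

text \<open>The slow continued fraction map: of the frequencies \<open>1 - \<gamma>\<close> and
  \<gamma>, the smaller is subtracted from the larger and the result is normalised to sum 1.\<close>

definition farey :: "real \<Rightarrow> real" where
  "farey \<gamma> = (if \<gamma> < 1/2 then \<gamma> / (1 - \<gamma>) else (2 * \<gamma> - 1) / \<gamma>)"

text \<open>The characteristic word of slope \<open>\<gamma>\<close>.\<close>
definition cw :: "real \<Rightarrow> nat \<Rightarrow> nat" where
  "cw \<gamma> = code True \<gamma> \<gamma>"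

lemma slope_half: "slope \<gamma> \<Longrightarrow> \<gamma> \<noteq> 1/2"
proof
  assume "slope \<gamma>" "\<gamma> = 1/2"
  moreover have "(1/2::real) \<in> \<rat>" by (intro Rats_divide Rats_1 Rats_number_of)
  ultimately show False by (simp add: slope_def)
qed

lemma slope_swap: "slope \<gamma> \<Longrightarrow> slope (1 - \<gamma>)"
  using Rats_diff[OF Rats_1, of "1 - \<gamma>"] by (auto simp: slope_def)

lemma farey_swap: "slope \<gamma> \<Longrightarrow> farey (1 - \<gamma>) = 1 - farey \<gamma>"
  using slope_half[of \<gamma>] by (cases "\<gamma> < 1/2") (auto simp: farey_def slope_def divide_simps)

lemma slope_farey:
  assumes "slope \<gamma>" shows "slope (farey \<gamma>)"
proof -
  have aux: "slope (\<gamma> / (1 - \<gamma>))" if s: "slope \<gamma>" "\<gamma> < 1/2" for \<gamma>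
  proof -
    have "\<gamma> / (1 - \<gamma>) \<notin> \<rat>"
    proof
      assume r: "\<gamma> / (1 - \<gamma>) \<in> \<rat>"
      have "\<gamma> = (\<gamma> / (1 - \<gamma>)) / (1 + \<gamma> / (1 - \<gamma>))" using s by (simp add: slope_def field_simps)
      also have "\<dots> \<in> \<rat>" by (rule Rats_divide[OF r Rats_add[OF Rats_1 r]])
      finally show False using s by (simp add: slope_def)
    qed
    then show ?thesis using s by (simp add: slope_def field_simps)
  qed
  show ?thesis
  proof (cases "\<gamma> < 1/2")
    case True then show ?thesis using aux[OF assms] by (simp add: farey_def)
  next
    case False
    then have "1 - \<gamma> < 1/2" using slope_half[OF assms] by simp
    then have "slope (farey (1 - \<gamma>))" using aux[OF slope_swap[OF assms]] by (simp add: farey_def)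
    then show ?thesis using slope_swap farey_swap[OF assms] by fastforce
  qed
qed

lemma slope_farey_funpow: "slope \<gamma> \<Longrightarrow> slope ((farey ^^ k) \<gamma>)"
  by (induction k) (auto intro: slope_farey)

lemma coding_slope: "slope \<gamma> \<Longrightarrow> coding f \<gamma> \<gamma>"
  by unfold_locales (auto simp: slope_def intro: pos_gt dest: pos_ge)

text \<open>The orbit of \<gamma> never meets \<open>1 - \<gamma>\<close>, which would make a
  positive multiple of \<gamma> an integer, so the end conventions do not matter.\<close>

lemma cw_flag: assumes "slope \<gamma>" shows "code f \<gamma> \<gamma> = cw \<gamma>"
proof -
  interpret A: coding f \<gamma> \<gamma> by (rule coding_slope[OF assms])
  interpret B: coding True \<gamma> \<gamma> by (rule coding_slope[OF assms])
  have ne: "A.y n \<noteq> 1 - \<gamma>" for n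
  proof
    assume "A.y n = 1 - \<gamma>"
    moreover obtain c :: int where "A.y (0 + n) = A.y 0 + of_int (int n) * \<gamma> - of_int c"
      using A.y_add by blast
    ultimately have "of_int (int n + 2) * \<gamma> = of_int (c + 1)" by (simp add: A.y_0 algebra_simps)
    from irrational_lin[OF A.irr this] show False by simp
  qed
  have letter: "A.u n = B.u n" if "A.y n = B.y n" for n
    using A.u_pos[of n] B.u_pos[of n] A.u_01[of n] B.u_01[of n] that ne[of n] by (auto simp: pos_def split: if_splits)
  have "A.y n = B.y n" for n
    by (induction n) (auto simp: A.y_0 B.y_0 A.y_Suc B.y_Suc letter)
  then show ?thesis using letter by (auto simp: cw_def fun_eq_iff)
qed

lemma cw_swap: assumes "slope \<gamma>" shows "swap01 \<circ> cw \<gamma> = cw (1 - \<gamma>)"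
  unfolding cw_def[of \<gamma>] code_swap[symmetric] by (rule cw_flag[OF slope_swap[OF assms]])

lemma range_cw: "slope \<gamma> \<Longrightarrow> range (cw \<gamma>) = {0, 1}"
  unfolding cw_def by (rule coding.range_u[OF coding_slope])

lemma range_case_nat: "range (case_nat a u) = insert a (range u)"
proof -
  have "case_nat a u ` UNIV = insert (case_nat a u 0) (case_nat a u ` range Suc)"
    by (metis UNIV_nat_eq image_insert)
  then show ?thesis by (simp add: image_image)
qed

lemma range_prep: "slope \<gamma> \<Longrightarrow> set t \<subseteq> {0, 1} \<Longrightarrow> range (prep t (cw \<gamma>)) = {0, 1}"
  by (induction t) (auto simp: range_cw range_case_nat)

text \<open>The blocks start at the visits to \<open>[0, 1 - \<gamma>)\<close>. The first return map
  to this interval, rescaled by \<open>1 - \<gamma>\<close>, is the rotation by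
  \<open>\<gamma> / (1 - \<gamma>)\<close>, and the base points match because
  \<open>(1 - \<gamma>) * farey \<gamma> = \<gamma>\<close>.\<close>

lemma cw_L0:
  assumes s: "slope \<gamma>" and lt: "\<gamma> < 1/2"
  shows "maps_to L0 (cw (farey \<gamma>)) (cw \<gamma>)"
proof -
  define \<gamma>' where "\<gamma>' = farey \<gamma>"
  have g: "(1 - \<gamma>) * \<gamma>' = \<gamma>" "0 < \<gamma>" "\<gamma> < 1" using s lt by (auto simp: \<gamma>'_def farey_def slope_def)
  interpret A: coding True \<gamma> \<gamma> by (rule coding_slope[OF s])
  interpret B: coding True \<gamma>' \<gamma>' unfolding \<gamma>'_def by (rule coding_slope[OF slope_farey[OF s]])
  let ?N = "cut L0 B.u"
  have both: "L0 (B.u n) = seg A.u (?N n) (?N (Suc n)) \<and> A.y (?N (Suc n)) = (1 - \<gamma>) * B.y (Suc n)"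
    if IH: "A.y (?N n) = (1 - \<gamma>) * B.y n" for n
  proof -
    have "(1 - \<gamma>) * B.y n < (1 - \<gamma>) * 1"
      using B.y_unit(2)[of n] g by (intro mult_strict_left_mono) (auto simp: pos_def)
    then have u0: "A.u (?N n) = 0" using IH by (simp add: A.u_0 pos_def)
    then have y1: "A.y (Suc (?N n)) = (1 - \<gamma>) * B.y n + \<gamma>" using IH by (simp add: A.y_Suc)
    show ?thesis
    proof (cases "B.u n = 0")
      case True
      then show ?thesis using u0 y1 g(1) by (simp add: cut_L0_Suc L0_def B.y_Suc algebra_simps)
    next
      case False
      then have "B.y n \<ge> 1 - \<gamma>'" using B.u_0[of n] by (auto simp: pos_def)
      then have "(1 - \<gamma>) * B.y n \<ge> (1 - \<gamma>) * (1 - \<gamma>')" using g by (intro mult_left_mono) auto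
      then have "A.y (Suc (?N n)) \<ge> 1 - \<gamma>" using y1 g(1) by (simp add: algebra_simps)
      then have u1: "A.u (Suc (?N n)) = 1" using A.u_pos[of "Suc (?N n)"] by (simp add: pos_def)
      have "A.y (Suc (Suc (?N n))) = (1 - \<gamma>) * B.y n + \<gamma> + (\<gamma> - 1)"
        using y1 u1 by (simp add: A.y_Suc[of "Suc (?N n)"])
      then show ?thesis using False u0 u1 g(1) by (simp add: cut_L0_Suc L0_def B.y_Suc algebra_simps)
    qed
  qed
  have "A.y (?N n) = (1 - \<gamma>) * B.y n" for n
  proof (induction n)
    case 0 show ?case using g by (simp add: A.y_0 B.y_0)
  next
    case (Suc n) then show ?case using both by blast
  qed
  then have "maps_to L0 B.u A.u" using both by (intro maps_toI_blocks) blast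
  then show ?thesis by (simp add: cw_def \<gamma>'_def)
qed

text \<open>The codings of the points \<open>0, \<gamma>, 1 - \<gamma>, 1\<close> are exactly \<open>t c\<close> with \<open>t\<close> in \<open>T5\<close>; derivation
  only produces the prefixes in \<open>T3\<close>.\<close>
definition T5 :: "nat list set" where "T5 = {[], [0], [1], [0, 1], [1, 0]}"
definition T3 :: "nat list set" where "T3 = {[], [0], [1]}"

lemma T3_T5: "T3 \<subseteq> T5" by (auto simp: T3_def T5_def)

lemma T5_letters: "t \<in> T5 \<Longrightarrow> set t \<subseteq> {0, 1}"
  by (auto simp: T5_def)

lemma T5_swap: "t \<in> T5 \<Longrightarrow> map swap01 t \<in> T5" and T3_swap: "t \<in> T3 \<Longrightarrow> map swap01 t \<in> T3"
  by (auto simp: T5_def T3_def)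

section \<open>Desubstitution of special words\<close>

lemma prep_swap: "swap01 \<circ> prep t w = prep (map swap01 t) (swap01 \<circ> w)"
proof (induction t)
  case (Cons a t)
  then show ?case by (auto simp: fun_eq_iff split: nat.split)
qed simp

lemma swap01_comp [simp]: "swap01 \<circ> swap01 = id"
  by (simp add: fun_eq_iff)

lemma map_swap_swap: "map swap01 (map swap01 x) = x"
  by simp

lemma prep_cw_swap: "slope \<gamma> \<Longrightarrow> swap01 \<circ> prep (map swap01 t) (cw (1 - \<gamma>)) = prep t (cw \<gamma>)"
  using cw_swap[OF slope_swap, of \<gamma>] by (simp add: prep_swap)

lemma factor_swap: "factor (map swap01 v) (swap01 \<circ> u) \<longleftrightarrow> factor v u"
  by (simp add: factor_def occurs_at_swap)

lemma not_occurs_0: "v \<noteq> [] \<Longrightarrow> hd v \<noteq> a \<Longrightarrow> \<not> occurs_at (case_nat a u) v 0"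
  by (cases v) (auto simp: occurs_at_Cons)

lemma factor_tail:
  assumes "factor v (case_nat a u)" "\<not> occurs_at (case_nat a u) v 0"
  shows "factor v u"
proof -
  obtain k where k: "occurs_at (case_nat a u) v k" using assms(1) by (auto simp: factor_def)
  then obtain j where "k = Suc j" using assms(2) by (cases k) auto
  then have "occurs_at u v j" using k by (simp add: occurs_at_def)
  then show ?thesis by (auto simp: factor_def)
qed

lemma factor_case_nat: "factor v u \<Longrightarrow> factor v (case_nat a u)"
proof -
  assume "factor v u"
  then obtain k where "occurs_at u v k" by (auto simp: factor_def)
  then have "occurs_at (case_nat a u) v (Suc k)" by (simp add: occurs_at_def)
  then show ?thesis by (auto simp: factor_def)
qed

lemma factor_letters: "factor v u \<Longrightarrow> set v \<subseteq> range u"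
  by (auto simp: factor_def occurs_at_def in_set_conv_nth) (metis rangeI)

lemma desubstitute_low:
  assumes s: "slope \<gamma>" and lt: "\<gamma> < 1/2" and t: "t \<in> T5" and v: "v \<noteq> []" "factor v (prep t (cw \<gamma>))"
  shows "\<exists>t1\<in>T5. \<exists>x. factor x (prep t1 (cw (farey \<gamma>))) \<and>
    (\<forall>d. derived_word (prep t1 (cw (farey \<gamma>))) x d \<longrightarrow> derived_word (prep t (cw \<gamma>)) v d) \<and>
    (x = [] \<longrightarrow> t1 \<in> T3) \<and> (length x < length v \<or> v = [1] \<and> x = [1])"
proof -
  note One_nat_def [simp del]
  let ?c = "cw \<gamma>" and ?c1 = "cw (farey \<gamma>)"
  note m = cw_L0[OF s lt]
  have m0: "maps_to L0 (case_nat 0 ?c1) (case_nat 0 ?c)"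
    using maps_to_prep[OF m, of 0] by (simp add: L0_def)
  have m1: "maps_to L0 (case_nat 1 ?c1) (case_nat 0 (case_nat 1 ?c))"
    using maps_to_prep[OF m, of 1] by (simp add: L0_def)
  have m10: "maps_to L0 (case_nat 1 (case_nat 0 ?c1)) (case_nat 0 (case_nat 1 (case_nat 0 ?c)))"
    using maps_to_prep[OF m0, of 1] by (simp add: L0_def)
  have r: "range ?c1 \<subseteq> {0, 1}" "range (case_nat 0 ?c1) \<subseteq> {0, 1}" "range (case_nat 1 ?c1) \<subseteq> {0, 1}"
    "range (case_nat 1 (case_nat 0 ?c1)) \<subseteq> {0, 1}"
    unfolding range_case_nat range_cw[OF slope_farey[OF s]] by auto
  have "hd v \<in> {0, 1}"
    using factor_letters[OF v(2)] range_prep[OF s T5_letters[OF t]] v(1) by (cases v) auto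
  then consider "hd v = 0" | "hd v = 1" by auto
  then show ?thesis
  proof cases
    case 1
    have direct: ?thesis if "t1 \<in> T3" "maps_to L0 (prep t1 ?c1) u" "range (prep t1 ?c1) \<subseteq> {0, 1}"
      "factor v u" "\<And>d. derived_word u v d \<Longrightarrow> derived_word (prep t ?c) v d" for t1 u
      using desubstitute_zero[OF that(2,3,4) v(1) 1] that(1,5) T3_T5 by blast
    have sh: "derived_word u v d \<Longrightarrow> derived_word (case_nat 1 u) v d" for u d
      using derived_word_shift[OF not_occurs_0[OF v(1)]] 1 by simp
    have fa: "factor v (case_nat 1 u) \<Longrightarrow> factor v u" for u
      using factor_tail[OF _ not_occurs_0[OF v(1)]] 1 by simp
    from t consider "t = []" | "t = [0]" | "t = [1]" | "t = [0, 1]" | "t = [1, 0]" unfolding T5_def by blast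
    then show ?thesis
    proof cases
      case 1 show ?thesis by (rule direct[of "[]" ?c]) (use m r v 1 in \<open>simp_all add: T3_def\<close>)
    next
      case 2 show ?thesis
        by (rule direct[of "[0]" "case_nat 0 ?c"]) (use m0 r v 2 in \<open>simp_all add: T3_def\<close>)
    next
      case 3 show ?thesis
        by (rule direct[of "[]" ?c]) (use m r v 3 fa[of ?c] sh[of ?c] in \<open>simp_all add: T3_def\<close>)
    next
      case 4 show ?thesis
        by (rule direct[of "[1]" "case_nat 0 (case_nat 1 ?c)"]) (use m1 r v 4 in \<open>simp_all add: T3_def\<close>)
    next
      case 5 show ?thesis
        by (rule direct[of "[0]" "case_nat 0 ?c"])
          (use m0 r v 5 fa[of "case_nat 0 ?c"] sh[of "case_nat 0 ?c"] in \<open>simp_all add: T3_def\<close>)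
    qed
  next
    case 2
    have direct: ?thesis if "t1 \<in> T5" "maps_to L0 (prep t1 ?c1) u" "range (prep t1 ?c1) \<subseteq> {0, 1}"
      "factor v u" "\<And>d. derived_word u v d \<Longrightarrow> derived_word (prep t ?c) v d" for t1 u
      using desubstitute_one[OF that(2,3,4) v(1) 2] that(1,5) by blast
    have sh: "derived_word (case_nat 0 u) v d \<Longrightarrow> derived_word u v d" for u d
      using derived_word_shift[OF not_occurs_0[OF v(1)]] 2 by simp
    from t consider "t = []" | "t = [0]" | "t = [1]" | "t = [0, 1]" | "t = [1, 0]" unfolding T5_def by blast
    then show ?thesis
    proof cases
      case 1 show ?thesis by (rule direct[of "[]" ?c]) (use m r v 1 in \<open>simp_all add: T5_def\<close>)
    next
      case 2 show ?thesis
        by (rule direct[of "[0]" "case_nat 0 ?c"]) (use m0 r v 2 in \<open>simp_all add: T5_def\<close>)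
    next
      case 3 show ?thesis
        by (rule direct[of "[1]" "case_nat 0 (case_nat 1 ?c)"])
          (use m1 r v 3 sh[of "case_nat 1 ?c"] factor_case_nat in \<open>simp_all add: T5_def\<close>)
    next
      case 4 show ?thesis
        by (rule direct[of "[1]" "case_nat 0 (case_nat 1 ?c)"]) (use m1 r v 4 in \<open>simp_all add: T5_def\<close>)
    next
      case 5 show ?thesis
        by (rule direct[of "[1, 0]" "case_nat 0 (case_nat 1 (case_nat 0 ?c))"])
          (use m10 r v 5 sh[of "case_nat 1 (case_nat 0 ?c)"] factor_case_nat in \<open>simp_all add: T5_def\<close>)
    qed
  qed
qed

lemma desubstitute:
  assumes s: "slope \<gamma>" and t: "t \<in> T5" and v: "v \<noteq> []" "factor v (prep t (cw \<gamma>))"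
  shows "\<exists>t1\<in>T5. \<exists>x. factor x (prep t1 (cw (farey \<gamma>))) \<and>
    (\<forall>d. derived_word (prep t1 (cw (farey \<gamma>))) x d \<longrightarrow> derived_word (prep t (cw \<gamma>)) v d) \<and>
    (x = [] \<longrightarrow> t1 \<in> T3) \<and>
    (length x < length v \<or> \<gamma> < 1/2 \<and> v = [1] \<and> x = [1] \<or> \<gamma> > 1/2 \<and> v = [0] \<and> x = [0])"
proof (cases "\<gamma> < 1/2")
  case True
  then show ?thesis using desubstitute_low[OF s True t v] by blast
next
  case False
  then have gt: "\<gamma> > 1/2" "1 - \<gamma> < 1/2" using slope_half[OF s] by auto
  note s' = slope_swap[OF s]
  let ?v = "map swap01 v" and ?t = "map swap01 t"
  have u: "prep t (cw \<gamma>) = swap01 \<circ> prep ?t (cw (1 - \<gamma>))" using prep_cw_swap[OF s] by simp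
  have fv: "factor ?v (prep ?t (cw (1 - \<gamma>)))"
    using v(2) factor_swap[of ?v "prep ?t (cw (1 - \<gamma>))"] unfolding u map_swap_swap by simp
  have ne: "?v \<noteq> []" using v(1) by simp
  from desubstitute_low[OF s' gt(2) T5_swap[OF t] ne fv] obtain t1 x where x: "t1 \<in> T5" "factor x (prep t1 (cw (farey (1 - \<gamma>))))"
    "\<And>d. derived_word (prep t1 (cw (farey (1 - \<gamma>)))) x d \<Longrightarrow> derived_word (prep ?t (cw (1 - \<gamma>))) ?v d"
    "x = [] \<longrightarrow> t1 \<in> T3" "length x < length ?v \<or> ?v = [1] \<and> x = [1]"
    by (elim bexE exE conjE) (rule that; simp)
  have w: "prep (map swap01 t1) (cw (farey \<gamma>)) = swap01 \<circ> prep t1 (cw (farey (1 - \<gamma>)))"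
    using prep_cw_swap[OF slope_farey[OF s], of "map swap01 t1"] farey_swap[OF s]
    by (simp add: map_swap_swap)
  have "factor (map swap01 x) (prep (map swap01 t1) (cw (farey \<gamma>)))"
    unfolding w factor_swap by (rule x(2))
  moreover have "derived_word (prep t (cw \<gamma>)) v d"
    if "derived_word (prep (map swap01 t1) (cw (farey \<gamma>))) (map swap01 x) d" for d
  proof -
    have "derived_word (prep ?t (cw (1 - \<gamma>))) ?v d"
      using that x(3) unfolding w derived_word_swap by blast
    then have "derived_word (swap01 \<circ> prep ?t (cw (1 - \<gamma>))) (map swap01 ?v) d"
      unfolding derived_word_swap .
    then show ?thesis unfolding u map_swap_swap .
  qed
  moreover have "map swap01 x = [] \<longrightarrow> map swap01 t1 \<in> T3" using x(4) T3_swap by simp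
  moreover have "length (map swap01 x) < length v \<or> v = [0] \<and> map swap01 x = [0]"
    using x(5)
  proof
    assume a: "?v = [1] \<and> x = [1]"
    then have "map swap01 ?v = map swap01 [1]" by metis
    then have "v = [0]" unfolding map_swap_swap by simp
    then show ?thesis using a by simp
  qed simp
  ultimately show ?thesis
    by (intro bexI[OF _ T5_swap[OF x(1)]] exI[of _ "map swap01 x"]) (use gt(1) in auto)
qed

text \<open>Desubstitution shortens the factor until it is empty. It stalls only on a single letter,
  and there a second induction on the slope takes over.\<close>

lemma derived_special:
  assumes "slope \<gamma>" "t \<in> T5" "v \<noteq> []" "factor v (prep t (cw \<gamma>))"
  shows "\<exists>k. \<exists>t'\<in>T3. derived_word (prep t (cw \<gamma>)) v (prep t' (cw ((farey ^^ k) \<gamma>)))"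
  using assms
proof (induction "length v" arbitrary: v \<gamma> t rule: less_induct)
  case less
  note outer = less.hyps
  \<comment> \<open>While the factor stays \<open>[1]\<close>, a Farey step lowers
    \<open>1 / \<gamma>\<close> by 1; while it stays \<open>[0]\<close>, it lowers
    \<open>1 / (1 - \<gamma>)\<close> by 1.\<close>
  define \<mu> where "\<mu> \<gamma> = nat \<lceil>1 / (if v = [1] then \<gamma> else 1 - \<gamma>)\<rceil>" for \<gamma> :: real
  have "\<exists>k. \<exists>t'\<in>T3. derived_word (prep t (cw \<gamma>)) v (prep t' (cw ((farey ^^ k) \<gamma>)))"
    if "slope \<gamma>" "t \<in> T5" "factor v (prep t (cw \<gamma>))" for \<gamma> t
    using that
  proof (induction "\<mu> \<gamma>" arbitrary: \<gamma> t rule: less_induct)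
    case (less \<gamma> t)
    note s1 = slope_farey[OF less.prems(1)]
    obtain t1 x where x: "t1 \<in> T5" "factor x (prep t1 (cw (farey \<gamma>)))"
      "\<And>d. derived_word (prep t1 (cw (farey \<gamma>))) x d \<Longrightarrow> derived_word (prep t (cw \<gamma>)) v d"
      "x = [] \<longrightarrow> t1 \<in> T3"
      "length x < length v \<or> \<gamma> < 1/2 \<and> v = [1] \<and> x = [1] \<or> \<gamma> > 1/2 \<and> v = [0] \<and> x = [0]"
      using desubstitute[OF less.prems(1,2) \<open>v \<noteq> []\<close> less.prems(3)] by blast
    have lift: ?case if "derived_word (prep t1 (cw (farey \<gamma>))) x (prep t' (cw ((farey ^^ k) (farey \<gamma>))))"
      "t' \<in> T3" for k t'
      using x(3)[OF that(1)] that(2) by (auto simp: funpow_swap1 intro!: exI[of _ "Suc k"] bexI[of _ t'])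
    consider "x = []" | "x \<noteq> []" "length x < length v"
      | "\<gamma> < 1/2" "v = [1]" "x = v" | "\<gamma> > 1/2" "v = [0]" "x = v"
      using x(5) by auto
    then show ?case
    proof cases
      case 1
      have "derived_word (prep t1 (cw (farey \<gamma>))) [] (prep t1 (cw (farey \<gamma>)))"
        by (rule derived_word_Nil[OF range_prep[OF s1 T5_letters[OF x(1)]]])
      then show ?thesis using lift[of t1 0] 1 x(4) by simp
    next
      case 2
      then show ?thesis using outer[OF 2(2) s1 x(1) 2(1) x(2)] lift by blast
    next
      case 3
      have "\<mu> (farey \<gamma>) < \<mu> \<gamma>"
      proof -
        have "1 / farey \<gamma> = 1 / \<gamma> - 1" using 3 less.prems(1) by (simp add: farey_def slope_def field_simps)
        moreover have "1 / \<gamma> > 1" using less.prems(1) by (simp add: slope_def)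
        ultimately show ?thesis using 3(2) less.prems(1) unfolding \<mu>_def by (simp add: slope_def)
      qed
      from less.hyps[OF this s1 x(1)] x(2) 3(3) show ?thesis using lift by blast
    next
      case 4
      have "\<mu> (farey \<gamma>) < \<mu> \<gamma>"
      proof -
        have "1 / (1 - farey \<gamma>) = 1 / (1 - \<gamma>) - 1"
          using 4 less.prems(1) by (simp add: farey_def slope_def field_simps)
        moreover have "1 / (1 - \<gamma>) > 1" using less.prems(1) by (simp add: slope_def)
        ultimately show ?thesis using 4(2) less.prems(1) unfolding \<mu>_def by (simp add: slope_def)
      qed
      from less.hyps[OF this s1 x(1)] x(2) 4(3) show ?thesis using lift by blast
    qed
  qed
  then show ?case using less.prems by blast
qed

section \<open>Primitive substitutions along Farey cycles\<close>

lemma maps_to_swap: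
  assumes "maps_to \<phi> w u"
  shows "maps_to (\<lambda>a. map swap01 (\<phi> (swap01 a))) (swap01 \<circ> w) (swap01 \<circ> u)"
proof -
  let ?\<phi> = "\<lambda>a. map swap01 (\<phi> (swap01 a))"
  have im: "mimage ?\<phi> (map swap01 x) = map swap01 (mimage \<phi> x)" for x
    by (induction x) simp_all
  have "mimage ?\<phi> (seg (swap01 \<circ> w) 0 n) = map swap01 (seg u 0 (cut \<phi> w n))" for n
    using im[of "seg w 0 n"] maps_to_seg[OF assms, of 0 n] by simp
  then show ?thesis unfolding maps_to_def by simp
qed

text \<open>The prefix \<open>t\<close> must be the same on both sides for the steps to compose to a
  substitution fixing one word; this forces \<open>R0\<close> for \<open>t = [1]\<close>. The
  letters in the images are recorded for primitivity.\<close>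

lemma substitution_step:
  assumes s: "slope \<gamma>" and t: "t \<in> T3"
  shows "\<exists>X. maps_to X (prep t (cw (farey \<gamma>))) (prep t (cw \<gamma>)) \<and>
    (\<forall>a\<in>{0, 1}. a \<in> set (X a) \<and> set (X a) \<subseteq> {0, 1}) \<and>
    (\<gamma> < 1/2 \<longrightarrow> 0 \<in> set (X 1)) \<and> (\<gamma> > 1/2 \<longrightarrow> 1 \<in> set (X 0))"
proof -
  have low: "\<exists>X. maps_to X (prep t (cw (farey \<gamma>))) (prep t (cw \<gamma>)) \<and>
      (\<forall>a\<in>{0, 1}. a \<in> set (X a) \<and> set (X a) \<subseteq> {0, 1}) \<and> 0 \<in> set (X 1)"
    if s: "slope \<gamma>" "\<gamma> < 1/2" and t: "t \<in> T3" for \<gamma> t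
  proof -
    note m = cw_L0[OF s]
    have L: "(\<forall>a\<in>{0, 1}. a \<in> set (L0 a) \<and> set (L0 a) \<subseteq> {0, 1}) \<and> 0 \<in> set (L0 1)" by (simp add: L0_def)
    have R: "(\<forall>a\<in>{0, 1}. a \<in> set (R0 a) \<and> set (R0 a) \<subseteq> {0, 1}) \<and> 0 \<in> set (R0 1)" by (simp add: R0_def)
    have m0: "maps_to L0 (prep [0] (cw (farey \<gamma>))) (prep [0] (cw \<gamma>))"
      using maps_to_prep[OF m, of 0] by (simp add: L0_simps)
    have m1: "maps_to R0 (prep [1] (cw (farey \<gamma>))) (prep [1] (cw \<gamma>))"
      using maps_to_R0[OF m] by simp
    from t consider "t = []" | "t = [0]" | "t = [1]" unfolding T3_def by blast
    then show ?thesis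
    proof cases
      case 1 show ?thesis unfolding 1 by (rule exI[of _ L0]) (use m L in simp)
    next
      case 2 show ?thesis unfolding 2 by (rule exI[of _ L0]) (intro conjI m0 L[THEN conjunct1] L[THEN conjunct2])
    next
      case 3 show ?thesis unfolding 3 by (rule exI[of _ R0]) (intro conjI m1 R[THEN conjunct1] R[THEN conjunct2])
    qed
  qed
  show ?thesis
  proof (cases "\<gamma> < 1/2")
    case True
    then show ?thesis using low[OF s True t] by auto
  next
    case False
    then have lt: "1 - \<gamma> < 1/2" using slope_half[OF s] by simp
    obtain X where X: "maps_to X (prep (map swap01 t) (cw (farey (1 - \<gamma>)))) (prep (map swap01 t) (cw (1 - \<gamma>)))"
      "\<forall>a\<in>{0, 1}. a \<in> set (X a) \<and> set (X a) \<subseteq> {0, 1}" "0 \<in> set (X 1)"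
      using low[OF slope_swap[OF s] lt T3_swap[OF t]] by blast
    let ?X = "\<lambda>a. map swap01 (X (swap01 a))"
    have "maps_to ?X (prep t (cw (farey \<gamma>))) (prep t (cw \<gamma>))"
      using maps_to_swap[OF X(1)] prep_cw_swap[OF s, of t] prep_cw_swap[OF slope_farey[OF s], of t]
      by (simp only: farey_swap[OF s])
    moreover have "\<forall>a\<in>{0, 1}. a \<in> set (?X a) \<and> set (?X a) \<subseteq> {0, 1}"
      using X(2) by (force simp: image_iff image_subset_iff)
    moreover have "1 \<in> set (?X 0)" using X(3) by force
    ultimately show ?thesis using False by (intro exI[of _ ?X]) auto
  qed
qed

lemma substitution_iterate:
  assumes s: "slope \<gamma>" and t: "t \<in> T3"
  shows "\<exists>\<psi>. maps_to \<psi> (prep t (cw ((farey ^^ n) \<gamma>))) (prep t (cw \<gamma>)) \<and>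
    (\<forall>a\<in>{0, 1}. a \<in> set (\<psi> a) \<and> set (\<psi> a) \<subseteq> {0, 1}) \<and>
    ((\<exists>k<n. (farey ^^ k) \<gamma> < 1/2) \<longrightarrow> 0 \<in> set (\<psi> 1)) \<and>
    ((\<exists>k<n. (farey ^^ k) \<gamma> > 1/2) \<longrightarrow> 1 \<in> set (\<psi> 0))"
proof (induction n)
  case 0
  have "mimage (\<lambda>a. [a]) x = x" for x by (induction x) simp_all
  then have "maps_to (\<lambda>a. [a]) w w" for w unfolding maps_to_def by simp
  then show ?case by (intro exI[of _ "\<lambda>a. [a]"]) auto
next
  case (Suc n)
  then obtain \<psi> where \<psi>: "maps_to \<psi> (prep t (cw ((farey ^^ n) \<gamma>))) (prep t (cw \<gamma>))"
    "\<forall>a\<in>{0, 1}. a \<in> set (\<psi> a) \<and> set (\<psi> a) \<subseteq> {0, 1}"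
    "(\<exists>k<n. (farey ^^ k) \<gamma> < 1/2) \<longrightarrow> 0 \<in> set (\<psi> 1)"
    "(\<exists>k<n. (farey ^^ k) \<gamma> > 1/2) \<longrightarrow> 1 \<in> set (\<psi> 0)" by (elim exE conjE)
  let ?\<gamma> = "(farey ^^ n) \<gamma>"
  obtain X where X: "maps_to X (prep t (cw (farey ?\<gamma>))) (prep t (cw ?\<gamma>))"
    "\<forall>a\<in>{0, 1}. a \<in> set (X a) \<and> set (X a) \<subseteq> {0, 1}"
    "?\<gamma> < 1/2 \<longrightarrow> 0 \<in> set (X 1)" "?\<gamma> > 1/2 \<longrightarrow> 1 \<in> set (X 0)"
    using substitution_step[OF slope_farey_funpow[OF s, of n] t] by (elim exE conjE)
  define \<psi>' where "\<psi>' a = mimage \<psi> (X a)" for a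
  have set': "set (\<psi>' a) = (\<Union>b\<in>set (X a). set (\<psi> b))" for a by (simp add: \<psi>'_def set_mimage)
  have "maps_to \<psi>' (prep t (cw ((farey ^^ Suc n) \<gamma>))) (prep t (cw \<gamma>))"
    using maps_to_comp[OF \<psi>(1) X(1)] by (simp add: \<psi>'_def[abs_def])
  moreover have "a \<in> set (\<psi>' a) \<and> set (\<psi>' a) \<subseteq> {0, 1}" if "a \<in> {0, 1}" for a
  proof
    show "a \<in> set (\<psi>' a)" unfolding set' using bspec[OF \<psi>(2) that] bspec[OF X(2) that] by blast
    have "set (X a) \<subseteq> {0, 1}" using bspec[OF X(2) that] by simp
    then show "set (\<psi>' a) \<subseteq> {0, 1}" unfolding set' using \<psi>(2) by (intro UN_least) (meson subsetD)
  qed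
  moreover have "0 \<in> set (\<psi>' 1)" if "\<exists>k<Suc n. (farey ^^ k) \<gamma> < 1/2"
  proof -
    from that consider "\<exists>k<n. (farey ^^ k) \<gamma> < 1/2" | "?\<gamma> < 1/2" by (metis less_Suc_eq)
    then show ?thesis
    proof cases
      case 1 then show ?thesis unfolding set' using \<psi>(3) X(2) by (intro UN_I[of 1]) simp_all
    next
      case 2 then show ?thesis unfolding set' using X(3) \<psi>(2) by (intro UN_I[of 0]) simp_all
    qed
  qed
  moreover have "1 \<in> set (\<psi>' 0)" if "\<exists>k<Suc n. (farey ^^ k) \<gamma> > 1/2"
  proof -
    from that consider "\<exists>k<n. (farey ^^ k) \<gamma> > 1/2" | "?\<gamma> > 1/2" by (metis less_Suc_eq)
    then show ?thesis
    proof cases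
      case 1 then show ?thesis unfolding set' using \<psi>(4) X(2) by (intro UN_I[of 0]) simp_all
    next
      case 2 then show ?thesis unfolding set' using X(4) \<psi>(2) by (intro UN_I[of 1]) simp_all
    qed
  qed
  ultimately show ?case by (intro exI[of _ \<psi>'] conjI ballI impI) simp_all
qed

lemma farey_increase: "slope \<gamma> \<Longrightarrow> \<gamma> < 1/2 \<Longrightarrow> \<gamma> < farey \<gamma>"
  by (auto simp: farey_def slope_def less_divide_eq algebra_simps)

lemma farey_decrease:
  assumes "slope \<gamma>" "\<gamma> > 1/2" shows "farey \<gamma> < \<gamma>"
  using farey_increase[OF slope_swap[OF assms(1)]] assms(2) farey_swap[OF assms(1)] by simp

text \<open>The slope rises below \<open>1/2\<close> and falls above it, so a cycle visits both
  sides. One kind of step puts 0 into the image of 1, the other puts 1 into the image of 0.\<close>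

lemma fixing_substitution:
  assumes s: "slope \<gamma>" and t: "t \<in> T3" and per: "(farey ^^ m) \<gamma> = \<gamma>" "m \<ge> 1"
  shows "\<exists>\<psi>. maps_to \<psi> (prep t (cw \<gamma>)) (prep t (cw \<gamma>)) \<and> set (\<psi> 0) = {0, 1} \<and> set (\<psi> 1) = {0, 1}"
proof -
  note sk = slope_farey_funpow[OF s]
  have "\<exists>k<m. (farey ^^ k) \<gamma> < 1/2"
  proof (rule ccontr)
    assume "\<not> ?thesis"
    then have gt: "(farey ^^ k) \<gamma> > 1/2" if "k < m" for k
      using that slope_half[OF sk[of k]] by (meson linorder_neqE_linordered_idom)
    have "k \<le> m \<Longrightarrow> k \<ge> 1 \<Longrightarrow> (farey ^^ k) \<gamma> < \<gamma>" for k
    proof (induction k)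
      case (Suc k)
      then show ?case using farey_decrease[OF sk gt, of k] by (cases "k = 0") auto
    qed simp
    from this[of m] show False using per by simp
  qed
  moreover have "\<exists>k<m. (farey ^^ k) \<gamma> > 1/2"
  proof (rule ccontr)
    assume "\<not> ?thesis"
    then have lt: "(farey ^^ k) \<gamma> < 1/2" if "k < m" for k
      using that slope_half[OF sk[of k]] by (meson linorder_neqE_linordered_idom)
    have "k \<le> m \<Longrightarrow> k \<ge> 1 \<Longrightarrow> (farey ^^ k) \<gamma> > \<gamma>" for k
    proof (induction k)
      case (Suc k)
      then show ?case using farey_increase[OF sk lt, of k] by (cases "k = 0") auto
    qed simp
    from this[of m] show False using per by simp
  qed
  moreover obtain \<psi> where \<psi>: "maps_to \<psi> (prep t (cw ((farey ^^ m) \<gamma>))) (prep t (cw \<gamma>))"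
    "\<forall>a\<in>{0, 1}. a \<in> set (\<psi> a) \<and> set (\<psi> a) \<subseteq> {0, 1}"
    "(\<exists>k<m. (farey ^^ k) \<gamma> < 1/2) \<longrightarrow> 0 \<in> set (\<psi> 1)"
    "(\<exists>k<m. (farey ^^ k) \<gamma> > 1/2) \<longrightarrow> 1 \<in> set (\<psi> 0)"
    using substitution_iterate[OF s t, of m] by (elim exE conjE)
  ultimately have in': "0 \<in> set (\<psi> 1)" "1 \<in> set (\<psi> 0)" by simp_all
  have "0 \<in> set (\<psi> 0)" "set (\<psi> 0) \<subseteq> {0, 1}" "1 \<in> set (\<psi> 1)" "set (\<psi> 1) \<subseteq> {0, 1}"
    using \<psi>(2) by simp_all
  then have "set (\<psi> 0) = {0, 1}" "set (\<psi> 1) = {0, 1}" using in' by blast+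
  then show ?thesis using \<psi>(1) per by auto
qed

lemma primitive_substitutionI:
  assumes mt: "maps_to \<psi> w w" and w0: "w 0 \<in> {0, 1}"
    and s0: "set (\<psi> 0) = {0, 1}" and s1: "set (\<psi> 1) = {0, 1}"
  shows "primitive_substitution {0, 1} \<psi>"
proof -
  have sets: "set (\<psi> a) = {0, 1}" if "a \<in> {0, 1}" for a
  proof -
    from that have "a = 0 \<or> a = 1" by simp
    then show ?thesis by (elim disjE) (simp_all only: s0 s1)
  qed
  have len: "length (\<psi> a) \<ge> 2" if "a \<in> {0, 1}" for a
    using card_length[of "\<psi> a"] sets[OF that] by simp
  have "primitive_morphism {0, 1} \<psi>"
    unfolding primitive_morphism_def
    by (intro conjI exI[of _ 1]) (auto simp: sets)
  moreover have "substitution {0, 1} \<psi>"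
    unfolding substitution_def
  proof (intro conjI bexI[of _ "w 0"] exI[of _ "tl (\<psi> (w 0))"])
    show "\<forall>a\<in>{0, 1}. set (\<psi> a) \<subseteq> {0, 1}" using sets by simp
    show "tl (\<psi> (w 0)) \<noteq> []" using len[OF w0] by (cases "\<psi> (w 0)") auto
    have "0 < length (\<psi> (w 0))" using len[OF w0] by linarith
    from maps_to_nth[OF mt this] have "\<psi> (w 0) ! 0 = w 0" by simp
    then show "\<psi> (w 0) = w 0 # tl (\<psi> (w 0))" using len[OF w0] by (cases "\<psi> (w 0)") auto
    have grow: "length (mimage \<psi> z) \<ge> 2 * length z" if "set z \<subseteq> {0, 1}" for z
      using that
    proof (induction z)
      case (Cons a z) then show ?case using len[of a] by auto
    qed simp
    have "set ((mimage \<psi> ^^ n) [w 0]) \<subseteq> {0, 1} \<and> length ((mimage \<psi> ^^ n) [w 0]) \<ge> Suc n" for n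
    proof (induction n)
      case 0 then show ?case using w0 by simp
    next
      case (Suc n)
      then have "set ((mimage \<psi> ^^ Suc n) [w 0]) \<subseteq> {0, 1}" using sets by (auto simp: set_mimage)
      then show ?case using grow[of "(mimage \<psi> ^^ n) [w 0]"] Suc by simp
    qed
    then have "n \<le> length ((mimage \<psi> ^^ n) [w 0])" for n by (meson Suc_leD)
    then show "filterlim (\<lambda>n. length ((mimage \<psi> ^^ n) [w 0])) at_top sequentially"
      by (intro filterlim_at_top_mono[OF filterlim_ident] always_eventually) simp
    show "w 0 \<in> {0, 1}" by (rule w0)
  qed
  ultimately show ?thesis by (simp add: primitive_substitution_def)
qed

text \<open>Subtractive Euclid on the columns. For nonnegative entries and determinant 1, one column
  dominates the other or the matrix is the identity. Subtracting the dominated column is one Farey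
  step on the slope of the image of \<open>(f0, f1)\<close>.\<close>

lemma farey_matrix:
  fixes a b c d :: int and f0 f1 :: real
  assumes "a \<ge> 0" "b \<ge> 0" "c \<ge> 0" "d \<ge> 0" "a * d - b * c = 1" "f0 > 0" "f1 > 0"
  shows "\<exists>n. (farey ^^ n) ((f0 * b + f1 * d) / ((f0 * a + f1 * c) + (f0 * b + f1 * d))) = f1 / (f0 + f1)
     \<and> (n = 0 \<longrightarrow> a = 1 \<and> b = 0 \<and> c = 0 \<and> d = 1)"
  using assms(1-5)
proof (induction "nat (a + b + c + d)" arbitrary: a b c d rule: less_induct)
  case less
  let ?g0 = "f0 * a + f1 * c" and ?g1 = "f0 * b + f1 * d"
  have pos: "f0 * x + f1 * y > 0" if "x \<ge> 0" "y \<ge> 0" "x > 0 \<or> y > 0" for x y :: int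
    using that assms(6,7) by (auto simp: add_pos_nonneg add_nonneg_pos)
  have col0: "a > 0 \<or> c > 0" and col1: "b > 0 \<or> d > 0"
    using less.prems by (cases "a = 0"; cases "c = 0"; cases "b = 0"; cases "d = 0"; auto)+
  have g0: "?g0 > 0" and g1: "?g1 > 0" using pos col0 col1 less.prems by auto
  consider "b \<le> a \<and> d \<le> c" | "a \<le> b \<and> c \<le> d" | "a < b \<and> d < c" | "b < a \<and> c < d" by linarith
  then show ?case
  proof cases
    case 1
    have ne: "a - b > 0 \<or> c - d > 0"
    proof (rule ccontr)
      assume "\<not> ?thesis"
      then have "a = b" "c = d" using 1 by auto
      then show False using less.prems(5) by simp
    qed
    have det: "(a - b) * d - b * (c - d) = 1" using less.prems(5) by (simp add: algebra_simps)
    have "nat ((a - b) + b + (c - d) + d) < nat (a + b + c + d)"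
      using col1 less.prems by auto
    from less.hyps[OF this _ less.prems(2) _ less.prems(4) det] 1 obtain n where
      n: "(farey ^^ n) (?g1 / ((f0 * (a - b) + f1 * (c - d)) + ?g1)) = f1 / (f0 + f1)" by auto
    have d0: "f0 * (a - b) + f1 * (c - d) > 0" using pos[of "a - b" "c - d"] ne 1 by simp
    then have lt: "?g1 < ?g0" by (simp add: algebra_simps)
    then have "farey (?g1 / (?g0 + ?g1)) = ?g1 / ?g0"
      using g0 g1 by (simp add: farey_def divide_simps)
    also have "\<dots> = ?g1 / ((f0 * (a - b) + f1 * (c - d)) + ?g1)" by (simp add: algebra_simps)
    finally have "(farey ^^ Suc n) (?g1 / (?g0 + ?g1)) = f1 / (f0 + f1)"
      using n by (simp add: funpow_swap1)
    then show ?thesis by blast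
  next
    case 2
    have ne: "b - a > 0 \<or> d - c > 0"
    proof (rule ccontr)
      assume "\<not> ?thesis"
      then have "a = b" "c = d" using 2 by auto
      then show False using less.prems(5) by simp
    qed
    have det: "a * (d - c) - (b - a) * c = 1" using less.prems(5) by (simp add: algebra_simps)
    have "nat (a + (b - a) + c + (d - c)) < nat (a + b + c + d)"
      using col0 less.prems by auto
    from less.hyps[OF this less.prems(1) _ less.prems(3) _ det] 2 obtain n where
      n: "(farey ^^ n) ((f0 * (b - a) + f1 * (d - c)) / (?g0 + (f0 * (b - a) + f1 * (d - c)))) = f1 / (f0 + f1)"
      by auto
    have d0: "f0 * (b - a) + f1 * (d - c) > 0" using pos[of "b - a" "d - c"] ne 2 by simp
    then have lt: "?g0 < ?g1" by (simp add: algebra_simps)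
    then have "farey (?g1 / (?g0 + ?g1)) = (?g1 - ?g0) / ?g1"
      using g0 g1 by (simp add: farey_def divide_simps)
    also have "\<dots> = (f0 * (b - a) + f1 * (d - c)) / (?g0 + (f0 * (b - a) + f1 * (d - c)))"
      by (simp add: algebra_simps)
    finally have "(farey ^^ Suc n) (?g1 / (?g0 + ?g1)) = f1 / (f0 + f1)"
      using n by (simp add: funpow_swap1)
    then show ?thesis by blast
  next
    case 3
    then have "a * d \<le> b * c" using less.prems by (intro mult_mono) auto
    then show ?thesis using less.prems(5) by linarith
  next
    case 4
    \<comment> \<open>Both diagonal entries exceed their row neighbours, and with determinant 1 this
      leaves the identity.\<close>
    then have "(b + 1) * (c + 1) \<le> a * d" using less.prems by (intro mult_mono) auto
    then have "b + c \<le> 0" using less.prems(5) by (simp add: algebra_simps)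
    then have bc: "b = 0" "c = 0" using less.prems by auto
    then have "a * d = 1" using less.prems(5) by simp
    then have "a = 1" "d = 1" using less.prems by (auto simp: zmult_eq_1_iff)
    then show ?thesis using bc by (intro exI[of _ 0]) simp
  qed
qed

text \<open>The frequency vector is an eigenvector, so Euclid on the incidence matrix starts and
  ends at slope \<gamma>. At least one step occurs because the image of 0 has more than one
  letter.\<close>

lemma (in coding_fixed) farey_periodic: "\<exists>m\<ge>1. (farey ^^ m) \<gamma> = \<gamma>"
proof -
  have nn: "pz \<ge> 0" "p1 \<ge> 0" "qz \<ge> 0" "q1 \<ge> 0" by (simp_all add: pz_def p1_def qz_def q1_def)
  let ?g0 = "(1 - \<gamma>) * of_int pz + \<gamma> * of_int qz" and ?g1 = "(1 - \<gamma>) * of_int p1 + \<gamma> * of_int q1"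
  obtain n where n: "(farey ^^ n) (?g1 / (?g0 + ?g1)) = \<gamma> / (1 - \<gamma> + \<gamma>)"
    "n = 0 \<longrightarrow> pz = 1 \<and> p1 = 0 \<and> qz = 0 \<and> q1 = 1"
    using farey_matrix[OF nn det_one, of "1 - \<gamma>" \<gamma>] \<gamma>0 \<gamma>1 by auto
  have "?g0 + ?g1 \<noteq> 0"
  proof -
    have "real p = of_int pz + of_int p1" "real q = of_int qz + of_int q1"
      using p_split q_split by (metis of_int_add of_int_of_nat_eq)+
    then have "?g0 + ?g1 = (1 - \<gamma>) * real p + \<gamma> * real q"
      by (simp add: algebra_simps)
    moreover have "real p > 0" "real q > 0" using p2 q2 by linarith+
    then have "(1 - \<gamma>) * real p > 0" "\<gamma> * real q > 0"
      using \<gamma>0 \<gamma>1 by (intro mult_pos_pos; linarith)+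
    ultimately show ?thesis by linarith
  qed
  then have "?g1 / (?g0 + ?g1) = \<gamma>" using slope_eq by (simp add: field_simps)
  then have "(farey ^^ n) \<gamma> = \<gamma>" using n(1) by simp
  moreover have "n \<noteq> 0" using n(2) p_split p2 by auto
  ultimately show ?thesis by (intro exI[of _ n]) auto
qed

section \<open>Special words have closeable substitutions\<close>

lemma code_unfold:
  "code f \<gamma> \<rho> = case_nat (if pos f (\<rho> - (1 - \<gamma>)) then 1 else 0) (code f \<gamma> (rot f \<gamma> \<rho>))"
proof
  fix n
  show "code f \<gamma> \<rho> n = case_nat (if pos f (\<rho> - (1 - \<gamma>)) then 1 else 0) (code f \<gamma> (rot f \<gamma> \<rho>)) n"
  proof (cases n)
    case 0 then show ?thesis by (simp add: code_def)
  next
    case (Suc m) then show ?thesis using code_shift[of f \<gamma> 1 \<rho> m] by simp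
  qed
qed

lemma code_zero: "slope \<gamma> \<Longrightarrow> code True \<gamma> 0 = prep [0] (cw \<gamma>)"
  by (subst code_unfold) (auto simp: slope_def pos_def rot_def cw_def)

lemma code_one: "slope \<gamma> \<Longrightarrow> code False \<gamma> 1 = prep [1] (cw \<gamma>)"
  by (subst code_unfold) (auto simp: slope_def pos_def rot_def cw_flag)

text \<open>At the discontinuity the conventions part: the lower exchange moves to 0, the upper one
  to 1.\<close>

lemma code_one_minus:
  assumes "slope \<gamma>"
  shows "code True \<gamma> (1 - \<gamma>) = prep [1, 0] (cw \<gamma>)" "code False \<gamma> (1 - \<gamma>) = prep [0, 1] (cw \<gamma>)"
  by (subst code_unfold, use code_zero[OF assms] code_one[OF assms] in \<open>simp add: pos_def rot_def\<close>)+

lemma (in coding) slope_gamma: "slope \<gamma>"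
  using irr \<gamma>0 \<gamma>1 by (simp add: slope_def)

lemma (in coding) special_prep:
  assumes "\<rho> \<in> {0, \<gamma>, 1 - \<gamma>, 1}"
  shows "\<exists>t\<in>T5. u = prep t (cw \<gamma>)"
proof -
  note s = slope_gamma
  consider "\<rho> = 0" | "\<rho> = \<gamma>" | "\<rho> = 1 - \<gamma>" | "\<rho> = 1" using assms by blast
  then show ?thesis
  proof cases
    case 1
    then have "f" using \<rho>0 by (auto simp: pos_def split: if_splits)
    then have "u = prep [0] (cw \<gamma>)" using code_zero[OF s] 1 by simp
    then show ?thesis by (intro bexI[of _ "[0]"]) (simp_all add: T5_def)
  next
    case 2
    then have "u = prep [] (cw \<gamma>)" using cw_flag[OF s] by simp
    then show ?thesis by (intro bexI[of _ "[]"]) (simp_all add: T5_def)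
  next
    case 3
    show ?thesis
    proof (cases f)
      case True
      then have "u = prep [1, 0] (cw \<gamma>)" using code_one_minus[OF s] 3 by simp
      then show ?thesis by (intro bexI[of _ "[1, 0]"]) (simp_all add: T5_def)
    next
      case False
      then have "u = prep [0, 1] (cw \<gamma>)" using code_one_minus[OF s] 3 by simp
      then show ?thesis by (intro bexI[of _ "[0, 1]"]) (simp_all add: T5_def)
    qed
  next
    case 4
    then have "\<not> f" using \<rho>1 by (auto simp: pos_def split: if_splits)
    then have "u = prep [1] (cw \<gamma>)" using code_one[OF s] 4 by simp
    then show ?thesis by (intro bexI[of _ "[1]"]) (simp_all add: T5_def)
  qed
qed

lemma prep_special:
  assumes s: "slope \<gamma>" and t: "t \<in> T3"
  shows "\<exists>f \<rho>. coding f \<gamma> \<rho> \<and> \<rho> \<in> {0, \<gamma>, 1 - \<gamma>, 1} \<and> prep t (cw \<gamma>) = code f \<gamma> \<rho>"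
proof -
  have c0: "coding True \<gamma> 0" and c1: "coding False \<gamma> 1"
    using s by (unfold_locales) (auto simp: slope_def pos_def)
  from t consider "t = []" | "t = [0]" | "t = [1]" unfolding T3_def by blast
  then show ?thesis
  proof cases
    case 1
    then show ?thesis using coding_slope[OF s, of True]
      by (intro exI[of _ True] exI[of _ \<gamma>]) (simp add: cw_def)
  next
    case 2
    then show ?thesis using c0 code_zero[OF s] by (intro exI[of _ True] exI[of _ 0]) simp
  next
    case 3
    then show ?thesis using c1 code_one[OF s] by (intro exI[of _ False] exI[of _ 1]) simp
  qed
qed

text \<open>A second fixed point begins with the other letter, so the images begin differently. This
  forces \<rho> to be \<open>1 - \<gamma>\<close>, and the second word is the coding of that point
  with the other convention.\<close>

lemma (in coding) all_fixed_points_special: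
  assumes sp: "\<rho> \<in> {0, \<gamma>, 1 - \<gamma>, 1}" and pm: "primitive_morphism A \<phi>"
    and fp: "fixed_point A \<phi> u" and fw: "fixed_point A \<phi> w"
  shows "\<exists>t\<in>T5. w = prep t (cw \<gamma>)"
proof (cases "w 0 = u 0")
  case True
  then have "w = u" using fixed_point_unique[OF pm fp fw] by simp
  then show ?thesis using special_prep[OF sp] by simp
next
  case False
  obtain \<Phi> where \<Phi>: "coding_fixed f \<gamma> \<rho> \<Phi>" "\<And>w. maps_to \<phi> w w \<Longrightarrow> maps_to \<Phi> w w"
    using power_coding_fixed[OF pm fp] by blast
  interpret F: coding_fixed f \<gamma> \<rho> \<Phi> by (rule \<Phi>(1))
  have mw: "maps_to \<Phi> w w" using fw \<Phi>(2) by (simp add: fixed_point_iff)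
  have w0: "w 0 = 0 \<or> w 0 = 1"
    using fw alphabet[OF pm fp] by (auto simp: fixed_point_iff image_subset_iff)
  have lens: "0 < length (\<Phi> 0)" "0 < length (\<Phi> 1)" using F.p2 F.q2 by auto
  have hdu: "\<Phi> (u 0) ! 0 = u 0" using maps_to_nth[OF F.mt, of 0 0] F.phi_ne[of 0] by simp
  have "0 < length (\<Phi> (w 0))" using w0 lens by metis
  from maps_to_nth[OF mw this] have hdw: "\<Phi> (w 0) ! 0 = w 0" by simp
  have "\<Phi> 0 ! 0 \<noteq> \<Phi> 1 ! 0" using hdu hdw False w0 u_01[of 0] by metis
  then have r: "\<rho> = 1 - \<gamma>" by (rule F.distinct_first_letters)
  interpret G: coding "\<not> f" \<gamma> \<rho>
    using irr \<gamma>0 \<gamma>1 r by unfold_locales (auto intro: pos_gt dest: pos_ge)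
  have mg: "maps_to \<Phi> G.u G.u" by (rule F.other_flag[OF r])
  have "G.u 0 \<noteq> u 0" using r by (cases f) (auto simp: code_def pos_def)
  then have "w 0 = G.u 0" using False w0 u_01[of 0] G.u_01[of 0] by metis
  moreover have "length (\<Phi> (w 0)) \<ge> 2" using w0 F.p2 F.q2 by metis
  moreover have "\<Phi> (G.u n) \<noteq> []" for n
    using G.u_01[of n] lens by (metis length_greater_0_conv)
  ultimately have "G.u = w" using maps_to_unique[OF mg mw] by simp
  then show ?thesis using G.special_prep r by auto
qed

lemma (in coding) special_imp_closeable:
  assumes sp: "\<rho> \<in> {0, \<gamma>, 1 - \<gamma>, 1}" and ps: "primitive_substitution A \<phi>"
    and fp: "fixed_point A \<phi> u"
  shows "closeable_under_derivation A \<phi>"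
proof -
  have pm: "primitive_morphism A \<phi>" using ps by (simp add: primitive_substitution_def)
  note s = slope_gamma
  obtain \<Phi> where "coding_fixed f \<gamma> \<rho> \<Phi>" using power_coding_fixed[OF pm fp] by blast
  then interpret F: coding_fixed f \<gamma> \<rho> \<Phi> .
  obtain m where m: "m \<ge> 1" "(farey ^^ m) \<gamma> = \<gamma>" using F.farey_periodic by blast
  \<comment> \<open>Pure periodicity makes the Farey orbit finite and closed under further steps, so
    finitely many substitutions serve all derived words.\<close>
  define S where "S = (\<lambda>k. (farey ^^ k) \<gamma>) ` {..<m}"
  have S_all: "(farey ^^ k) \<gamma> \<in> S" for k
    using funpow_mod_eq[OF m(2), of k] m(1) unfolding S_def
    by (metis imageI lessThan_iff mod_less_divisor less_le_trans zero_less_one)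
  have S_slope: "slope \<gamma>'" if "\<gamma>' \<in> S" for \<gamma>'
    using that slope_farey_funpow[OF s] by (auto simp: S_def)
  have S_iter: "(farey ^^ k) \<gamma>' \<in> S" if g: "\<gamma>' \<in> S" for k \<gamma>'
  proof -
    obtain j where "\<gamma>' = (farey ^^ j) \<gamma>" using g by (auto simp: S_def)
    then have "(farey ^^ k) \<gamma>' = (farey ^^ (k + j)) \<gamma>" by (simp add: funpow_add)
    then show ?thesis using S_all by metis
  qed
  have S_per: "(farey ^^ m) \<gamma>' = \<gamma>'" if g: "\<gamma>' \<in> S" for \<gamma>'
  proof -
    obtain j where j: "\<gamma>' = (farey ^^ j) \<gamma>" using g by (auto simp: S_def)
    have "(farey ^^ m) \<gamma>' = (farey ^^ (m + j)) \<gamma>" unfolding j by (simp add: funpow_add)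
    also have "\<dots> = (farey ^^ (j + m)) \<gamma>" by (simp add: add.commute)
    also have "\<dots> = \<gamma>'" using m(2) j by (simp add: funpow_add)
    finally show ?thesis .
  qed
  have "\<exists>\<psi>. maps_to \<psi> (prep t (cw \<gamma>')) (prep t (cw \<gamma>')) \<and> set (\<psi> 0) = {0, 1} \<and> set (\<psi> 1) = {0, 1}"
    if "\<gamma>' \<in> S" "t \<in> T3" for \<gamma>' t
    using fixing_substitution[OF S_slope[OF that(1)] that(2) S_per[OF that(1)] m(1)] .
  then obtain \<Psi> where \<Psi>: "\<And>\<gamma>' t. \<gamma>' \<in> S \<Longrightarrow> t \<in> T3 \<Longrightarrow>
      maps_to (\<Psi> \<gamma>' t) (prep t (cw \<gamma>')) (prep t (cw \<gamma>')) \<and>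
      set (\<Psi> \<gamma>' t 0) = {0, 1} \<and> set (\<Psi> \<gamma>' t 1) = {0, 1}"
    by metis
  have rng: "range (prep t (cw \<gamma>')) = {0, 1}" if "\<gamma>' \<in> S" "t \<in> T3" for \<gamma>' t
    by (rule range_prep[OF S_slope[OF that(1)] T5_letters[OF subsetD[OF T3_T5 that(2)]]])
  have \<Psi>_prim: "primitive_substitution {0, 1} (\<Psi> \<gamma>' t)" if "\<gamma>' \<in> S" "t \<in> T3" for \<gamma>' t
  proof -
    have "prep t (cw \<gamma>') 0 \<in> range (prep t (cw \<gamma>'))" by (rule rangeI)
    then have w0: "prep t (cw \<gamma>') 0 \<in> {0, 1}" unfolding rng[OF that] .
    from \<Psi>[OF that] show ?thesis 
      by (elim conjE) (rule primitive_substitutionI[where w = "prep t (cw \<gamma>')", OF _ w0])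
  qed
  have \<Psi>_fix: "fixed_point {0, 1} (\<Psi> \<gamma>' t) (prep t (cw \<gamma>'))" if "\<gamma>' \<in> S" "t \<in> T3" for \<gamma>' t
    unfolding fixed_point_iff rng[OF that] using \<Psi>[OF that] by simp
  define M where "M = insert (A, \<phi>) ((\<lambda>(\<gamma>', t). ({0, 1}, \<Psi> \<gamma>' t)) ` (S \<times> T3))"
  have "finite S" "finite T3" by (simp_all add: S_def T3_def)
  then have "finite M" unfolding M_def by simp
  have prim: "primitive_substitution B \<psi>" if "(B, \<psi>) \<in> M" for B \<psi>
    using that ps \<Psi>_prim unfolding M_def by auto
  \<comment> \<open>Closure concerns every fixed point of every member, including those other than
    the word for which the member was built.\<close>
  have form: "\<exists>\<gamma>'\<in>S. \<exists>t\<in>T5. w = prep t (cw \<gamma>')" if B: "(B, \<psi>) \<in> M" and w: "fixed_point B \<psi> w" for B \<psi> w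
  proof -
    consider "B = A" "\<psi> = \<phi>" | \<gamma>' t where "\<gamma>' \<in> S" "t \<in> T3" "B = {0, 1}" "\<psi> = \<Psi> \<gamma>' t"
      using B unfolding M_def by auto
    then show ?thesis
    proof cases
      case 1
      then have "\<exists>t\<in>T5. w = prep t (cw \<gamma>)" using w by (intro all_fixed_points_special[OF sp pm fp]) simp
      moreover have "\<gamma> \<in> S" using S_all[of 0] by simp
      ultimately show ?thesis by (rule bexI)
    next
      case (2 \<gamma>' t)
      obtain f' \<rho>' where c: "coding f' \<gamma>' \<rho>'" "\<rho>' \<in> {0, \<gamma>', 1 - \<gamma>', 1}"
        "prep t (cw \<gamma>') = code f' \<gamma>' \<rho>'"
        using prep_special[OF S_slope[OF 2(1)] 2(2)] by blast
      have "primitive_morphism B \<psi>" using prim[OF B] by (simp add: primitive_substitution_def)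
      moreover have "fixed_point B \<psi> (code f' \<gamma>' \<rho>')" using \<Psi>_fix[OF 2(1,2)] c(3) 2 by simp
      ultimately have "\<exists>t\<in>T5. w = prep t (cw \<gamma>')"
        by (rule coding.all_fixed_points_special[OF c(1,2) _ _ w])
      then show ?thesis using 2(1) by (rule bexI)
    qed
  qed
  have "closed_under_derivation M"
    unfolding closed_under_derivation_def
  proof (intro conjI)
    show "finite M" by fact
    show "\<forall>(A, \<phi>)\<in>M. primitive_substitution A \<phi>" using prim by blast
    have "\<exists>d. derived_word w v d \<and> (\<exists>(B, \<psi>)\<in>M. fixed_point B \<psi> d)"
      if B: "(B, \<psi>) \<in> M" and w: "fixed_point B \<psi> w" and v: "v \<noteq> []" "factor v w" for B \<psi> w v
    proof -
      obtain \<gamma>' t where g: "\<gamma>' \<in> S" "t \<in> T5" "w = prep t (cw \<gamma>')" using form[OF B w] by blast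
      obtain k t' where t': "t' \<in> T3" "derived_word w v (prep t' (cw ((farey ^^ k) \<gamma>')))"
        using derived_special[OF S_slope[OF g(1)] g(2) v(1)] v(2) unfolding g(3) by blast
      have "fixed_point {0, 1} (\<Psi> ((farey ^^ k) \<gamma>') t') (prep t' (cw ((farey ^^ k) \<gamma>')))"
        by (rule \<Psi>_fix[OF S_iter[OF g(1)] t'(1)])
      moreover have "({0, 1}, \<Psi> ((farey ^^ k) \<gamma>') t') \<in> M"
        unfolding M_def using S_iter[OF g(1), of k] t'(1) by force
      ultimately show ?thesis using t'(2) by blast
    qed
    then show "\<forall>(A, \<phi>)\<in>M. \<forall>u. fixed_point A \<phi> u \<longrightarrow> (\<forall>v. v \<noteq> [] \<and> factor v u \<longrightarrow>
        (\<exists>d. derived_word u v d \<and> (\<exists>(B, \<psi>)\<in>M. fixed_point B \<psi> d)))"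
      by (intro ballI, unfold split_paired_all prod.case) blast
  qed
  then show ?thesis using ps unfolding closeable_under_derivation_def M_def by blast
qed

theorem theorem33:
  fixes \<gamma> \<delta> :: real and u :: "nat \<Rightarrow> nat" and A :: "nat set" and \<phi> :: "nat \<Rightarrow> nat list"
  assumes "\<gamma> \<in> {0..1}" and "\<delta> \<in> {0..1}" and "\<gamma> \<notin> \<rat>"
    and "coding_2iet (1 - \<gamma>) \<gamma> \<delta> u"
    and "primitive_substitution A \<phi>" and "fixed_point A \<phi> u"
  shows "closeable_under_derivation A \<phi> \<longleftrightarrow> \<delta> \<in> {0, \<gamma>, 1 - \<gamma>, 1}"
proof -
  obtain f where f: "pos f \<delta>" "\<not> pos f (\<delta> - 1)" "u = code f \<gamma> \<delta>"
    using assms(4) unfolding coding_2iet_iff by blast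
  have "\<gamma> \<noteq> 0" "\<gamma> \<noteq> 1" using assms(3) by auto
  then interpret C: coding f \<gamma> \<delta>
    using assms(1,3) f by unfold_locales auto
  show ?thesis
    using C.closeable_imp_special C.special_imp_closeable assms(5,6) f(3) by blast
qed

end
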